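(* Let $S=\Bbbk[[H]]$ be a numerical semigroup ring which is not Gorenstein. Then $\operatorname{CM}(S)$ is of finite type if and only if one of the following holds: (1) $H=\langle 3,4,5\rangle$; (2) $H=\langle 3,5,7\rangle$.
   Context: $\Bbbk$ is an algebraically closed field of characteristic $0$. A numerical semigroup is a submonoid $H$ of $\mathbb N=\{0,1,2,\dots\}$ with finite complement; $\langle b_1,\dots,b_m\rangle$ denotes the semigroup generated by $b_1,\dots,b_m$, and for $H=\langle b_1,\dots,b_m\rangle$, $\Bbbk[[H]]=\Bbbk[[t^{b_1},\dots,t^{b_m}]]\subseteq\Bbbk[[t]]$. $\operatorname{CM}(S)$ is the category of (finitely generated) maximal Cohen–Macaulay $S$-modules; it is of finite type if it has only finitely many indecomposable objects up to isomorphism. *)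

theory Defs
  imports
    "HOL-Computational_Algebra.Computational_Algebra"
    "HOL-Library.Extended_Nat"
    "HOL-Algebra.Ring_Divisibility"
    "HOL-Algebra.Module"
begin

section \<open>Numerical semigroup rings\<close>

definition nat_submonoid :: "nat set \<Rightarrow> bool" where
  "nat_submonoid H \<longleftrightarrow> 0 \<in> H \<and> (\<forall>a\<in>H. \<forall>b\<in>H. a + b \<in> H)"

definition numerical_semigroup :: "nat set \<Rightarrow> bool" where
  "numerical_semigroup H \<longleftrightarrow> nat_submonoid H \<and> finite (- H)"

abbreviation nat_generated :: "nat set \<Rightarrow> nat set" where
  "nat_generated B \<equiv> nat_submonoid hull B"

text \<open>
  The ring \<open>k[[H]]\<close> is the ring of all power series with support in \<open>H\<close>.  That this is
  the ring \<open>k[[t^b1, ..., t^bm]]\<close> of power series in the \<open>t^bi\<close> whenever \<open>b1, ..., bm\<close> are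
  positive generators of \<open>H\<close> is lemma \<open>carrier_semigroup_ring_generated\<close> below.
\<close>

definition semigroup_ring :: "nat set \<Rightarrow> 'k::field fps ring" where
  "semigroup_ring H =
    \<lparr>carrier = {f. \<forall>n. fps_nth f n \<noteq> 0 \<longrightarrow> n \<in> H}, mult = (*), one = 1, zero = 0, add = (+)\<rparr>"

lemma cring_semigroup_ring:
  assumes "nat_submonoid H"
  shows "cring (semigroup_ring H :: 'k::field fps ring)"
proof -
  let ?S = "semigroup_ring H :: 'k fps ring"
  have mult: "n \<in> H" if "\<forall>n. fps_nth x n \<noteq> 0 \<longrightarrow> n \<in> H" "\<forall>n. fps_nth y n \<noteq> 0 \<longrightarrow> n \<in> H"
    "fps_nth (x * y) n \<noteq> 0" for x y :: "'k fps" and n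
  proof -
    obtain i where "i \<in> {0..n}" "fps_nth x i * fps_nth y (n - i) \<noteq> 0"
      using \<open>fps_nth (x * y) n \<noteq> 0\<close> unfolding fps_mult_nth by (meson sum.neutral)
    then have "i \<in> H" "n - i \<in> H" "i \<le> n"
      using that by auto
    then have "i + (n - i) \<in> H" "i \<le> n"
      using assms unfolding nat_submonoid_def by blast+
    then show ?thesis by simp
  qed
  have add: "n \<in> H" if "\<forall>n. fps_nth x n \<noteq> 0 \<longrightarrow> n \<in> H" "\<forall>n. fps_nth y n \<noteq> 0 \<longrightarrow> n \<in> H"
    "fps_nth (x + y) n \<noteq> 0" for x y :: "'k fps" and n
    using that by (metis add_cancel_right_right fps_add_nth)
  have "abelian_group ?S"
  proof (rule abelian_groupI)
    fix x y assume "x \<in> carrier ?S" "y \<in> carrier ?S"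
    then show "x \<oplus>\<^bsub>?S\<^esub> y \<in> carrier ?S"
      unfolding semigroup_ring_def by (simp del: fps_add_nth) (blast intro: add)
  next
    fix x assume "x \<in> carrier ?S"
    then show "\<exists>y\<in>carrier ?S. y \<oplus>\<^bsub>?S\<^esub> x = \<zero>\<^bsub>?S\<^esub>"
      by (intro bexI[of _ "- x"]) (auto simp: semigroup_ring_def)
  qed (simp_all add: semigroup_ring_def algebra_simps)
  moreover have "Group.comm_monoid ?S"
  proof (rule comm_monoidI)
    fix x y assume "x \<in> carrier ?S" "y \<in> carrier ?S"
    then show "x \<otimes>\<^bsub>?S\<^esub> y \<in> carrier ?S"
      unfolding semigroup_ring_def by simp (blast intro: mult)
  next
    show "\<one>\<^bsub>?S\<^esub> \<in> carrier ?S"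
      using assms by (simp add: semigroup_ring_def nat_submonoid_def)
  qed (simp_all add: semigroup_ring_def algebra_simps)
  ultimately show ?thesis
    by (rule cringI) (simp add: semigroup_ring_def algebra_simps)
qed

lemma nat_generated_list:
  "nat_generated (set bs) = {\<Sum>i<length bs. a ! i * bs ! i | a. length a = length bs}"
    (is "_ = ?D")
proof
  have "0 \<in> ?D"
    by (auto intro!: exI[of _ "replicate (length bs) 0"])
  moreover have "x + y \<in> ?D" if "x \<in> ?D" "y \<in> ?D" for x y
  proof -
    from that obtain a b
      where a: "x = (\<Sum>i<length bs. a ! i * bs ! i)" "length a = length bs"
        and b: "y = (\<Sum>i<length bs. b ! i * bs ! i)" "length b = length bs"
      by blast
    show ?thesis
      using a b by (auto intro!: exI[of _ "map (\<lambda>i. a ! i + b ! i) [0..<length bs]"]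
        simp: sum.distrib[symmetric] algebra_simps)
  qed
  ultimately have "nat_submonoid ?D"
    unfolding nat_submonoid_def by blast
  moreover have "set bs \<subseteq> ?D"
  proof
    fix b assume "b \<in> set bs"
    then obtain j where j: "j < length bs" "bs ! j = b" by (auto simp: in_set_conv_nth)
    have "(\<Sum>i<length bs. (if i = j then 1 else 0) * bs ! i) = b"
      using j by (simp add: if_distrib[of "\<lambda>x. x * _"] cong: if_cong)
    then show "b \<in> ?D"
      by (auto intro!: exI[of _ "map (\<lambda>i. if i = j then 1 else 0) [0..<length bs]"])
  qed
  ultimately show "nat_generated (set bs) \<subseteq> ?D" by (intro hull_minimal)
next
  let ?G = "nat_generated (set bs)"
  have "nat_submonoid ?G"
    by (rule hull_in) (auto simp: nat_submonoid_def)
  then have zero: "0 \<in> ?G" and add: "\<And>x y. x \<in> ?G \<Longrightarrow> y \<in> ?G \<Longrightarrow> x + y \<in> ?G"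
    by (simp_all only: nat_submonoid_def)
  have mul: "n * b \<in> ?G" if "b \<in> ?G" for n b
    using that by (induction n) (auto intro: zero add)
  have mem: "bs ! i \<in> ?G" if "i < length bs" for i
    using that hull_subset[of "set bs" nat_submonoid] by (meson nth_mem subsetD)
  have "(\<Sum>i<m. a ! i * bs ! i) \<in> ?G" if "m \<le> length bs" for a m
    using that
  proof (induction m)
    case 0
    then show ?case using zero by simp
  next
    case (Suc m)
    then show ?case using add[OF _ mul[OF mem]] by simp
  qed
  then show "?D \<subseteq> nat_generated (set bs)" by blast
qed

lemma carrier_semigroup_ring_generated:
  assumes "0 \<notin> set bs"
  shows "carrier (semigroup_ring (nat_generated (set bs)) :: 'k::field fps ring) =
    {Abs_fps (\<lambda>n. \<Sum>a | length a = length bs \<and> (\<Sum>i<length bs. a ! i * bs ! i) = n. c a) | c.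
      True}" (is "_ = ?P")
proof -
  define dot where "dot = (\<lambda>a. \<Sum>i<length bs. a ! i * bs ! i)"
  have fin: "finite {a. length a = length bs \<and> dot a = n}" for n
  proof (rule finite_subset)
    show "{a. length a = length bs \<and> dot a = n} \<subseteq> {a. set a \<subseteq> {..n} \<and> length a = length bs}"
    proof safe
      fix a x assume a: "length a = length bs" "n = dot a" "x \<in> set a"
      then obtain i where i: "i < length bs" "x = a ! i" by (metis in_set_conv_nth)
      have "0 < bs ! i" using assms i by (metis gr0I nth_mem)
      then have "x \<le> a ! i * bs ! i" using i by simp
      also have "\<dots> \<le> dot a"
        unfolding dot_def by (rule member_le_sum) (use i in auto)
      finally show "x \<le> dot a" .
    qed
  qed (simp add: finite_lists_length_eq)
  have "f \<in> ?P" if f: "\<forall>n. fps_nth f n \<noteq> 0 \<longrightarrow> (\<exists>a. length a = length bs \<and> dot a = n)"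
    for f :: "'k fps"
  proof -
    define rep where "rep n = (SOME a. length a = length bs \<and> dot a = n)" for n
    define c where "c a = (if a = rep (dot a) then fps_nth f (dot a) else 0)" for a
    have "fps_nth f n = (\<Sum>a | length a = length bs \<and> dot a = n. c a)" for n
    proof (cases "\<exists>a. length a = length bs \<and> dot a = n")
      case True
      then have "length (rep n) = length bs \<and> dot (rep n) = n"
        unfolding rep_def by (rule someI_ex)
      moreover have "(\<Sum>a | length a = length bs \<and> dot a = n. c a) =
          (\<Sum>a | length a = length bs \<and> dot a = n. if a = rep n then fps_nth f n else 0)"
        by (rule sum.cong) (auto simp: c_def)
      ultimately show ?thesis using fin[of n] by (simp add: sum.delta)
    next
      case False
      then have "{a. length a = length bs \<and> dot a = n} = {}" by blast
      then show ?thesis using f False by (metis sum.empty)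
    qed
    then have "f = Abs_fps (\<lambda>n. \<Sum>a | length a = length bs \<and> dot a = n. c a)"
      by (simp add: fps_eq_iff)
    then show ?thesis unfolding dot_def by blast
  qed
  moreover have "\<exists>a. length a = length bs \<and> dot a = n"
    if "(\<Sum>a | length a = length bs \<and> dot a = n. c a) \<noteq> (0::'k)" for c n
    using that by (metis (mono_tags, lifting) mem_Collect_eq sum.neutral)
  moreover have "carrier (semigroup_ring (nat_generated (set bs)) :: 'k fps ring) =
      {f. \<forall>n. fps_nth f n \<noteq> 0 \<longrightarrow> (\<exists>a. length a = length bs \<and> dot a = n)}"
    unfolding nat_generated_list semigroup_ring_def dot_def by fastforce
  ultimately show ?thesis
    unfolding dot_def by auto
qed


section \<open>Modules\<close>

definition mod_hom ::
    "('r, 'x) ring_scheme \<Rightarrow> ('r, 'a) module \<Rightarrow> ('r, 'b) module \<Rightarrow> ('a \<Rightarrow> 'b) set" where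
  "mod_hom R M N = {f. f \<in> carrier M \<rightarrow> carrier N \<and>
     (\<forall>x\<in>carrier M. \<forall>y\<in>carrier M. f (x \<oplus>\<^bsub>M\<^esub> y) = f x \<oplus>\<^bsub>N\<^esub> f y) \<and>
     (\<forall>r\<in>carrier R. \<forall>x\<in>carrier M. f (r \<odot>\<^bsub>M\<^esub> x) = r \<odot>\<^bsub>N\<^esub> f x)}"

definition mod_iso :: "('r, 'x) ring_scheme \<Rightarrow> ('r, 'a) module \<Rightarrow> ('r, 'b) module \<Rightarrow> bool" where
  "mod_iso R M N \<longleftrightarrow> (\<exists>f\<in>mod_hom R M N. bij_betw f (carrier M) (carrier N))"

definition fin_gen_module :: "('r, 'x) ring_scheme \<Rightarrow> ('r, 'a) module \<Rightarrow> bool" where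
  "fin_gen_module R M \<longleftrightarrow> Module.module R M \<and>
     (\<exists>A\<subseteq>carrier M. finite A \<and> (\<forall>N. submodule N R M \<longrightarrow> A \<subseteq> N \<longrightarrow> N = carrier M))"

definition indecomposable_module :: "('r, 'x) ring_scheme \<Rightarrow> ('r, 'a) module \<Rightarrow> bool" where
  "indecomposable_module R M \<longleftrightarrow> Module.module R M \<and> carrier M \<noteq> {\<zero>\<^bsub>M\<^esub>} \<and>
     (\<forall>A B. submodule A R M \<and> submodule B R M \<and>
        A <+>\<^bsub>M\<^esub> B = carrier M \<and> A \<inter> B = {\<zero>\<^bsub>M\<^esub>} \<longrightarrow>
        A = {\<zero>\<^bsub>M\<^esub>} \<or> B = {\<zero>\<^bsub>M\<^esub>})"

definition regular_module :: "('r, 'x) ring_scheme \<Rightarrow> ('r, 'r) module" where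
  "regular_module R = \<lparr>carrier = carrier R, mult = mult R, one = one R, zero = zero R, add = add R,
     smult = mult R\<rparr>"

text \<open>
  HOL cannot quantify over modules of all types inside a formula, so quantifiers over
  \<open>R\<close>-modules range over modules with elements in the following type.  It accommodates an
  isomorphic copy of every finitely generated \<open>R\<close>-module (lemma \<open>fin_gen_module_copy\<close>): an
  element of a quotient of \<open>R^n\<close> is a coset, that is, a set of finite sequences, and these are
  embedded in \<open>nat \<Rightarrow> 'r\<close>.
\<close>

type_synonym 'r mod_elt = "(nat \<Rightarrow> 'r) set"

lemma module_transport:
  assumes M: "Module.module R M" and inj: "inj_on h (carrier M)"
  defines "g \<equiv> inv_into (carrier M) h"
  defines "N \<equiv> \<lparr>carrier = h ` carrier M, mult = \<lambda>x y. undefined, one = undefined,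
     zero = h \<zero>\<^bsub>M\<^esub>, add = \<lambda>x y. h (g x \<oplus>\<^bsub>M\<^esub> g y), smult = \<lambda>r x. h (r \<odot>\<^bsub>M\<^esub> g x)\<rparr>"
  shows "Module.module R N \<and> mod_iso R M N"
proof -
  interpret M: Module.module R M by (rule M)
  have g [simp]: "g (h x) = x" if "x \<in> carrier M" for x
    using that inj by (simp add: g_def)
  have "abelian_group N"
  proof (rule abelian_groupI)
    fix x assume "x \<in> carrier N"
    then obtain u where "x = h u" "u \<in> carrier M" by (auto simp: N_def)
    then show "\<exists>y\<in>carrier N. y \<oplus>\<^bsub>N\<^esub> x = \<zero>\<^bsub>N\<^esub>"
      by (intro bexI[of _ "h (\<ominus>\<^bsub>M\<^esub> u)"]) (auto simp: N_def M.M.l_neg)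
  qed (auto simp: N_def M.M.a_ac)
  then have "Module.module R N"
    by (intro moduleI M.R.is_cring)
      (auto simp: N_def M.smult_l_distr M.smult_r_distr M.smult_assoc1)
  moreover have "mod_iso R M N"
    unfolding mod_iso_def using inj
    by (intro bexI[of _ h]) (auto simp: N_def mod_hom_def bij_betw_def)
  ultimately show ?thesis ..
qed

lemma fin_gen_module_copy:
  fixes R :: "('r, 'x) ring_scheme" and M :: "('r, 'a) module"
  assumes "fin_gen_module R M"
  shows "\<exists>N :: ('r, 'r mod_elt) module. Module.module R N \<and> mod_iso R M N"
proof -
  interpret M: Module.module R M using assms by (simp add: fin_gen_module_def)
  obtain A where A: "A \<subseteq> carrier M" "finite A"
    and gen: "\<And>N. submodule N R M \<Longrightarrow> A \<subseteq> N \<Longrightarrow> N = carrier M"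
    using assms unfolding fin_gen_module_def by metis
  obtain e :: "'a \<Rightarrow> nat" where e: "inj_on e A"
    using \<open>finite A\<close> finite_imp_inj_to_nat_seg by blast
  define comb where "comb c = (\<Oplus>\<^bsub>M\<^esub>a\<in>A. c (e a) \<odot>\<^bsub>M\<^esub> a)" for c :: "nat \<Rightarrow> 'r"
  define C where "C = {c :: nat \<Rightarrow> 'r. \<forall>i. c i \<in> carrier R}"
  have cl: "(\<lambda>a. c (e a) \<odot>\<^bsub>M\<^esub> a) \<in> A \<rightarrow> carrier M" if "c \<in> C" for c
    using that A by (auto simp: C_def)
  have "submodule (comb ` C) R M"
  proof (rule M.submoduleI)
    show "comb ` C \<subseteq> carrier M" using cl by (auto simp: comb_def)
    have "comb (\<lambda>_. \<zero>\<^bsub>R\<^esub>) = (\<Oplus>\<^bsub>M\<^esub>a\<in>A. \<zero>\<^bsub>M\<^esub>)"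
      unfolding comb_def by (rule M.M.finsum_cong') (use A in auto)
    also have "\<dots> = \<zero>\<^bsub>M\<^esub>" by simp
    finally show "\<zero>\<^bsub>M\<^esub> \<in> comb ` C" by (intro image_eqI[of _ _ "\<lambda>_. \<zero>\<^bsub>R\<^esub>"]) (auto simp: C_def)
  next
    fix x y assume "x \<in> comb ` C" "y \<in> comb ` C"
    then obtain c d where cd: "c \<in> C" "d \<in> C" "x = comb c" "y = comb d" by auto
    have "comb (\<lambda>i. c i \<oplus>\<^bsub>R\<^esub> d i) =
        (\<Oplus>\<^bsub>M\<^esub>a\<in>A. c (e a) \<odot>\<^bsub>M\<^esub> a \<oplus>\<^bsub>M\<^esub> d (e a) \<odot>\<^bsub>M\<^esub> a)"
      unfolding comb_def
      by (rule M.M.finsum_cong') (use cd A in \<open>auto simp: C_def M.smult_l_distr subset_iff\<close>)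
    also have "\<dots> = x \<oplus>\<^bsub>M\<^esub> y"
      unfolding cd comb_def by (rule M.M.finsum_addf) (use cl cd in auto)
    finally show "x \<oplus>\<^bsub>M\<^esub> y \<in> comb ` C"
      using cd by (intro image_eqI[of _ _ "\<lambda>i. c i \<oplus>\<^bsub>R\<^esub> d i"]) (auto simp: C_def)
  next
    fix r x assume r: "r \<in> carrier R" and "x \<in> comb ` C"
    then obtain c where c: "c \<in> C" "x = comb c" by auto
    have "comb (\<lambda>i. r \<otimes>\<^bsub>R\<^esub> c i) = (\<Oplus>\<^bsub>M\<^esub>a\<in>A. r \<odot>\<^bsub>M\<^esub> (c (e a) \<odot>\<^bsub>M\<^esub> a))"
      unfolding comb_def
      by (rule M.M.finsum_cong') (use r c A in \<open>auto simp: C_def M.smult_assoc1 subset_iff\<close>)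
    also have "\<dots> = r \<odot>\<^bsub>M\<^esub> x"
      unfolding c comb_def
      by (rule M.finsum_smult_ldistr[symmetric]) (use A r cl c in auto)
    finally show *: "r \<odot>\<^bsub>M\<^esub> x \<in> comb ` C"
      using c r by (intro image_eqI[of _ _ "\<lambda>i. r \<otimes>\<^bsub>R\<^esub> c i"]) (auto simp: C_def)
  next
    fix x assume "x \<in> comb ` C"
    then obtain c where c: "c \<in> C" "x = comb c" by auto
    have "comb (\<lambda>i. \<ominus>\<^bsub>R\<^esub> \<one>\<^bsub>R\<^esub> \<otimes>\<^bsub>R\<^esub> c i) = (\<Oplus>\<^bsub>M\<^esub>a\<in>A. (\<ominus>\<^bsub>R\<^esub> \<one>\<^bsub>R\<^esub>) \<odot>\<^bsub>M\<^esub> (c (e a) \<odot>\<^bsub>M\<^esub> a))"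
      unfolding comb_def
      by (rule M.M.finsum_cong')
        (use c A in \<open>auto simp: C_def M.smult_assoc1 subset_iff\<close>)
    also have "\<dots> = (\<ominus>\<^bsub>R\<^esub> \<one>\<^bsub>R\<^esub>) \<odot>\<^bsub>M\<^esub> x"
      unfolding c comb_def
      by (rule M.finsum_smult_ldistr[symmetric]) (use A cl c in auto)
    also have "\<dots> = \<ominus>\<^bsub>M\<^esub> x"
      using cl c by (simp add: M.smult_l_minus comb_def)
    finally show "\<ominus>\<^bsub>M\<^esub> x \<in> comb ` C"
      using c by (intro image_eqI[of _ _ "\<lambda>i. \<ominus>\<^bsub>R\<^esub> \<one>\<^bsub>R\<^esub> \<otimes>\<^bsub>R\<^esub> c i"]) (auto simp: C_def)
  qed
  moreover have "A \<subseteq> comb ` C"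
  proof
    fix b assume b: "b \<in> A"
    define c where "c i = (if i = e b then \<one>\<^bsub>R\<^esub> else \<zero>\<^bsub>R\<^esub>)" for i
    have "comb c = (\<Oplus>\<^bsub>M\<^esub>a\<in>A. if b = a then a else \<zero>\<^bsub>M\<^esub>)"
      unfolding comb_def
      by (rule M.M.finsum_cong') (use b A e in \<open>auto simp: c_def inj_on_eq_iff subset_iff\<close>)
    also have "\<dots> = b"
      by (rule M.M.finsum_singleton) (use b A in auto)
    finally show "b \<in> comb ` C" by (intro image_eqI[of _ _ c]) (auto simp: C_def c_def)
  qed
  ultimately have surj: "comb ` C = carrier M" by (rule gen)
  have "inj_on (\<lambda>x. {c \<in> C. comb c = x}) (carrier M)"
  proof (rule inj_onI)
    fix x y assume xy: "x \<in> carrier M" "y \<in> carrier M" "{c \<in> C. comb c = x} = {c \<in> C. comb c = y}"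
    then obtain c where "c \<in> C" "comb c = x" using surj by (metis imageE)
    then show "x = y" using xy by blast
  qed
  from module_transport[OF M.module_axioms this] show ?thesis by blast
qed


section \<open>Gorenstein local rings\<close>

definition noetherian_local_ring :: "('r, 'x) ring_scheme \<Rightarrow> bool" where
  "noetherian_local_ring R \<longleftrightarrow> cring R \<and> noetherian_ring R \<and> (\<exists>!m. maximalideal m R)"

text \<open>
  By Baer's criterion an \<open>R\<close>-module is injective as soon as it has the extension property for
  the ideals of \<open>R\<close>.  These have copies in \<open>'r mod_elt\<close>, so the restriction to
  test modules with elements in that type is harmless.
\<close>

definition injective_module :: "('r, 'x) ring_scheme \<Rightarrow> ('r, 'a) module \<Rightarrow> bool" where
  "injective_module R E \<longleftrightarrow> Module.module R E \<and>
     (\<forall>(M :: ('r, 'r mod_elt) module) N f.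
        Module.module R M \<and> submodule N R M \<and> f \<in> mod_hom R (M\<lparr>carrier := N\<rparr>) E \<longrightarrow>
        (\<exists>g\<in>mod_hom R M E. \<forall>x\<in>N. g x = f x))"

text \<open>
  Existence of an exact sequence \<open>0 \<rightarrow> M \<rightarrow> E 0 \<rightarrow> \<dots> \<rightarrow> E n \<rightarrow> 0\<close> with all \<open>E i\<close> injective.  The
  terms are indexed by all natural numbers and vanish beyond \<open>n\<close>.  For a finitely generated
  module over a Noetherian ring \<open>R\<close>, the terms of the minimal injective resolution have
  cardinality at most that of \<open>R\<close> or of \<open>nat\<close>, whichever is larger, hence have copies in
  \<open>'r mod_elt\<close>.
\<close>

definition finite_injective_dimension :: "('r, 'x) ring_scheme \<Rightarrow> ('r, 'a) module \<Rightarrow> bool" where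
  "finite_injective_dimension R M \<longleftrightarrow>
     (\<exists>n (E :: nat \<Rightarrow> ('r, 'r mod_elt) module) \<epsilon> d.
        (\<forall>i. injective_module R (E i)) \<and>
        (\<forall>i>n. carrier (E i) = {\<zero>\<^bsub>E i\<^esub>}) \<and>
        \<epsilon> \<in> mod_hom R M (E 0) \<and> inj_on \<epsilon> (carrier M) \<and>
        (\<forall>i. d i \<in> mod_hom R (E i) (E (Suc i))) \<and>
        \<epsilon> ` carrier M = {x \<in> carrier (E 0). d 0 x = \<zero>\<^bsub>E (Suc 0)\<^esub>} \<and>
        (\<forall>i. d i ` carrier (E i) =
           {x \<in> carrier (E (Suc i)). d (Suc i) x = \<zero>\<^bsub>E (Suc (Suc i))\<^esub>}))"

definition gorenstein_local_ring :: "('r, 'x) ring_scheme \<Rightarrow> bool" where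
  "gorenstein_local_ring R \<longleftrightarrow>
     noetherian_local_ring R \<and> finite_injective_dimension R (regular_module R)"


section \<open>Maximal Cohen--Macaulay modules\<close>

definition krull_dim :: "('r, 'x) ring_scheme \<Rightarrow> enat" where
  "krull_dim R = Sup {enat n | n.
     \<exists>P. (\<forall>i\<le>n. primeideal (P i) R) \<and> (\<forall>i<n. P i \<subset> P (Suc i))}"

definition max_ideal :: "('r, 'x) ring_scheme \<Rightarrow> 'r set" where
  "max_ideal R = (THE m. maximalideal m R)"

text \<open>The submodule \<open>(x1, ..., xn) M\<close> of \<open>M\<close>.\<close>

fun seq_smult :: "('r, 'a) module \<Rightarrow> 'r list \<Rightarrow> 'a set" where
  "seq_smult M [] = {\<zero>\<^bsub>M\<^esub>}"
| "seq_smult M (x # xs) = ((\<lambda>v. x \<odot>\<^bsub>M\<^esub> v) ` carrier M) <+>\<^bsub>M\<^esub> seq_smult M xs"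

text \<open>
  Each \<open>xs ! i\<close> is a nonzerodivisor on \<open>M / (xs ! 0, ..., xs ! (i - 1)) M\<close>, and
  \<open>M / (xs) M\<close> is nonzero.
\<close>

definition regular_sequence :: "('r, 'x) ring_scheme \<Rightarrow> ('r, 'a) module \<Rightarrow> 'r list \<Rightarrow> bool" where
  "regular_sequence R M xs \<longleftrightarrow> set xs \<subseteq> carrier R \<and>
     (\<forall>i<length xs. \<forall>v\<in>carrier M.
        (xs ! i) \<odot>\<^bsub>M\<^esub> v \<in> seq_smult M (take i xs) \<longrightarrow> v \<in> seq_smult M (take i xs)) \<and>
     seq_smult M xs \<noteq> carrier M"

definition depth :: "('r, 'x) ring_scheme \<Rightarrow> ('r, 'a) module \<Rightarrow> enat" where
  "depth R M = Sup {enat (length xs) | xs. set xs \<subseteq> max_ideal R \<and> regular_sequence R M xs}"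

text \<open>The zero module counts as maximal Cohen--Macaulay, so that these modules form an additive
  category.\<close>

definition maximal_CM_module :: "('r, 'x) ring_scheme \<Rightarrow> ('r, 'a) module \<Rightarrow> bool" where
  "maximal_CM_module R M \<longleftrightarrow> fin_gen_module R M \<and>
     (carrier M = {\<zero>\<^bsub>M\<^esub>} \<or> depth R M = krull_dim R)"

text \<open>
  Since direct summands of maximal Cohen--Macaulay modules are maximal Cohen--Macaulay, the
  indecomposable objects of the category are its members that are indecomposable as modules.
\<close>

definition finite_CM_type :: "('r, 'x) ring_scheme \<Rightarrow> bool" where
  "finite_CM_type R \<longleftrightarrow>
     (\<exists>X :: ('r, 'r mod_elt) module set. finite X \<and>
        (\<forall>M :: ('r, 'r mod_elt) module.
           maximal_CM_module R M \<and> indecomposable_module R M \<longrightarrow> (\<exists>N\<in>X. mod_iso R M N)))"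

end

theory Submission
  imports Defs "HOL-Library.Product_Plus" "HOL-Library.Function_Algebras"
begin

text \<open>
  Let \<open>S = k[[H]]\<close> contain \<open>k[[t^3, t^5, t^7]]\<close>.  A maximal Cohen--Macaulay module \<open>M\<close> is torsion
  free, and a \<open>k[[t]]\<close>-basis of \<open>k[[t]] M\<close> can be chosen inside \<open>M\<close>.  Hence, for a vector space \<open>V\<close> and
  a subspace \<open>\<Gamma>\<close> of \<open>V^3\<close>, \<open>M\<close> consists of the power series \<open>v\<close> over \<open>V\<close> whose coefficients satisfy
  \<open>(v 1, v 2, v 4) \<in> \<Gamma>\<close>.  If none of sixteen such modules of rank at most three were a direct summand
  of \<open>M\<close>, then separating vectors from subspaces by linear functionals would force \<open>V = 0\<close>.  So an
  indecomposable \<open>M\<close> is one of these sixteen.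

  Conversely, if \<open>H\<close> contains none of \<open>1, 2, 3\<close>, the modules of all power series \<open>f\<close> with \<open>f 2 = 0\<close>
  and \<open>f 3 = r * f 1\<close> are pairwise non-isomorphic for \<open>r \<in> k\<close>.  If \<open>H\<close> contains none of
  \<open>1, 2, 4, 5\<close>, the same holds for the conditions \<open>f 1 = f 2 = 0\<close> and \<open>f 5 = r * f 4\<close>.  The numerical
  semigroups to which neither family applies are \<open>\<langle>3, 4, 5\<rangle>\<close>, \<open>\<langle>3, 5, 7\<rangle>\<close> and some symmetric ones,
  and a symmetric semigroup gives a Gorenstein ring: the quotient of the Laurent series by \<open>S\<close> is the
  dual of \<open>S\<close>, which is injective.
\<close>

section \<open>Subspaces of \<open>V^3\<close> and linear functionals\<close>

text \<open>The degrees 1, 2, 4 are the gaps of <3, 5, 7>. A module that contains a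
  \<open>k[[t]]\<close>-basis contains its combinations over k[[t^3, t^5, t^7]], so only the
  coefficients at the gaps remain to be recorded, and of the multiplications only t^3 is felt there:
  it moves degree 1 to degree 4. The case <3, 4, 5> needs no classification of its own: t^5 carries
  k[[t]] into the smaller ring and can be cancelled on torsion-free modules, so linearity over the
  smaller ring suffices.

  The number sixteen has a classical origin: k[[t^3, t^5, t^7]] is the endomorphism ring of the
  maximal ideal of the E8 singularity k[[t^3, t^5]], whose indecomposables are the ring itself and
  sixteen others.

  In place of matrix reductions, a summand is recognised by two maps. An embedding of a model is a
  handful of elements of \<open>\<Gamma>\<close>, a projection is a handful of functionals subject
  to linear relations on \<open>\<Gamma>\<close>, and by duality a projection that fits the
  embedding exists unless some vector lies in some subspace. Failure of a model to split off thus
  becomes a membership, and memberships can be composed.\<close>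

context vector_space
begin

text \<open>Linearity is asked only on \<open>W\<close>: in \<open>injective_dual\<close> this
  extends a functional from an ideal to all power series.\<close>

lemma functional_extend:
  assumes W: "subspace W"
    and add: "\<And>x y. x \<in> W \<Longrightarrow> y \<in> W \<Longrightarrow> f (x + y) = f x + f y"
    and hom: "\<And>c x. x \<in> W \<Longrightarrow> f (c *s x) = c * f x"
  obtains g where "Vector_Spaces.linear scale (*) g" "\<And>x. x \<in> W \<Longrightarrow> g x = f x"
proof -
  interpret vector_space_pair scale "(*) :: 'a \<Rightarrow> 'a \<Rightarrow> 'a"
    by unfold_locales (simp_all add: algebra_simps)
  obtain B where B: "B \<subseteq> W" "independent B" "W \<subseteq> span B"
    by (rule maximal_independent_subset[of W])
  obtain g where g: "Vector_Spaces.linear scale (*) g" "\<forall>x\<in>B. g x = f x"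
    using linear_independent_extend[OF B(2)] by blast
  interpret g: Vector_Spaces.linear scale "(*)" g by (rule g)
  have "x \<in> W \<and> g x = f x" if "x \<in> span B" for x
    using that
  proof (induction rule: span_induct_alt)
    case base
    have "f 0 = 0"
      using hom[of 0 0] subspace_0[OF W] by simp
    then show ?case using subspace_0[OF W] by simp
  next
    case (step c b y)
    then have "b \<in> W" "c *s b \<in> W" using B(1) subspace_scale[OF W] by auto
    then show ?case
      using step g(2) by (simp add: add hom g.add g.scale subspace_add[OF W])
  qed
  then show thesis using that g(1) B(3) by blast
qed

lemma functional_separate:
  assumes W: "subspace W" and v: "v \<notin> W"
  obtains g where "Vector_Spaces.linear scale (*) g" "g v = 1" "\<And>x. x \<in> W \<Longrightarrow> g x = 0"
proof -
  interpret vector_space_pair scale "(*) :: 'a \<Rightarrow> 'a \<Rightarrow> 'a"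
    by unfold_locales (simp_all add: algebra_simps)
  obtain B where B: "B \<subseteq> W" "independent B" "W \<subseteq> span B"
    by (rule maximal_independent_subset[of W])
  have "span B = W" using B W by (simp add: span_subspace)
  then have "v \<notin> span B" using v by simp
  then have "independent (insert v B)" "v \<notin> B" using B(2) by (auto simp: independent_insert intro: span_base)
  then obtain g where g: "Vector_Spaces.linear scale (*) g"
    "\<forall>x\<in>insert v B. g x = (if x = v then 1 else 0)"
    using linear_independent_extend[of "insert v B" "\<lambda>x. if x = v then 1 else 0"] by blast
  interpret g: Vector_Spaces.linear scale "(*)" g by (rule g)
  have "g x = 0" if "x \<in> span B" for x
    by (rule g.eq_0_on_span[OF _ that]) (use g(2) \<open>v \<notin> B\<close> in auto)
  then show thesis using that g \<open>span B = W\<close> by auto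
qed

end

type_synonym 'v triple = "'v \<times> 'v \<times> 'v"
type_synonym 'v six = "'v \<times> 'v \<times> 'v \<times> 'v \<times> 'v \<times> 'v"

text \<open>
  A triple space \<open>(V, \<Gamma>)\<close> describes the module of all power series \<open>v\<close> with coefficients in \<open>V\<close>
  such that \<open>(v 1, v 2, v 4) \<in> \<Gamma>\<close> (see \<open>lattice_seq\<close> below).  The axiom \<open>shift\<close> is closure under
  multiplication by \<open>t^3\<close>.
\<close>

locale triple_space = vector_space scale
  for scale :: "'k::field \<Rightarrow> 'v::ab_group_add \<Rightarrow> 'v" (infixr \<open>*s\<close> 75) +
  fixes V :: "'v set" and \<Gamma> :: "'v triple set"
  assumes V: "subspace V"
    and sub: "(x, y, z) \<in> \<Gamma> \<Longrightarrow> x \<in> V \<and> y \<in> V \<and> z \<in> V"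
    and zero: "(0, 0, 0) \<in> \<Gamma>"
    and add: "(x, y, z) \<in> \<Gamma> \<Longrightarrow> (x', y', z') \<in> \<Gamma> \<Longrightarrow> (x + x', y + y', z + z') \<in> \<Gamma>"
    and scl: "(x, y, z) \<in> \<Gamma> \<Longrightarrow> (c *s x, c *s y, c *s z) \<in> \<Gamma>"
    and shift: "(x, y, z) \<in> \<Gamma> \<Longrightarrow> (0, 0, x) \<in> \<Gamma>"
begin

definition functional :: "('v \<Rightarrow> 'k) \<Rightarrow> bool" where
  "functional f \<longleftrightarrow> Vector_Spaces.linear scale (*) f"

lemma functional_simps:
  assumes "functional f"
  shows "f (x + y) = f x + f y" "f (x - y) = f x - f y" "f (- x) = - f x" "f 0 = 0"
    "f (c *s x) = c * f x"
proof -
  interpret f: Vector_Spaces.linear scale "(*)" f using assms by (simp add: functional_def)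
  show "f (x + y) = f x + f y" "f (x - y) = f x - f y" "f (- x) = - f x" "f 0 = 0"
    "f (c *s x) = c * f x"
    by (simp_all add: f.add f.diff f.neg f.zero f.scale)
qed

lemma neg: "(x, y, z) \<in> \<Gamma> \<Longrightarrow> (- x, - y, - z) \<in> \<Gamma>"
  using scl[of x y z "-1"] by simp

lemma diff: "(x, y, z) \<in> \<Gamma> \<Longrightarrow> (x', y', z') \<in> \<Gamma> \<Longrightarrow> (x - x', y - y', z - z') \<in> \<Gamma>"
  using add[OF _ neg] by fastforce

lemma comb:
  assumes "(x1, y1, z1) \<in> \<Gamma>" "(x2, y2, z2) \<in> \<Gamma>" "(x3, y3, z3) \<in> \<Gamma>" "(x4, y4, z4) \<in> \<Gamma>"
    "(x5, y5, z5) \<in> \<Gamma>"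
  shows "(a *s x1 + b *s x2 + c *s x3 + d *s x4 + e *s x5,
    a *s y1 + b *s y2 + c *s y3 + d *s y4 + e *s y5,
    a *s z1 + b *s z2 + c *s z3 + d *s z4 + e *s z5) \<in> \<Gamma>"
  by (intro add scl assms)

abbreviation (input) X :: "(nat \<Rightarrow> 'v triple) \<Rightarrow> nat \<Rightarrow> 'v" where
  "X g i \<equiv> fst (g i)"
abbreviation (input) Y :: "(nat \<Rightarrow> 'v triple) \<Rightarrow> nat \<Rightarrow> 'v" where
  "Y g i \<equiv> fst (snd (g i))"
abbreviation (input) Z :: "(nat \<Rightarrow> 'v triple) \<Rightarrow> nat \<Rightarrow> 'v" where
  "Z g i \<equiv> snd (snd (g i))"

text \<open>The six functionals are the components of a single functional on \<open>V^6\<close> that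
  vanishes on the image under \<open>L\<close> of all families in \<open>\<Gamma>\<close>. Testing
  families with one nonzero entry is enough, and each index \<open>i\<close> then gives one linear
  relation that holds throughout \<open>\<Gamma>\<close>.\<close>

definition annihilates ::
    "((nat \<Rightarrow> 'v triple) \<Rightarrow> 'v six) \<Rightarrow> ('v \<Rightarrow> 'k) \<Rightarrow> ('v \<Rightarrow> 'k) \<Rightarrow> ('v \<Rightarrow> 'k) \<Rightarrow>
      ('v \<Rightarrow> 'k) \<Rightarrow> ('v \<Rightarrow> 'k) \<Rightarrow> ('v \<Rightarrow> 'k) \<Rightarrow> bool" where
  "annihilates L f1 f2 f3 f4 f5 f6 \<longleftrightarrow>
     functional f1 \<and> functional f2 \<and> functional f3 \<and> functional f4 \<and> functional f5 \<and> functional f6 \<and>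
     (\<forall>i x y z. (x, y, z) \<in> \<Gamma> \<longrightarrow>
       (case L (\<lambda>j. if j = i then (x, y, z) else 0) of (p, q, r, s, t, u) \<Rightarrow>
         f1 p + f2 q + f3 r + f4 s + f5 t + f6 u) = 0)"

lemma annihilates_simps:
  assumes "annihilates L f1 f2 f3 f4 f5 f6"
  shows "functional f1" "functional f2" "functional f3" "functional f4" "functional f5" "functional f6"
    "f1 (x + y) = f1 x + f1 y" "f1 (x - y) = f1 x - f1 y" "f1 (- x) = - f1 x" "f1 0 = 0"
    "f1 (c *s x) = c * f1 x"
    "f2 (x + y) = f2 x + f2 y" "f2 (x - y) = f2 x - f2 y" "f2 (- x) = - f2 x" "f2 0 = 0"
    "f2 (c *s x) = c * f2 x"
    "f3 (x + y) = f3 x + f3 y" "f3 (x - y) = f3 x - f3 y" "f3 (- x) = - f3 x" "f3 0 = 0"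
    "f3 (c *s x) = c * f3 x"
    "f4 (x + y) = f4 x + f4 y" "f4 (x - y) = f4 x - f4 y" "f4 (- x) = - f4 x" "f4 0 = 0"
    "f4 (c *s x) = c * f4 x"
    "f5 (x + y) = f5 x + f5 y" "f5 (x - y) = f5 x - f5 y" "f5 (- x) = - f5 x" "f5 0 = 0"
    "f5 (c *s x) = c * f5 x"
    "f6 (x + y) = f6 x + f6 y" "f6 (x - y) = f6 x - f6 y" "f6 (- x) = - f6 x" "f6 0 = 0"
    "f6 (c *s x) = c * f6 x"
  using assms by (simp_all add: annihilates_def functional_simps)

lemma annihilates_relation:
  assumes "annihilates L f1 f2 f3 f4 f5 f6" "(x, y, z) \<in> \<Gamma>"
  shows "(case L (\<lambda>j. if j = i then (x, y, z) else 0) of (p, q, r, s, t, u) \<Rightarrow>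
    f1 p + f2 q + f3 r + f4 s + f5 t + f6 u) = 0"
  using assms by (simp add: annihilates_def)

text \<open>
  If \<open>v\<close> cannot be expressed by elements of \<open>\<Gamma>\<close> subject to the five linear side conditions encoded
  in \<open>L\<close>, then there are functionals that satisfy linear relations on all of \<open>\<Gamma>\<close>; these will be the
  coordinates of a projection onto one of the models.
\<close>

lemma exists_annihilator:
  fixes L :: "(nat \<Rightarrow> 'v triple) \<Rightarrow> 'v six"
  assumes L_add: "\<And>g h. L (\<lambda>i. g i + h i) = L g + L h"
    and L_scl: "\<And>c g. L (\<lambda>i. (c *s X g i, c *s Y g i, c *s Z g i)) =
      (case L g of (p, q, r, s, t, u) \<Rightarrow> (c *s p, c *s q, c *s r, c *s s, c *s t, c *s u))"
    and no: "\<nexists>g. (\<forall>i. g i \<in> \<Gamma>) \<and> L g = (v, 0, 0, 0, 0, 0)"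
  obtains f1 f2 f3 f4 f5 f6 where "annihilates L f1 f2 f3 f4 f5 f6" "f1 v = 1"
proof -
  define sc where "sc c = (\<lambda>(p, q, r, s, t, u). (c *s p, c *s q, c *s r, c *s s, c *s t, c *s u))"
    for c :: 'k
  interpret P: vector_space sc
    by unfold_locales (auto simp: sc_def algebra_simps)
  define W where "W = L ` {g. \<forall>i. g i \<in> \<Gamma>}"
  have L0: "L (\<lambda>i. 0) = 0" using L_add[of "\<lambda>i. 0" "\<lambda>i. 0"] by simp
  have "P.subspace W"
    unfolding P.subspace_def
  proof (intro conjI ballI allI)
    show "0 \<in> W" unfolding W_def using L0 zero
      by (intro image_eqI[of _ _ "\<lambda>i. 0"]) (auto simp: zero_prod_def)
  next
    fix x y assume "x \<in> W" "y \<in> W"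
    then obtain g h where gh: "x = L g" "y = L h" "\<forall>i. g i \<in> \<Gamma>" "\<forall>i. h i \<in> \<Gamma>"
      by (auto simp: W_def)
    have "g i + h i \<in> \<Gamma>" for i
      using gh(3,4)[rule_format, of i] by (cases "g i"; cases "h i") (auto intro: add)
    then show "x + y \<in> W"
      using gh by (auto simp: W_def L_add[symmetric])
  next
    fix x c assume "x \<in> W"
    then obtain g where g: "x = L g" "\<forall>i. g i \<in> \<Gamma>" by (auto simp: W_def)
    have "(c *s X g i, c *s Y g i, c *s Z g i) \<in> \<Gamma>" for i
      using g(2)[rule_format, of i] by (cases "g i") (auto intro: scl)
    then show "sc c x \<in> W"
      unfolding W_def sc_def g(1) L_scl[symmetric] by blast
  qed
  moreover have "(v, 0, 0, 0, 0, 0) \<notin> W" using no by (auto simp: W_def)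
  ultimately obtain G where G: "Vector_Spaces.linear sc (*) G" "G (v, 0, 0, 0, 0, 0) = 1"
    "\<And>x. x \<in> W \<Longrightarrow> G x = 0"
    using P.functional_separate by blast
  interpret G: Vector_Spaces.linear sc "(*)" G by (rule G)
  have fn: "functional (\<lambda>x. G (e x))" if "\<And>x y. e (x + y) = e x + e y" "\<And>c x. e (c *s x) = sc c (e x)" for e
    unfolding functional_def using that
    by unfold_locales (simp_all add: G.add G.scale algebra_simps)
  let ?f1 = "\<lambda>x. G (x, 0, 0, 0, 0, 0)" and ?f2 = "\<lambda>x. G (0, x, 0, 0, 0, 0)"
    and ?f3 = "\<lambda>x. G (0, 0, x, 0, 0, 0)" and ?f4 = "\<lambda>x. G (0, 0, 0, x, 0, 0)"
    and ?f5 = "\<lambda>x. G (0, 0, 0, 0, x, 0)" and ?f6 = "\<lambda>x. G (0, 0, 0, 0, 0, x)"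
  have "annihilates L ?f1 ?f2 ?f3 ?f4 ?f5 ?f6"
    unfolding annihilates_def
  proof (intro conjI allI impI)
    show "functional ?f1" "functional ?f2" "functional ?f3" "functional ?f4" "functional ?f5" "functional ?f6"
      by (rule fn; simp add: sc_def)+
  next
    fix i x y z assume xyz: "(x, y, z) \<in> \<Gamma>"
    obtain p q r s t u where L: "L (\<lambda>j. if j = i then (x, y, z) else 0) = (p, q, r, s, t, u)"
      by (metis surj_pair)
    then have "(p, q, r, s, t, u) \<in> W"
      unfolding W_def by (intro image_eqI[of _ _ "\<lambda>j. if j = i then (x, y, z) else 0"])
        (auto simp: zero_prod_def zero xyz)
    then have "G (p, q, r, s, t, u) = 0" by (rule G(3))
    moreover have "(p, q, r, s, t, u) = (p, 0, 0, 0, 0, 0) + (0, q, 0, 0, 0, 0) + (0, 0, r, 0, 0, 0)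
      + (0, 0, 0, s, 0, 0) + (0, 0, 0, 0, t, 0) + (0, 0, 0, 0, 0, u)" by simp
    ultimately have "?f1 p + ?f2 q + ?f3 r + ?f4 s + ?f5 t + ?f6 u = 0"
      by (simp only: G.add)
    then show "(case L (\<lambda>j. if j = i then (x, y, z) else 0) of (p, q, r, s, t, u) \<Rightarrow>
        ?f1 p + ?f2 q + ?f3 r + ?f4 s + ?f5 t + ?f6 u) = 0"
      by (simp add: L)
  qed
  then show thesis using that G(2) by blast
qed

end

section \<open>Splitting off a model\<close>

definition scale3 :: "'k::field \<Rightarrow> 'k triple \<Rightarrow> 'k triple" where
  "scale3 c = (\<lambda>(x, y, z). (c * x, c * y, c * z))"

text \<open>
  The maps \<open>f0, ..., f4\<close> are the coefficients of \<open>t^0, ..., t^4\<close> in a \<open>k[[t]]\<close>-linear map between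
  the modules described by two triple spaces.
\<close>

definition graded_hom where
  "graded_hom s V \<Gamma> s' V' \<Gamma>' f0 f1 f2 f3 f4 \<longleftrightarrow>
     (\<forall>f\<in>{f0, f1, f2, f3, f4}. Vector_Spaces.linear s s' f \<and> f ` V \<subseteq> V') \<and>
     (\<forall>x\<in>V. (f1 x, f2 x, f4 x) \<in> \<Gamma>') \<and>
     (\<forall>(x, y, z)\<in>\<Gamma>. (f0 x, f0 y + f1 x, f0 z + f2 y + f3 x) \<in> \<Gamma>')"

context triple_space
begin

definition lincomb :: "'v \<Rightarrow> 'v \<Rightarrow> 'v \<Rightarrow> 'k triple \<Rightarrow> 'v" where
  "lincomb u v w = (\<lambda>(a, b, c). a *s u + b *s v + c *s w)"

text \<open>
  The composite of the two maps need not be the identity: it suffices that its constant term is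
  unipotent, see \<open>neumann_bij\<close>.
\<close>

definition summand :: "'k triple set \<Rightarrow> 'k triple triple set \<Rightarrow> bool"
  where "summand V' \<Gamma>' \<longleftrightarrow> (\<exists>i0 i1 i2 i3 i4 p0 p1 p2 p3 p4.
     graded_hom scale3 V' \<Gamma>' scale V \<Gamma> i0 i1 i2 i3 i4 \<and>
     graded_hom scale V \<Gamma> scale3 V' \<Gamma>' p0 p1 p2 p3 p4 \<and>
     (\<forall>x\<in>V'. ((\<lambda>x. p0 (i0 x) - x) ^^ 3) x = 0))"

definition coords :: "('v \<Rightarrow> 'k) \<Rightarrow> ('v \<Rightarrow> 'k) \<Rightarrow> ('v \<Rightarrow> 'k) \<Rightarrow> 'v \<Rightarrow> 'k triple" where
  "coords f g h x = (f x, g x, h x)"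

lemma linear_lincomb: "Vector_Spaces.linear scale3 scale (lincomb u v w)"
proof -
  interpret k3: vector_space scale3
    by unfold_locales (auto simp: scale3_def algebra_simps)
  show ?thesis
    by unfold_locales (auto simp: scale3_def lincomb_def algebra_simps scale_scale)
qed

lemma linear_coords:
  assumes "functional f" "functional g" "functional h"
  shows "Vector_Spaces.linear scale scale3 (coords f g h)"
proof -
  interpret k3: vector_space scale3
    by unfold_locales (auto simp: scale3_def algebra_simps)
  show ?thesis
    by unfold_locales (auto simp: scale3_def coords_def functional_simps[OF assms(1)]
      functional_simps[OF assms(2)] functional_simps[OF assms(3)])
qed

lemma functional_0: "functional (\<lambda>x. 0)"
  unfolding functional_def by unfold_locales (auto simp: algebra_simps)

lemma functional_diff: "functional f \<Longrightarrow> functional g \<Longrightarrow> functional (\<lambda>x. f x - g x)"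
  unfolding functional_def[of "\<lambda>x. f x - g x"]
  by unfold_locales (auto simp: functional_simps algebra_simps)

lemma functional_neg: "functional f \<Longrightarrow> functional (\<lambda>x. - f x)"
  unfolding functional_def[of "\<lambda>x. - f x"]
  by unfold_locales (auto simp: functional_simps algebra_simps)

lemma summandI:
  assumes "{u0, v0, w0, u1, v1, w1, u2, v2, w2, u3, v3, w3, u4, v4, w4} \<subseteq> V"
    and "\<And>a b c. (a, b, c) \<in> V' \<Longrightarrow>
      (lincomb u1 v1 w1 (a, b, c), lincomb u2 v2 w2 (a, b, c), lincomb u4 v4 w4 (a, b, c)) \<in> \<Gamma>"
    and "\<And>x y z. (x, y, z) \<in> \<Gamma>' \<Longrightarrow>
      (lincomb u0 v0 w0 x, lincomb u0 v0 w0 y + lincomb u1 v1 w1 x, lincomb u0 v0 w0 z + lincomb u2 v2 w2 y + lincomb u3 v3 w3 x) \<in> \<Gamma>"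
    and "\<forall>f\<in>{f0, g0, h0, f1, g1, h1, f2, g2, h2, f3, g3, h3, f4, g4, h4}. functional f"
    and "\<And>x. x \<in> V \<Longrightarrow> {coords f0 g0 h0 x, coords f1 g1 h1 x, coords f2 g2 h2 x, coords f3 g3 h3 x, coords f4 g4 h4 x} \<subseteq> V'"
    and "\<And>x. x \<in> V \<Longrightarrow> (coords f1 g1 h1 x, coords f2 g2 h2 x, coords f4 g4 h4 x) \<in> \<Gamma>'"
    and "\<And>x y z. (x, y, z) \<in> \<Gamma> \<Longrightarrow>
      (coords f0 g0 h0 x, coords f0 g0 h0 y + coords f1 g1 h1 x, coords f0 g0 h0 z + coords f2 g2 h2 y + coords f3 g3 h3 x) \<in> \<Gamma>'"
    and "\<And>a b c. (a, b, c) \<in> V' \<Longrightarrow> ((\<lambda>x. coords f0 g0 h0 (lincomb u0 v0 w0 x) - x) ^^ 3) (a, b, c) = 0"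
  shows "summand V' \<Gamma>'"
proof -
  have cV: "lincomb u v w x \<in> V" if "u \<in> V" "v \<in> V" "w \<in> V" for u v w x
    using that by (cases x) (auto simp: lincomb_def intro!: subspace_add[OF V] subspace_scale[OF V])
  have 1: "graded_hom scale3 V' \<Gamma>' scale V \<Gamma> (lincomb u0 v0 w0) (lincomb u1 v1 w1) (lincomb u2 v2 w2) (lincomb u3 v3 w3) (lincomb u4 v4 w4)"
    unfolding graded_hom_def using assms(1-3) by (auto simp: linear_lincomb intro!: cV)
  have 2: "graded_hom scale V \<Gamma> scale3 V' \<Gamma>' (coords f0 g0 h0) (coords f1 g1 h1) (coords f2 g2 h2) (coords f3 g3 h3) (coords f4 g4 h4)"
    unfolding graded_hom_def using assms(4-7) by (auto simp: linear_coords)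
  show ?thesis
    unfolding summand_def using 1 2 assms(8) by fast
qed

end

text \<open>
  The sixteen models, which have rank one (\<open>V1\<close>), two (\<open>V2\<close>) or three.
\<close>

definition V1 :: "'k::field triple set" where
  "V1 = {(a, 0, 0) | a. True}"
definition V2 :: "'k::field triple set" where
  "V2 = {(a, b, 0) | a b. True}"
definition T1 :: "'k::field triple triple set" where
  "T1 = {((0, 0, 0), (0, 0, 0), (0, 0, 0))}"
definition T2 :: "'k::field triple triple set" where
  "T2 = {((0, 0, 0), (y, 0, 0), (0, 0, 0)) | y. True}"
definition T3 :: "'k::field triple triple set" where
  "T3 = {((0, 0, 0), (0, 0, 0), (z, 0, 0)) | z. True}"
definition T4 :: "'k::field triple triple set" where
  "T4 = {((0, 0, 0), (y, 0, 0), (z, 0, 0)) | y z. True}"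
definition T5 :: "'k::field triple triple set" where
  "T5 = {((x, 0, 0), (0, 0, 0), (z, 0, 0)) | x z. True}"
definition T6 :: "'k::field triple triple set" where
  "T6 = {((x, 0, 0), (y, 0, 0), (z, 0, 0)) | x y z. True}"
definition T7 :: "'k::field triple triple set" where
  "T7 = {((0, x, 0), (x, 0, 0), (0, z, 0)) | x z. True}"
definition T8 :: "'k::field triple triple set" where
  "T8 = {((0, x, 0), (x, y, 0), (0, z, 0)) | x y z. True}"
definition T9 :: "'k::field triple triple set" where
  "T9 = {((0, x, 0), (x, 0, 0), (w, z, 0)) | x z w. True}"
definition T10 :: "'k::field triple triple set" where
  "T10 = {((0, x, 0), (x, y, 0), (w, z, 0)) | x y z w. True}"
definition T11 :: "'k::field triple triple set" where
  "T11 = {((0, x, 0), (0, y, 0), (y, z, 0)) | x y z. True}"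
definition T12 :: "'k::field triple triple set" where
  "T12 = {((0, 0, 0), (y, 0, 0), (0, y, 0)) | y. True}"
definition T13 :: "'k::field triple triple set" where
  "T13 = {((0, 0, 0), (y, 0, 0), (w, y, 0)) | y w. True}"
definition T14 :: "'k::field triple triple set" where
  "T14 = {((0, x, x'), (x', y, 0), (y, z, z')) | x x' y z z'. True}"
definition T15 :: "'k::field triple triple set" where
  "T15 = {((0, 0, x), (x, 0, y), (0, y, z)) | x y z. True}"
definition T16 :: "'k::field triple triple set" where
  "T16 = {((0, 0, x), (x, 0, y), (w, y, z)) | x y z w. True}"

lemmas models_defs = V1_def V2_def T1_def T2_def T3_def T4_def T5_def T6_def T7_def T8_def T9_def
  T10_def T11_def T12_def T13_def T14_def T15_def T16_def

section \<open>The splitting criteria, one for each model\<close>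

context triple_space
begin

lemma family: "\<forall>i. g i \<in> \<Gamma> \<Longrightarrow> (X g i, Y g i, Z g i) \<in> \<Gamma>"
  by simp

lemma V0: "0 \<in> V" by (rule subspace_0[OF V])

abbreviation (input) zf :: "'v \<Rightarrow> 'k" where "zf \<equiv> \<lambda>_. 0"

lemmas model_simps = lincomb_def coords_def functional_0 functional_neg functional_diff subspace_diff[OF V]
  numeral_3_eq_3 zero_prod_def

text \<open>The form of all sixteen criteria. The hypotheses supply the images of the generators of
  the model, that is, an embedding. \<open>L\<close> is the transpose of the system of relations
  that a projection has to satisfy on \<open>\<Gamma>\<close>: each index of the family stands for
  one relation, each component of \<open>L\<close> for one functional, and surplus components are
  zero. If the membership fails, the functionals of \<open>exists_annihilator\<close> make up the
  projection. The normalisation at the vector and the relations fix enough values for the composite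
  to be unipotent; the other values are unknown, so it need not be the identity.\<close>

lemma summand_T3:
  assumes ns: "\<not> summand V1 T3"
    and v: "(0, 0, v) \<in> \<Gamma>"
  shows "\<exists>g :: nat \<Rightarrow> _. (\<forall>i. g i \<in> \<Gamma>) \<and> v = X g 0 + Y g 1"
proof (rule ccontr)
  assume no: "\<not> ?thesis"
  let ?L = "\<lambda>g :: nat \<Rightarrow> _. (X g 0 + Y g 1, 0, 0, 0, 0, 0) :: 'v six"
  obtain f r0 r1 r2 r3 r4 where ann: "annihilates ?L f r0 r1 r2 r3 r4" and norm: "f v = 1"
    by (rule exists_annihilator[of ?L v]) (use no in \<open>auto simp: algebra_simps\<close>)
  note fs = annihilates_simps[OF ann] and rel = annihilates_relation[OF ann]
  have c: "f x = 0" "f y = 0"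
    if "(x, y, z) \<in> \<Gamma>" for x y z
    using rel[OF that, of 0] rel[OF that, of 1] by (simp_all add: fs algebra_simps)
  have G2: "(0, 0, a *s v) \<in> \<Gamma>" for a
    using scl[OF v, of a] by (simp add: algebra_simps)
  have "summand V1 T3"
  proof (rule summandI[of v 0 0 0 0 0 0 0 0 0 0 0 0 0 0 _ _
      f zf zf zf zf zf zf zf zf zf zf zf zf zf zf])
    show "(coords f zf zf x, coords f zf zf y + coords zf zf zf x,
        coords f zf zf z + coords zf zf zf y + coords zf zf zf x) \<in> T3"
      if "(x, y, z) \<in> \<Gamma>" for x y z
      using c[OF that] by (auto simp: T3_def coords_def algebra_simps)
  qed (use sub[OF v] zero subspace_0[OF V] in
      \<open>auto simp: V1_def T3_def G2 fs norm model_simps split: prod.splits\<close>)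
  with ns show False ..
qed

lemma summand_T9:
  assumes ns: "\<not> summand V2 T9"
    and v: "(0, 0, v) \<in> \<Gamma>"
    and b: "(b, v, s) \<in> \<Gamma>"
  shows "\<exists>g :: nat \<Rightarrow> _. (\<forall>i. g i \<in> \<Gamma>) \<and> v = X g 0 + Y g 1 \<and> Y g 2 - X g 1 = 0 \<and> X g 2 = 0"
proof (rule ccontr)
  assume no: "\<not> ?thesis"
  let ?L = "\<lambda>g :: nat \<Rightarrow> _. (X g 0 + Y g 1, Y g 2 - X g 1, X g 2, 0, 0, 0) :: 'v six"
  obtain f g k r0 r1 r2 where ann: "annihilates ?L f g k r0 r1 r2" and norm: "f v = 1"
    by (rule exists_annihilator[of ?L v]) (use no in \<open>auto simp: algebra_simps\<close>)
  note fs = annihilates_simps[OF ann] and rel = annihilates_relation[OF ann]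
  have c: "f x = 0" "f y = g x" "g y + k x = 0"
    if "(x, y, z) \<in> \<Gamma>" for x y z
    using rel[OF that, of 0] rel[OF that, of 1] rel[OF that, of 2]
    by (simp_all add: fs algebra_simps)
  have vals: "f b = 0" "g b = 1"
    using norm c[OF b] by (simp_all add: fs)
  have G2: "(a *s b, a *s v, w *s v + z *s b + a *s s) \<in> \<Gamma>" for a w z
    using comb[OF b v shift[OF b] zero zero, of a w z] by (simp add: algebra_simps)
  have "summand V2 T9"
  proof (rule summandI[of v b 0 0 0 0 0 0 0 0 s 0 0 0 0 _ _
      f g zf zf k zf k zf zf zf zf zf zf zf zf])
    show "(coords f g zf x, coords f g zf y + coords zf k zf x,
        coords f g zf z + coords k zf zf y + coords zf zf zf x) \<in> T9"
      if "(x, y, z) \<in> \<Gamma>" for x y z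
      using c[OF that] by (auto simp: T9_def coords_def algebra_simps)
  qed (use sub[OF v] sub[OF b] zero subspace_0[OF V] in
      \<open>auto simp: V2_def T9_def G2 fs norm vals model_simps split: prod.splits\<close>)
  with ns show False ..
qed

text \<open>The constants of the model are not embedded as constants: the second basis vector goes
  to a series with \<open>b\<close>, \<open>y0\<close>, \<open>u\<close>, \<open>s\<close> in
  degrees 0, 1, 2, 4, which lies in the module by \<open>(y0, u, s) \<in> \<Gamma>\<close>. Its
  degree 2 coefficient is the reason for \<open>v + u\<close> in place of \<open>v\<close>. The sums
  in the hypotheses for \<open>T8\<close>, \<open>T10\<close> and \<open>T14\<close> arise in the
  same way.\<close>

lemma summand_T11:
  assumes ns: "\<not> summand V2 T11"
    and b: "(0, b, v + u) \<in> \<Gamma>"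
    and y0: "(b, y0, z0) \<in> \<Gamma>"
    and u: "(y0, u, s) \<in> \<Gamma>"
  shows "\<exists>g :: nat \<Rightarrow> _. (\<forall>i. g i \<in> \<Gamma>) \<and> v = X g 0 + Y g 1 + Z g 2 \<and> - Y g 2 = 0 \<and> - X g 2 = 0"
proof (rule ccontr)
  assume no: "\<not> ?thesis"
  let ?L = "\<lambda>g :: nat \<Rightarrow> _. (X g 0 + Y g 1 + Z g 2, - Y g 2, - X g 2, 0, 0, 0) :: 'v six"
  obtain f g k r0 r1 r2 where ann: "annihilates ?L f g k r0 r1 r2" and norm: "f v = 1"
    by (rule exists_annihilator[of ?L v]) (use no in \<open>auto simp: algebra_simps\<close>)
  note fs = annihilates_simps[OF ann] and rel = annihilates_relation[OF ann]
  have c: "f x = 0" "f y = 0" "f z = g y + k x"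
    if "(x, y, z) \<in> \<Gamma>" for x y z
    using rel[OF that, of 0] rel[OF that, of 1] rel[OF that, of 2]
    by (simp_all add: fs algebra_simps)
  have vV: "v \<in> V"
    using subspace_diff[OF V, of "v + u" u] sub[OF b] sub[OF u] by simp
  have vals: "f b = 0" "g b = 1"
    using norm c[OF b] c[OF y0] c[OF u] by (simp_all add: fs)
  have G1: "(a *s y0, a *s u, a *s s) \<in> \<Gamma>" for a
    using scl[OF u, of a] by simp
  have G2: "(a *s b, c *s b + a *s y0, c *s v + z *s b + c *s u + a *s z0) \<in> \<Gamma>" for a c z
    using comb[OF b y0 shift[OF y0] zero zero, of c a z] by (simp add: algebra_simps)
  have "summand V2 T11"
  proof (rule summandI[of v b 0 0 y0 0 0 u 0 0 z0 0 0 s 0 _ _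
      f g zf zf k zf zf zf zf zf zf zf zf zf zf])
    show "(coords f g zf x, coords f g zf y + coords zf k zf x,
        coords f g zf z + coords zf zf zf y + coords zf zf zf x) \<in> T11"
      if "(x, y, z) \<in> \<Gamma>" for x y z
      using c[OF that] by (auto simp: T11_def coords_def algebra_simps)
  qed (use sub[OF b] sub[OF y0] sub[OF u] vV zero subspace_0[OF V] in
      \<open>auto simp: V2_def T11_def G1 G2 fs norm vals model_simps split: prod.splits\<close>)
  with ns show False ..
qed

lemma summand_T15:
  assumes ns: "\<not> summand UNIV T15"
    and v1: "(b, v1, s) \<in> \<Gamma>"
    and v2: "(0, b, v2) \<in> \<Gamma>"
  shows "\<exists>g :: nat \<Rightarrow> _. (\<forall>i. g i \<in> \<Gamma>) \<and> v2 = X g 1 + Y g 3 + Z g 5 \<and> X g 0 + Y g 2 + Z g 4 = 0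
      \<and> - X g 2 - Y g 5 = 0 \<and> Y g 4 = 0 \<and> X g 4 = 0 \<and> - X g 5 = 0"
proof (rule ccontr)
  assume no: "\<not> ?thesis"
  let ?L = "\<lambda>g :: nat \<Rightarrow> _. (X g 1 + Y g 3 + Z g 5, X g 0 + Y g 2 + Z g 4, - X g 2 - Y g 5, Y g 4,
      X g 4, - X g 5) :: 'v six"
  obtain g f h k l m where ann: "annihilates ?L g f h k l m" and norm: "g v2 = 1"
    by (rule exists_annihilator[of ?L v2]) (use no in \<open>auto simp: algebra_simps\<close>)
  note fs = annihilates_simps[OF ann] and rel = annihilates_relation[OF ann]
  have c: "f x = 0" "g x = 0" "f y = h x" "g y = 0" "f z + k y + l x = 0" "g z = h y + m x"
    if "(x, y, z) \<in> \<Gamma>" for x y z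
    using rel[OF that, of 0] rel[OF that, of 1] rel[OF that, of 2] rel[OF that, of 3]
       rel[OF that, of 4] rel[OF that, of 5] by (simp_all add: fs algebra_simps)
  have vals: "f b = 0" "g b = 0" "h b = 1" "f v1 = 1" "g v1 = 0"
    using norm c[OF v1] c[OF v2] by (simp_all add: fs)
  have G2: "(a *s b, a *s v1 + c *s b, c *s v2 + z *s b + a *s s) \<in> \<Gamma>" for a c z
    using comb[OF v1 v2 shift[OF v1] zero zero, of a c z] by (simp add: algebra_simps)
  have "summand UNIV T15"
  proof (rule summandI[of v1 v2 b 0 0 0 0 0 0 0 0 s 0 0 0 _ _
      f g h zf zf k k zf zf l "\<lambda>x. k x - m x" zf zf zf zf])
    show "(coords f g h x, coords f g h y + coords zf zf k x,
        coords f g h z + coords k zf zf y + coords l (\<lambda>x. k x - m x) zf x) \<in> T15"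
      if "(x, y, z) \<in> \<Gamma>" for x y z
      using c[OF that] by (auto simp: T15_def coords_def algebra_simps)
  qed (use sub[OF v1] sub[OF v2] zero subspace_0[OF V] in
      \<open>auto simp: T15_def G2 fs norm vals model_simps split: prod.splits\<close>)
  with ns show False ..
qed

text \<open>\<open>T16\<close> is \<open>T15\<close> with the extra parameter \<open>w\<close>. This
  removes the relation on \<open>f z\<close> from the projection, which sharpens the resulting
  membership; the price is the hypothesis that the image \<open>(0, 0, v1)\<close> of the new
  generator lies in \<open>\<Gamma>\<close>.\<close>

lemma summand_T16:
  assumes ns: "\<not> summand UNIV T16"
    and v1: "(b, v1, s) \<in> \<Gamma>"
    and v2: "(0, b, v2) \<in> \<Gamma>"
    and v3: "(0, 0, v1) \<in> \<Gamma>"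
  shows "\<exists>g :: nat \<Rightarrow> _. (\<forall>i. g i \<in> \<Gamma>) \<and> v2 = X g 1 + Y g 3 + Z g 4 \<and> X g 0 + Y g 2 = 0
      \<and> - X g 2 - Y g 4 = 0 \<and> - X g 4 = 0"
proof (rule ccontr)
  assume no: "\<not> ?thesis"
  let ?L = "\<lambda>g :: nat \<Rightarrow> _. (X g 1 + Y g 3 + Z g 4, X g 0 + Y g 2, - X g 2 - Y g 4, - X g 4, 0,
      0) :: 'v six"
  obtain g f h m r0 r1 where ann: "annihilates ?L g f h m r0 r1" and norm: "g v2 = 1"
    by (rule exists_annihilator[of ?L v2]) (use no in \<open>auto simp: algebra_simps\<close>)
  note fs = annihilates_simps[OF ann] and rel = annihilates_relation[OF ann]
  have c: "f x = 0" "g x = 0" "f y = h x" "g y = 0" "g z = h y + m x"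
    if "(x, y, z) \<in> \<Gamma>" for x y z
    using rel[OF that, of 0] rel[OF that, of 1] rel[OF that, of 2] rel[OF that, of 3]
       rel[OF that, of 4] by (simp_all add: fs algebra_simps)
  have vals: "f b = 0" "g b = 0" "h b = 1" "f v1 = 1" "g v1 = 0"
    using norm c[OF v1] c[OF v2] by (simp_all add: fs)
  have G2: "(a *s b, a *s v1 + c *s b, w *s v1 + c *s v2 + z *s b + a *s s) \<in> \<Gamma>" for a c z w
    using comb[OF v1 v2 shift[OF v1] v3 zero, of a c z w] by (simp add: algebra_simps)
  have "summand UNIV T16"
  proof (rule summandI[of v1 v2 b 0 0 0 0 0 0 0 0 s 0 0 0 _ _
      f g h zf zf zf zf zf zf zf "\<lambda>x. - m x" zf zf zf zf])
    show "(coords f g h x, coords f g h y + coords zf zf zf x,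
        coords f g h z + coords zf zf zf y + coords zf (\<lambda>x. - m x) zf x) \<in> T16"
      if "(x, y, z) \<in> \<Gamma>" for x y z
      using c[OF that] by (auto simp: T16_def coords_def algebra_simps)
  qed (use sub[OF v1] sub[OF v2] sub[OF v3] zero subspace_0[OF V] in
      \<open>auto simp: T16_def G2 fs norm vals model_simps split: prod.splits\<close>)
  with ns show False ..
qed

lemma summand_T10:
  assumes ns: "\<not> summand V2 T10"
    and v: "(0, 0, v) \<in> \<Gamma>"
    and b: "(b, v + x0, s) \<in> \<Gamma>"
    and y0: "(0, b, y0) \<in> \<Gamma>"
    and x0: "(x0, y0, s0) \<in> \<Gamma>"
  shows "\<exists>g :: nat \<Rightarrow> _. (\<forall>i. g i \<in> \<Gamma>) \<and> v = X g 0 + Y g 1 \<and> - X g 1 = 0"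
proof (rule ccontr)
  assume no: "\<not> ?thesis"
  let ?L = "\<lambda>g :: nat \<Rightarrow> _. (X g 0 + Y g 1, - X g 1, 0, 0, 0, 0) :: 'v six"
  obtain f g r0 r1 r2 r3 where ann: "annihilates ?L f g r0 r1 r2 r3" and norm: "f v = 1"
    by (rule exists_annihilator[of ?L v]) (use no in \<open>auto simp: algebra_simps\<close>)
  note fs = annihilates_simps[OF ann] and rel = annihilates_relation[OF ann]
  have c: "f x = 0" "f y = g x"
    if "(x, y, z) \<in> \<Gamma>" for x y z
    using rel[OF that, of 0] rel[OF that, of 1] by (simp_all add: fs algebra_simps)
  have vals: "f b = 0" "g b = 1"
    using norm c[OF b] c[OF x0] by (simp_all add: fs)
  have G1: "(a *s x0, a *s y0, a *s s0) \<in> \<Gamma>" for a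
    using scl[OF x0, of a] by simp
  have G2: "(a *s b, a *s v + c *s b + a *s x0, w *s v + z *s b + c *s y0 + a *s s) \<in> \<Gamma>" for a c w z
    using comb[OF b y0 v shift[OF b] zero, of a c w z] by (simp add: algebra_simps)
  have "summand V2 T10"
  proof (rule summandI[of v b 0 0 x0 0 0 y0 0 0 s 0 0 s0 0 _ _
      f g zf zf zf zf zf zf zf zf zf zf zf zf zf])
    show "(coords f g zf x, coords f g zf y + coords zf zf zf x,
        coords f g zf z + coords zf zf zf y + coords zf zf zf x) \<in> T10"
      if "(x, y, z) \<in> \<Gamma>" for x y z
      using c[OF that] by (auto simp: T10_def coords_def algebra_simps)
  qed (use sub[OF v] sub[OF b] sub[OF y0] sub[OF x0] zero subspace_0[OF V] in
      \<open>auto simp: V2_def T10_def G1 G2 fs norm vals model_simps split: prod.splits\<close>)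
  with ns show False ..
qed

text \<open>The parameters \<open>x\<close>, \<open>x'\<close>, \<open>y\<close> of the model go to
  \<open>(b, y0, z0)\<close>, \<open>(b2, y1, z2)\<close> and \<open>(0, b, y1 + u)\<close>; the
  parameters \<open>z\<close> and \<open>z'\<close> are taken care of by \<open>shift\<close>, and
  \<open>(y0, u, s)\<close> corrects the image of the constant belonging to
  \<open>b\<close>.\<close>

lemma summand_T14:
  assumes ns: "\<not> summand UNIV T14"
    and y0: "(b, y0, z0) \<in> \<Gamma>"
    and u: "(y0, u, s) \<in> \<Gamma>"
    and b2: "(b2, y1, z2) \<in> \<Gamma>"
    and b: "(0, b, y1 + u) \<in> \<Gamma>"
  shows "\<exists>g :: nat \<Rightarrow> _. (\<forall>i. g i \<in> \<Gamma>) \<and> y1 = X g 0 + Y g 1 + Z g 3 \<and> Y g 2 - X g 1 = 0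
      \<and> X g 2 + Y g 3 = 0 \<and> - Y g 3 = 0 \<and> - X g 3 = 0"
proof (rule ccontr)
  assume no: "\<not> ?thesis"
  let ?L = "\<lambda>g :: nat \<Rightarrow> _. (X g 0 + Y g 1 + Z g 3, Y g 2 - X g 1, X g 2 + Y g 3, - Y g 3, - X g 3,
      0) :: 'v six"
  obtain f h k l m r0 where ann: "annihilates ?L f h k l m r0" and norm: "f y1 = 1"
    by (rule exists_annihilator[of ?L y1]) (use no in \<open>auto simp: algebra_simps\<close>)
  note fs = annihilates_simps[OF ann] and rel = annihilates_relation[OF ann]
  have c: "f x = 0" "f y = h x" "h y + k x = 0" "f z + k y = l y + m x"
    if "(x, y, z) \<in> \<Gamma>" for x y z
    using rel[OF that, of 0] rel[OF that, of 1] rel[OF that, of 2] rel[OF that, of 3]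
    by (simp_all add: fs algebra_simps)
  have vals: "f b = 0" "f b2 = 0" "h b = 0" "h b2 = 1" "l b = 1"
    using norm c[OF b] c[OF u] c[OF y0] c[OF b2] by (simp_all add: fs) (metis add.assoc add.right_neutral)
  have G1: "(a *s y0, a *s u, a *s s) \<in> \<Gamma>" for a
    using scl[OF u, of a] by simp
  have G2: "(a *s b + a' *s b2, a' *s y1 + c *s b + a *s y0,
      c *s y1 + z *s b + z' *s b2 + c *s u + (a *s z0 + a' *s z2)) \<in> \<Gamma>" for a a' c z z'
    using comb[OF y0 b2 b shift[OF y0] shift[OF b2], of a a' c z z'] by (simp add: algebra_simps)
  have "summand UNIV T14"
  proof (rule summandI[of y1 b b2 0 y0 0 0 u 0 0 z0 z2 0 s 0 _ _
      f l h zf m k k zf zf zf zf zf zf zf zf])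
    show "(coords f l h x, coords f l h y + coords zf m k x,
        coords f l h z + coords k zf zf y + coords zf zf zf x) \<in> T14"
      if "(x, y, z) \<in> \<Gamma>" for x y z
      using c[OF that] by (auto simp: T14_def coords_def algebra_simps)
  qed (use sub[OF y0] sub[OF u] sub[OF b2] sub[OF b] zero subspace_0[OF V] in
      \<open>auto simp: T14_def G1 G2 fs norm vals model_simps split: prod.splits\<close>)
  with ns show False ..
qed

lemma summand_T12:
  assumes ns: "\<not> summand V2 T12"
    and e: "(0, e1, e2) \<in> \<Gamma>"
  shows "\<exists>g :: nat \<Rightarrow> _. (\<forall>i. g i \<in> \<Gamma>) \<and> e2 = X g 1 + Y g 2 + Z g 4 \<and> X g 0 + Z g 3 - Y g 4 = 0
      \<and> Y g 3 = 0 \<and> X g 3 = 0 \<and> X g 4 = 0"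
proof (rule ccontr)
  assume no: "\<not> ?thesis"
  let ?L = "\<lambda>g :: nat \<Rightarrow> _. (X g 1 + Y g 2 + Z g 4, X g 0 + Z g 3 - Y g 4, Y g 3, X g 3, X g 4,
      0) :: 'v six"
  obtain g f k l m r0 where ann: "annihilates ?L g f k l m r0" and norm: "g e2 = 1"
    by (rule exists_annihilator[of ?L e2]) (use no in \<open>auto simp: algebra_simps\<close>)
  note fs = annihilates_simps[OF ann] and rel = annihilates_relation[OF ann]
  have c: "f x = 0" "g x = 0" "g y = 0" "f z + k y + l x = 0" "g z + m x = f y"
    if "(x, y, z) \<in> \<Gamma>" for x y z
    using rel[OF that, of 0] rel[OF that, of 1] rel[OF that, of 2] rel[OF that, of 3]
       rel[OF that, of 4] by (simp_all add: fs algebra_simps)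
  have vals: "f e1 = 1" "g e1 = 0"
    using norm c[OF e] by (simp_all add: fs)
  have G2: "(0, c *s e1, c *s e2) \<in> \<Gamma>" for c
    using scl[OF e, of c] by (simp add: algebra_simps)
  have "summand V2 T12"
  proof (rule summandI[of e1 e2 0 0 0 0 0 0 0 0 0 0 0 0 0 _ _
      f g zf zf zf zf k zf zf l m zf zf k zf])
    show "(coords f g zf x, coords f g zf y + coords zf zf zf x,
        coords f g zf z + coords k zf zf y + coords l m zf x) \<in> T12"
      if "(x, y, z) \<in> \<Gamma>" for x y z
      using c[OF that] by (auto simp: T12_def coords_def algebra_simps)
  qed (use sub[OF e] zero subspace_0[OF V] in
      \<open>auto simp: V2_def T12_def G2 fs norm vals model_simps split: prod.splits\<close>)
  with ns show False ..
qed

text \<open>\<open>T13\<close> is to \<open>T12\<close> what \<open>T16\<close> is to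
  \<open>T15\<close>: the parameter \<open>w\<close> trades a relation for the hypothesis on
  \<open>(0, 0, e1)\<close>.\<close>

lemma summand_T13:
  assumes ns: "\<not> summand V2 T13"
    and e: "(0, e1, e2) \<in> \<Gamma>"
    and e1: "(0, 0, e1) \<in> \<Gamma>"
  shows "\<exists>g :: nat \<Rightarrow> _. (\<forall>i. g i \<in> \<Gamma>) \<and> e2 = X g 1 + Y g 2 + Z g 3 \<and> X g 0 - Y g 3 = 0 \<and> X g 3 = 0"
proof (rule ccontr)
  assume no: "\<not> ?thesis"
  let ?L = "\<lambda>g :: nat \<Rightarrow> _. (X g 1 + Y g 2 + Z g 3, X g 0 - Y g 3, X g 3, 0, 0, 0) :: 'v six"
  obtain g f m r0 r1 r2 where ann: "annihilates ?L g f m r0 r1 r2" and norm: "g e2 = 1"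
    by (rule exists_annihilator[of ?L e2]) (use no in \<open>auto simp: algebra_simps\<close>)
  note fs = annihilates_simps[OF ann] and rel = annihilates_relation[OF ann]
  have c: "f x = 0" "g x = 0" "g y = 0" "g z + m x = f y"
    if "(x, y, z) \<in> \<Gamma>" for x y z
    using rel[OF that, of 0] rel[OF that, of 1] rel[OF that, of 2] rel[OF that, of 3]
    by (simp_all add: fs algebra_simps)
  have vals: "f e1 = 1" "g e1 = 0"
    using norm c[OF e] by (simp_all add: fs)
  have G2: "(0, c *s e1, w *s e1 + c *s e2) \<in> \<Gamma>" for c w
    using comb[OF e e1 zero zero zero, of c w] by (simp add: algebra_simps)
  have "summand V2 T13"
  proof (rule summandI[of e1 e2 0 0 0 0 0 0 0 0 0 0 0 0 0 _ _
      f g zf zf zf zf zf zf zf zf m zf zf zf zf])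
    show "(coords f g zf x, coords f g zf y + coords zf zf zf x,
        coords f g zf z + coords zf zf zf y + coords zf m zf x) \<in> T13"
      if "(x, y, z) \<in> \<Gamma>" for x y z
      using c[OF that] by (auto simp: T13_def coords_def algebra_simps)
  qed (use sub[OF e] sub[OF e1] zero subspace_0[OF V] in
      \<open>auto simp: V2_def T13_def G2 fs norm vals model_simps split: prod.splits\<close>)
  with ns show False ..
qed

lemma summand_T4:
  assumes ns: "\<not> summand V1 T4"
    and v: "(0, 0, v) \<in> \<Gamma>"
    and y: "(0, v, y1) \<in> \<Gamma>"
    and x1: "(x1, y1, s) \<in> \<Gamma>"
  shows "\<exists>g :: nat \<Rightarrow> _. (\<forall>i. g i \<in> \<Gamma>) \<and> v = X g 0"
proof (rule ccontr)
  assume no: "\<not> ?thesis"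
  let ?L = "\<lambda>g :: nat \<Rightarrow> _. (X g 0, 0, 0, 0, 0, 0) :: 'v six"
  obtain f r0 r1 r2 r3 r4 where ann: "annihilates ?L f r0 r1 r2 r3 r4" and norm: "f v = 1"
    by (rule exists_annihilator[of ?L v]) (use no in \<open>auto simp: algebra_simps\<close>)
  note fs = annihilates_simps[OF ann] and rel = annihilates_relation[OF ann]
  have c: "f x = 0"
    if "(x, y, z) \<in> \<Gamma>" for x y z
    using rel[OF that, of 0] by (simp_all add: fs algebra_simps)
  have G1: "(a *s x1, a *s y1, a *s s) \<in> \<Gamma>" for a
    using scl[OF x1, of a] by simp
  have G2: "(0, c *s v, z *s v + c *s y1) \<in> \<Gamma>" for c z
    using comb[OF y v zero zero zero, of c z] by (simp add: algebra_simps)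
  have "summand V1 T4"
  proof (rule summandI[of v 0 0 x1 0 0 y1 0 0 0 0 0 s 0 0 _ _
      f zf zf zf zf zf zf zf zf zf zf zf zf zf zf])
    show "(coords f zf zf x, coords f zf zf y + coords zf zf zf x,
        coords f zf zf z + coords zf zf zf y + coords zf zf zf x) \<in> T4"
      if "(x, y, z) \<in> \<Gamma>" for x y z
      using c[OF that] by (auto simp: T4_def coords_def algebra_simps)
  qed (use sub[OF v] sub[OF y] sub[OF x1] zero subspace_0[OF V] in
      \<open>auto simp: V1_def T4_def G1 G2 fs norm model_simps split: prod.splits\<close>)
  with ns show False ..
qed

lemma summand_T2:
  assumes ns: "\<not> summand V1 T2"
    and v: "(0, v, y1) \<in> \<Gamma>"
    and x1: "(x1, y1, s) \<in> \<Gamma>"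
  shows "\<exists>g :: nat \<Rightarrow> _. (\<forall>i. g i \<in> \<Gamma>) \<and> v = X g 0 + Z g 1 \<and> Y g 1 = 0 \<and> X g 1 = 0"
proof (rule ccontr)
  assume no: "\<not> ?thesis"
  let ?L = "\<lambda>g :: nat \<Rightarrow> _. (X g 0 + Z g 1, Y g 1, X g 1, 0, 0, 0) :: 'v six"
  obtain f k l r0 r1 r2 where ann: "annihilates ?L f k l r0 r1 r2" and norm: "f v = 1"
    by (rule exists_annihilator[of ?L v]) (use no in \<open>auto simp: algebra_simps\<close>)
  note fs = annihilates_simps[OF ann] and rel = annihilates_relation[OF ann]
  have c: "f x = 0" "f z + k y + l x = 0"
    if "(x, y, z) \<in> \<Gamma>" for x y z
    using rel[OF that, of 0] rel[OF that, of 1] by (simp_all add: fs algebra_simps)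
  have G1: "(a *s x1, a *s y1, a *s s) \<in> \<Gamma>" for a
    using scl[OF x1, of a] by simp
  have G2: "(0, c *s v, c *s y1) \<in> \<Gamma>" for c
    using scl[OF v, of c] by (simp add: algebra_simps)
  have "summand V1 T2"
  proof (rule summandI[of v 0 0 x1 0 0 y1 0 0 0 0 0 s 0 0 _ _
      f zf zf zf zf zf k zf zf l zf zf zf zf zf])
    show "(coords f zf zf x, coords f zf zf y + coords zf zf zf x,
        coords f zf zf z + coords k zf zf y + coords l zf zf x) \<in> T2"
      if "(x, y, z) \<in> \<Gamma>" for x y z
      using c[OF that] by (auto simp: T2_def coords_def algebra_simps)
  qed (use sub[OF v] sub[OF x1] zero subspace_0[OF V] in
      \<open>auto simp: V1_def T2_def G1 G2 fs norm model_simps split: prod.splits\<close>)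
  with ns show False ..
qed

lemma summand_T8:
  assumes ns: "\<not> summand V2 T8"
    and b: "(b, v + x1, s) \<in> \<Gamma>"
    and y1: "(0, b, y1) \<in> \<Gamma>"
    and x1: "(x1, y1, s1) \<in> \<Gamma>"
  shows "\<exists>g :: nat \<Rightarrow> _. (\<forall>i. g i \<in> \<Gamma>) \<and> v = X g 0 + Y g 1 + Z g 2 \<and> - X g 1 = 0 \<and> Y g 2 = 0
      \<and> X g 2 = 0"
proof (rule ccontr)
  assume no: "\<not> ?thesis"
  let ?L = "\<lambda>g :: nat \<Rightarrow> _. (X g 0 + Y g 1 + Z g 2, - X g 1, Y g 2, X g 2, 0, 0) :: 'v six"
  obtain f g k l r0 r1 where ann: "annihilates ?L f g k l r0 r1" and norm: "f v = 1"
    by (rule exists_annihilator[of ?L v]) (use no in \<open>auto simp: algebra_simps\<close>)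
  note fs = annihilates_simps[OF ann] and rel = annihilates_relation[OF ann]
  have c: "f x = 0" "f y = g x" "f z + k y + l x = 0"
    if "(x, y, z) \<in> \<Gamma>" for x y z
    using rel[OF that, of 0] rel[OF that, of 1] rel[OF that, of 2]
    by (simp_all add: fs algebra_simps)
  have vV: "v \<in> V"
    using subspace_diff[OF V, of "v + x1" x1] sub[OF b] sub[OF x1] by simp
  have vals: "f b = 0" "g b = 1"
    using norm c[OF b] c[OF x1] by (simp_all add: fs)
  have G1: "(a *s x1, a *s y1, a *s s1) \<in> \<Gamma>" for a
    using scl[OF x1, of a] by simp
  have G2: "(a *s b, a *s v + c *s b + a *s x1, z *s b + c *s y1 + a *s s) \<in> \<Gamma>" for a c z
    using comb[OF b y1 shift[OF b] zero zero, of a c z] by (simp add: algebra_simps)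
  have "summand V2 T8"
  proof (rule summandI[of v b 0 0 x1 0 0 y1 0 0 s 0 0 s1 0 _ _
      f g zf zf k zf k zf zf l zf zf zf zf zf])
    show "(coords f g zf x, coords f g zf y + coords zf k zf x,
        coords f g zf z + coords k zf zf y + coords l zf zf x) \<in> T8"
      if "(x, y, z) \<in> \<Gamma>" for x y z
      using c[OF that] by (auto simp: T8_def coords_def algebra_simps)
  qed (use sub[OF b] sub[OF y1] sub[OF x1] vV zero subspace_0[OF V] in
      \<open>auto simp: V2_def T8_def G1 G2 fs norm vals model_simps split: prod.splits\<close>)
  with ns show False ..
qed

text \<open>\<open>T6\<close> describes all of \<open>k[[t]]\<close>, so a projection onto it obeys
  no relation: \<open>L\<close> is zero, and any functional with value 1 at \<open>v\<close> will
  do. Hence an embedded copy always splits off, unless \<open>v\<close> vanishes.\<close>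

lemma summand_T6:
  assumes ns: "\<not> summand V1 T6"
    and v: "(v, e, s) \<in> \<Gamma>"
    and u: "(0, v, u) \<in> \<Gamma>"
    and y: "(e, u, s') \<in> \<Gamma>"
  shows "\<exists>g :: nat \<Rightarrow> _. (\<forall>i. g i \<in> \<Gamma>) \<and> v = 0"
proof (rule ccontr)
  assume no: "\<not> ?thesis"
  let ?L = "\<lambda>g :: nat \<Rightarrow> _. (0, 0, 0, 0, 0, 0) :: 'v six"
  obtain f r0 r1 r2 r3 r4 where ann: "annihilates ?L f r0 r1 r2 r3 r4" and norm: "f v = 1"
    by (rule exists_annihilator[of ?L v]) (use no in \<open>auto simp: algebra_simps\<close>)
  note fs = annihilates_simps[OF ann] and rel = annihilates_relation[OF ann]
  have G1: "(a *s e, a *s u, a *s s') \<in> \<Gamma>" for a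
    using scl[OF y, of a] by simp
  have G2: "(a *s v, c *s v + a *s e, z *s v + c *s u + a *s s) \<in> \<Gamma>" for a c z
    using comb[OF v u shift[OF v] zero zero, of a c z] by (simp add: algebra_simps)
  have "summand V1 T6"
  proof (rule summandI[of v 0 0 e 0 0 u 0 0 s 0 0 "s'" 0 0 _ _
      f zf zf zf zf zf zf zf zf zf zf zf zf zf zf])
  qed (use sub[OF v] sub[OF u] sub[OF y] zero subspace_0[OF V] in
      \<open>auto simp: V1_def T6_def G1 G2 fs norm model_simps split: prod.splits\<close>)
  with ns show False ..
qed

lemma summand_T7:
  assumes ns: "\<not> summand V2 T7"
    and v: "(b, v, s) \<in> \<Gamma>"
  shows "\<exists>g :: nat \<Rightarrow> _. (\<forall>i. g i \<in> \<Gamma>) \<and> v = X g 0 + Y g 1 + Z g 3 \<and> Y g 2 - X g 1 = 0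
      \<and> X g 2 + Y g 3 = 0 \<and> X g 3 = 0"
proof (rule ccontr)
  assume no: "\<not> ?thesis"
  let ?L = "\<lambda>g :: nat \<Rightarrow> _. (X g 0 + Y g 1 + Z g 3, Y g 2 - X g 1, X g 2 + Y g 3, X g 3, 0,
      0) :: 'v six"
  obtain f g k l r0 r1 where ann: "annihilates ?L f g k l r0 r1" and norm: "f v = 1"
    by (rule exists_annihilator[of ?L v]) (use no in \<open>auto simp: algebra_simps\<close>)
  note fs = annihilates_simps[OF ann] and rel = annihilates_relation[OF ann]
  have c: "f x = 0" "f y = g x" "g y + k x = 0" "f z + k y + l x = 0"
    if "(x, y, z) \<in> \<Gamma>" for x y z
    using rel[OF that, of 0] rel[OF that, of 1] rel[OF that, of 2] rel[OF that, of 3]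
    by (simp_all add: fs algebra_simps)
  have vals: "f b = 0" "g b = 1"
    using norm c[OF v] by (simp_all add: fs)
  have G2: "(a *s b, a *s v, z *s b + a *s s) \<in> \<Gamma>" for a z
    using comb[OF v shift[OF v] zero zero zero, of a z] by (simp add: algebra_simps)
  have "summand V2 T7"
  proof (rule summandI[of v b 0 0 0 0 0 0 0 0 s 0 0 0 0 _ _
      f g zf zf k zf k zf zf l zf zf zf zf zf])
    show "(coords f g zf x, coords f g zf y + coords zf k zf x,
        coords f g zf z + coords k zf zf y + coords l zf zf x) \<in> T7"
      if "(x, y, z) \<in> \<Gamma>" for x y z
      using c[OF that] by (auto simp: T7_def coords_def algebra_simps)
  qed (use sub[OF v] zero subspace_0[OF V] in
      \<open>auto simp: V2_def T7_def G2 fs norm vals model_simps split: prod.splits\<close>)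
  with ns show False ..
qed

lemma summand_T5:
  assumes ns: "\<not> summand V1 T5"
    and b: "(b, e, s) \<in> \<Gamma>"
    and y: "(e, u, s') \<in> \<Gamma>"
  shows "\<exists>g :: nat \<Rightarrow> _. (\<forall>i. g i \<in> \<Gamma>) \<and> b = Y g 0 \<and> X g 0 = 0"
proof (rule ccontr)
  assume no: "\<not> ?thesis"
  let ?L = "\<lambda>g :: nat \<Rightarrow> _. (Y g 0, X g 0, 0, 0, 0, 0) :: 'v six"
  obtain g k r0 r1 r2 r3 where ann: "annihilates ?L g k r0 r1 r2 r3" and norm: "g b = 1"
    by (rule exists_annihilator[of ?L b]) (use no in \<open>auto simp: algebra_simps\<close>)
  note fs = annihilates_simps[OF ann] and rel = annihilates_relation[OF ann]
  have c: "g y + k x = 0"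
    if "(x, y, z) \<in> \<Gamma>" for x y z
    using rel[OF that, of 0] by (simp_all add: fs algebra_simps)
  have G1: "(a *s e, a *s u, a *s s') \<in> \<Gamma>" for a
    using scl[OF y, of a] by simp
  have G2: "(a *s b, a *s e, z *s b + a *s s) \<in> \<Gamma>" for a z
    using comb[OF b shift[OF b] zero zero zero, of a z] by (simp add: algebra_simps)
  have "summand V1 T5"
  proof (rule summandI[of b 0 0 e 0 0 u 0 0 s 0 0 "s'" 0 0 _ _
      g zf zf k zf zf zf zf zf zf zf zf zf zf zf])
    show "(coords g zf zf x, coords g zf zf y + coords k zf zf x,
        coords g zf zf z + coords zf zf zf y + coords zf zf zf x) \<in> T5"
      if "(x, y, z) \<in> \<Gamma>" for x y z
      using c[OF that] by (auto simp: T5_def coords_def algebra_simps)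
  qed (use sub[OF b] sub[OF y] zero subspace_0[OF V] in
      \<open>auto simp: V1_def T5_def G1 G2 fs norm model_simps split: prod.splits\<close>)
  with ns show False ..
qed

lemma summand_T1:
  assumes ns: "\<not> summand V1 T1"
    and v0: "v \<in> V"
  shows "\<exists>g :: nat \<Rightarrow> _. (\<forall>i. g i \<in> \<Gamma>) \<and> v = X g 0 + Y g 1 + Z g 2 \<and> X g 2 = 0"
proof (rule ccontr)
  assume no: "\<not> ?thesis"
  let ?L = "\<lambda>g :: nat \<Rightarrow> _. (X g 0 + Y g 1 + Z g 2, X g 2, 0, 0, 0, 0) :: 'v six"
  obtain f l r0 r1 r2 r3 where ann: "annihilates ?L f l r0 r1 r2 r3" and norm: "f v = 1"
    by (rule exists_annihilator[of ?L v]) (use no in \<open>auto simp: algebra_simps\<close>)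
  note fs = annihilates_simps[OF ann] and rel = annihilates_relation[OF ann]
  have c: "f x = 0" "f y = 0" "f z + l x = 0"
    if "(x, y, z) \<in> \<Gamma>" for x y z
    using rel[OF that, of 0] rel[OF that, of 1] rel[OF that, of 2]
    by (simp_all add: fs algebra_simps)
  have "summand V1 T1"
  proof (rule summandI[of v 0 0 0 0 0 0 0 0 0 0 0 0 0 0 _ _
      f zf zf zf zf zf zf zf zf l zf zf zf zf zf])
    show "(coords f zf zf x, coords f zf zf y + coords zf zf zf x,
        coords f zf zf z + coords zf zf zf y + coords l zf zf x) \<in> T1"
      if "(x, y, z) \<in> \<Gamma>" for x y z
      using c[OF that] by (auto simp: T1_def coords_def algebra_simps)
  qed (use v0 zero subspace_0[OF V] in
      \<open>auto simp: V1_def T1_def fs norm model_simps split: prod.splits\<close>)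
  with ns show False ..
qed

end

section \<open>Elimination: if no model splits off, the space is zero\<close>

definition models :: "(('k::field \<times> 'k \<times> 'k) set \<times> (('k \<times> 'k \<times> 'k) \<times> ('k \<times> 'k \<times> 'k) \<times> ('k \<times> 'k \<times> 'k)) set) set" where
  "models = {(V1, T1), (V1, T2), (V1, T3), (V1, T4), (V1, T5), (V1, T6), (V2, T7), (V2, T8), (V2, T9),
     (V2, T10), (V2, T11), (V2, T12), (V2, T13), (UNIV, T14), (UNIV, T15), (UNIV, T16)}"

context triple_space
begin

text \<open>
  If no model is a summand, then each of the lemmas above gives a new inclusion between the subspaces
  attached to \<open>\<Gamma>\<close>, and together they force \<open>V = 0\<close>.
\<close>

theorem exists_summand:
  assumes v: "v \<in> V" "v \<noteq> 0"
  shows "\<exists>(V', \<Gamma>')\<in>models. summand V' \<Gamma>'"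
proof (rule ccontr)
  assume "\<not> ?thesis"
  then have ns: "\<not> summand V1 T1" "\<not> summand V1 T2" "\<not> summand V1 T3" "\<not> summand V1 T4"
    "\<not> summand V1 T5" "\<not> summand V1 T6" "\<not> summand V2 T7" "\<not> summand V2 T8" "\<not> summand V2 T9"
    "\<not> summand V2 T10" "\<not> summand V2 T11" "\<not> summand V2 T12" "\<not> summand V2 T13"
    "\<not> summand UNIV T14" "\<not> summand UNIV T15" "\<not> summand UNIV T16"
    unfolding models_def by auto
  define B where "B = {x. \<exists>y z. (x, y, z) \<in> \<Gamma>}"
  define R where "R = {y. \<exists>x z. (x, y, z) \<in> \<Gamma>}"
  define S where "S = {b + y | b y. b \<in> B \<and> y \<in> R}"
  \<comment> \<open>The refinement of \<open>R\<close> produced by \<open>T9\<close>, whose side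
    conditions say that the first coordinate of one element is the second coordinate of another one
    with vanishing first coordinate.\<close>
  define R3 where "R3 = {y. \<exists>x z s. (x, y, z) \<in> \<Gamma> \<and> (0, x, s) \<in> \<Gamma>}"
  have BI: "x \<in> B" if "(x, y, z) \<in> \<Gamma>" for x y z using that by (auto simp: B_def)
  have RI: "y \<in> R" if "(x, y, z) \<in> \<Gamma>" for x y z using that by (auto simp: R_def)
  have R3I: "y \<in> R3" if "(x, y, z) \<in> \<Gamma>" "(0, x, s) \<in> \<Gamma>" for x y z s
    using that by (auto simp: R3_def)
  have B0: "0 \<in> B" by (rule BI[OF zero])
  have R0: "0 \<in> R" by (rule RI[OF zero])
  have B_add: "x + y \<in> B" if "x \<in> B" "y \<in> B" for x y
    using that by (auto simp: B_def dest: add)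
  have B_neg: "- x \<in> B" if "x \<in> B" for x
    using that by (auto simp: B_def dest: neg)
  have R_add: "x + y \<in> R" if "x \<in> R" "y \<in> R" for x y
    using that unfolding R_def mem_Collect_eq by (meson add)
  have R3_add: "x + y \<in> R3" if "x \<in> R3" "y \<in> R3" for x y
  proof -
    from that obtain a c d a' c' d' where *: "(a, x, c) \<in> \<Gamma>" "(0, a, d) \<in> \<Gamma>"
      "(a', y, c') \<in> \<Gamma>" "(0, a', d') \<in> \<Gamma>" by (auto simp: R3_def)
    show ?thesis
      using R3I[OF add[OF *(1,3)], of "d + d'"] add[OF *(2,4)] by simp
  qed
  have S_I: "b + y \<in> S" if "b \<in> B" "y \<in> R" for b y using that by (auto simp: S_def)
  have SB: "x \<in> S" if "x \<in> B" for x using S_I[OF that R0] by simp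
  have SR: "x \<in> S" if "x \<in> R" for x using S_I[OF B0 that] by simp
  have S_add: "x + y \<in> S" if "x \<in> S" "y \<in> S" for x y
  proof -
    from that obtain b c b' c' where *: "b \<in> B" "c \<in> R" "b' \<in> B" "c' \<in> R" "x = b + c" "y = b' + c'"
      by (auto simp: S_def)
    have "x + y = (b + b') + (c + c')" using * by simp
    then show ?thesis using S_I[OF B_add[OF *(1,3)] R_add[OF *(2,4)]] by simp
  qed
  have S_D: "\<exists>b y x s. b \<in> B \<and> (x, y, s) \<in> \<Gamma> \<and> v = b + y" if "v \<in> S" for v
    using that unfolding S_def R_def by blast
  have B4: "(0, 0, x) \<in> \<Gamma>" if "x \<in> B" for x
    using that shift by (auto simp: B_def)
  \<comment> \<open>With \<open>B4\<close>, the third coordinate of an element of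
    \<open>\<Gamma>\<close> may be changed by elements of \<open>B\<close>. Memberships such as
    \<open>z \<in> S\<close> serve to normalise it to an element of \<open>R\<close>.\<close>
  have third: "(x, y, z - b) \<in> \<Gamma>" if "(x, y, z) \<in> \<Gamma>" "(0, 0, b) \<in> \<Gamma>" for x y z b
    using diff[OF that] by simp
  have eq_neg: "y = - x" if "- x - y = 0" for x y :: 'v
    using that by (simp add: algebra_simps eq_neg_iff_add_eq_0)

  have fam0: "(0, Y g i, Z g i) \<in> \<Gamma>" if "\<forall>i. g i \<in> \<Gamma>" "X g i = 0" for g :: "nat \<Rightarrow> _" and i
    using family[OF that(1), of i] that(2) by metis
  have fam00: "(0, 0, Z g i) \<in> \<Gamma>" if "\<forall>i. g i \<in> \<Gamma>" "X g i = 0" "Y g i = 0" for g :: "nat \<Rightarrow> _" and i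
    using family[OF that(1), of i] that(2,3) by metis

  have c1: "v \<in> S" if "(0, 0, v) \<in> \<Gamma>" for v
  proof -
    from summand_T3[OF ns(3) that] obtain g :: "nat \<Rightarrow> _" where g: "\<forall>i. g i \<in> \<Gamma>" "v = X g 0 + Y g 1" by blast
    show ?thesis unfolding g(2) using S_I[OF BI RI, OF family family, OF g(1) g(1)] .
  qed
  have c2: "\<exists>b\<in>B. \<exists>y\<in>R3. v = b + y" if v: "(0, 0, v) \<in> \<Gamma>" for v
  proof -
    from S_D[OF c1[OF v]] obtain b y x s where *: "b \<in> B" "(x, y, s) \<in> \<Gamma>" "v = b + y" by blast
    then have "(0, 0, y) \<in> \<Gamma>" using third[OF v B4[OF *(1)]] by simp
    from summand_T9[OF ns(9) this *(2)] obtain g :: "nat \<Rightarrow> _" where g: "\<forall>i. g i \<in> \<Gamma>"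
      "y = X g 0 + Y g 1" "Y g 2 = X g 1" "X g 2 = 0" by auto
    have "Y g 1 \<in> R3"
      using R3I[OF family[OF g(1), of 1], of "Z g 2"] fam0[OF g(1), of 2] fam00[OF g(1), of 2] family[OF g(1), of 2] g(3,4) by simp
    moreover have "b + X g 0 \<in> B" by (rule B_add[OF *(1) BI[OF family[OF g(1)]]])
    moreover have "v = (b + X g 0) + Y g 1" using * g by (simp add: algebra_simps)
    ultimately show ?thesis by blast
  qed
  have c2': "v \<in> S" if *: "(0, b, v) \<in> \<Gamma>" "(b, y0, z0) \<in> \<Gamma>" "(y0, u, s) \<in> \<Gamma>" for b v y0 z0 u s
  proof -
    have "(0, b, (v - u) + u) \<in> \<Gamma>" using * by simp
    from summand_T11[OF ns(11) this *(2,3)] obtain g :: "nat \<Rightarrow> _" where g: "\<forall>i. g i \<in> \<Gamma>"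
      "v - u = X g 0 + Y g 1 + Z g 2" "Y g 2 = 0" "X g 2 = 0" by auto
    have "Z g 2 \<in> S" using c1[of "Z g 2"] fam0[OF g(1), of 2] fam00[OF g(1), of 2] family[OF g(1), of 2] g(3,4) by simp
    then have "v - u \<in> S" unfolding g(2)
      by (intro S_add SB[OF BI[OF family[OF g(1)]]] SR[OF RI[OF family[OF g(1)]]])
    then show ?thesis using S_add[OF _ SR[OF RI[OF *(3)]], of "v - u"] by simp
  qed
  have c3: "v2 \<in> S" if *: "(0, b, v2) \<in> \<Gamma>" "(b, v1, s) \<in> \<Gamma>" for b v1 v2 s
  proof -
    from summand_T15[OF ns(15) *(2,1)] obtain g :: "nat \<Rightarrow> _" where g: "\<forall>i. g i \<in> \<Gamma>"
      "v2 = X g 1 + Y g 3 + Z g 5" "X g 0 + Y g 2 + Z g 4 = 0" "- X g 2 - Y g 5 = 0"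
      "Y g 4 = 0" "X g 4 = 0" "- X g 5 = 0" by blast
    have 1: "(0, Y g 5, Z g 5) \<in> \<Gamma>" using fam0[OF g(1), of 5] fam00[OF g(1), of 5] family[OF g(1), of 5] g(7) by (metis neg_equal_0_iff_equal)
    have 2: "(Y g 5, - Y g 2, - Z g 2) \<in> \<Gamma>"
      using neg[OF family[OF g(1), of 2]] eq_neg[OF g(4)] by simp
    have "- Y g 2 = X g 0 + Z g 4" using g(3) by (simp add: neg_eq_iff_add_eq_0 ac_simps)
    moreover have "(0, 0, Z g 4) \<in> \<Gamma>" using fam0[OF g(1), of 4] fam00[OF g(1), of 4] family[OF g(1), of 4] g(5,6) by simp
    ultimately have 3: "(0, 0, - Y g 2) \<in> \<Gamma>"
      using add[OF shift[OF family[OF g(1), of 0]], of 0 0 "Z g 4"] by simp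
    \<comment> \<open>The remainder \<open>Z g 5\<close> left by \<open>T15\<close> is again in the
      situation of \<open>T15\<close>, with \<open>b = Y g 5\<close> and
      \<open>v1 = - Y g 2\<close>, and now satisfies the additional hypothesis of \<open>T16\<close>
      as well. The remainder left by \<open>T16\<close> falls under \<open>c2'\<close>.\<close>
    from summand_T16[OF ns(16) 2 1 3] obtain h :: "nat \<Rightarrow> _" where h: "\<forall>i. h i \<in> \<Gamma>"
      "Z g 5 = X h 1 + Y h 3 + Z h 4" "X h 0 + Y h 2 = 0" "- X h 2 - Y h 4 = 0" "- X h 4 = 0" by blast
    have 4: "(0, Y h 4, Z h 4) \<in> \<Gamma>" using fam0[OF h(1), of 4] fam00[OF h(1), of 4] family[OF h(1), of 4] h(5) by simp
    have 5: "(Y h 4, X h 0, - Z h 2) \<in> \<Gamma>"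
      using neg[OF family[OF h(1), of 2]] eq_neg[OF h(4)] h(3) by (simp add: add_eq_0_iff2)
    have "Z h 4 \<in> S" by (rule c2'[OF 4 5 family[OF h(1)]])
    then have "Z g 5 \<in> S" unfolding h(2)
      by (intro S_add SB[OF BI[OF family[OF h(1)]]] SR[OF RI[OF family[OF h(1)]]])
    then show ?thesis unfolding g(2)
      by (intro S_add SB[OF BI[OF family[OF g(1)]]] SR[OF RI[OF family[OF g(1)]]])
  qed
  have c4: "\<exists>b\<in>B. \<exists>y s. (0, y, s) \<in> \<Gamma> \<and> v = b + y" if v: "(0, 0, v) \<in> \<Gamma>" for v
  proof -
    from c2[OF v] obtain b y x s s' where *: "b \<in> B" "(x, y, s) \<in> \<Gamma>" "(0, x, s') \<in> \<Gamma>" "v = b + y"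
      by (auto simp: R3_def)
    have y: "(0, 0, y) \<in> \<Gamma>" using third[OF v B4[OF *(1)]] *(4) by simp
    from S_D[OF c3[OF *(3,2)]] obtain b1 y1 x1 s1 where **: "b1 \<in> B" "(x1, y1, s1) \<in> \<Gamma>" "s' = b1 + y1" by blast
    have 1: "(0, x, y1) \<in> \<Gamma>" using third[OF *(3) B4[OF **(1)]] **(3) by simp
    have 2: "(0, 0, y - x1) \<in> \<Gamma>" by (rule third[OF y shift[OF **(2)]])
    have 3: "(x, (y - x1) + x1, s) \<in> \<Gamma>" using *(2) by simp
    from summand_T10[OF ns(10) 2 3 1 **(2)] obtain g :: "nat \<Rightarrow> _" where g: "\<forall>i. g i \<in> \<Gamma>"
      "y - x1 = X g 0 + Y g 1" "X g 1 = 0" by auto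
    have "b + x1 + X g 0 \<in> B" by (intro B_add *(1) BI[OF **(2)] BI[OF family[OF g(1)]])
    moreover have "(0, Y g 1, Z g 1) \<in> \<Gamma>" using fam0[OF g(1), of 1] fam00[OF g(1), of 1] family[OF g(1), of 1] g(3) by simp
    moreover have "v = (b + x1 + X g 0) + Y g 1" using *(4) g(2) by (simp add: algebra_simps)
    ultimately show ?thesis by blast
  qed
  have c5: "\<exists>b'\<in>B. \<exists>y\<in>R3. v - u = b' + y"
    if *: "(0, b, v) \<in> \<Gamma>" "(b, y0, z0) \<in> \<Gamma>" "(y0, u, s) \<in> \<Gamma>" for b v y0 z0 u s
  proof -
    have "v - u \<in> S" using S_add[OF c3[OF *(1,2)] SR[OF RI[OF neg[OF *(3)]]]] by simp
    from S_D[OF this] obtain b0 y1 b2 z2 where **: "b0 \<in> B" "(b2, y1, z2) \<in> \<Gamma>" "v - u = b0 + y1" by blast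
    have 1: "(0, b, y1 + u) \<in> \<Gamma>" using third[OF *(1) B4[OF **(1)]] **(3) by (simp add: algebra_simps)
    from summand_T14[OF ns(14) *(2,3) **(2) 1] obtain g :: "nat \<Rightarrow> _" where g: "\<forall>i. g i \<in> \<Gamma>"
      "y1 = X g 0 + Y g 1 + Z g 3" "Y g 2 = X g 1" "X g 2 = 0" "Y g 3 = 0" "X g 3 = 0" by auto
    have "(0, 0, Z g 3) \<in> \<Gamma>" using fam0[OF g(1), of 3] fam00[OF g(1), of 3] family[OF g(1), of 3] g(5,6) by simp
    from c2[OF this] obtain b3 y3 where 3: "b3 \<in> B" "y3 \<in> R3" "Z g 3 = b3 + y3" by blast
    have "Y g 1 \<in> R3"
      using R3I[OF family[OF g(1), of 1], of "Z g 2"] fam0[OF g(1), of 2] fam00[OF g(1), of 2] family[OF g(1), of 2] g(3,4) by simp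
    then have "Y g 1 + y3 \<in> R3" using R3_add 3 by blast
    moreover have "b0 + X g 0 + b3 \<in> B" by (intro B_add **(1) 3(1) BI[OF family[OF g(1)]])
    moreover have "v - u = (b0 + X g 0 + b3) + (Y g 1 + y3)" using **(3) g(2) 3(3) by (simp add: algebra_simps)
    ultimately show ?thesis by blast
  qed
  have c6: "e2 \<in> S" if e: "(0, e1, e2) \<in> \<Gamma>" for e1 e2
  proof -
    from summand_T12[OF ns(12) e] obtain g :: "nat \<Rightarrow> _" where g: "\<forall>i. g i \<in> \<Gamma>"
      "e2 = X g 1 + Y g 2 + Z g 4" "X g 0 + Z g 3 - Y g 4 = 0" "Y g 3 = 0" "X g 3 = 0" "X g 4 = 0" by auto
    have 1: "(0, Y g 4, Z g 4) \<in> \<Gamma>" using fam0[OF g(1), of 4] fam00[OF g(1), of 4] family[OF g(1), of 4] g(6) by simp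
    have "(0, 0, Z g 3) \<in> \<Gamma>" using fam0[OF g(1), of 3] fam00[OF g(1), of 3] family[OF g(1), of 3] g(4,5) by simp
    from add[OF shift[OF family[OF g(1), of 0]] this]
    have 2: "(0, 0, Y g 4) \<in> \<Gamma>" using g(3) by simp
    \<comment> \<open>The same two-stage argument as for \<open>T15\<close> and \<open>T16\<close>:
      the remainder of \<open>T12\<close> meets the extra hypothesis of \<open>T13\<close>, and the
      remainder of \<open>T13\<close> is covered by \<open>c3\<close>.\<close>
    from summand_T13[OF ns(13) 1 2] obtain h :: "nat \<Rightarrow> _" where h: "\<forall>i. h i \<in> \<Gamma>"
      "Z g 4 = X h 1 + Y h 2 + Z h 3" "X h 0 = Y h 3" "X h 3 = 0" by auto
    have 3: "(0, Y h 3, Z h 3) \<in> \<Gamma>" using fam0[OF h(1), of 3] fam00[OF h(1), of 3] family[OF h(1), of 3] h(4) by simp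
    have 4: "(Y h 3, Y h 0, Z h 0) \<in> \<Gamma>" using fam0[OF h(1), of 0] fam00[OF h(1), of 0] family[OF h(1), of 0] h(3) by simp
    have "Z g 4 \<in> S" unfolding h(2) using c3[OF 3 4]
      by (intro S_add SB[OF BI[OF family[OF h(1)]]] SR[OF RI[OF family[OF h(1)]]])
    then show ?thesis unfolding g(2)
      by (intro S_add SB[OF BI[OF family[OF g(1)]]] SR[OF RI[OF family[OF g(1)]]])
  qed
  have c6': "\<exists>x1 y1 s1. (0, y, y1) \<in> \<Gamma> \<and> (x1, y1, s1) \<in> \<Gamma>" if "(0, y, s) \<in> \<Gamma>" for y s
  proof -
    from S_D[OF c6[OF that]] obtain b1 y1 x1 s1 where "b1 \<in> B" "(x1, y1, s1) \<in> \<Gamma>" "s = b1 + y1" by blast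
    then show ?thesis using third[OF that B4, of b1] by auto
  qed
  have c7: "v \<in> B" if v: "(0, 0, v) \<in> \<Gamma>" for v
  proof -
    from c4[OF v] obtain b y s where *: "b \<in> B" "(0, y, s) \<in> \<Gamma>" "v = b + y" by blast
    have y: "(0, 0, y) \<in> \<Gamma>" using third[OF v B4[OF *(1)]] *(3) by simp
    from c6'[OF *(2)] obtain x1 y1 s1 where **: "(0, y, y1) \<in> \<Gamma>" "(x1, y1, s1) \<in> \<Gamma>" by blast
    from summand_T4[OF ns(4) y **] obtain g :: "nat \<Rightarrow> _" where g: "\<forall>i. g i \<in> \<Gamma>" "y = X g 0" by auto
    show ?thesis unfolding *(3) g(2) by (intro B_add *(1) BI[OF family[OF g(1)]])
  qed
  have c8: "y \<in> B" if y: "(0, y, z) \<in> \<Gamma>" for y z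
  proof -
    from c6'[OF y] obtain x1 y1 s1 where **: "(0, y, y1) \<in> \<Gamma>" "(x1, y1, s1) \<in> \<Gamma>" by blast
    from summand_T2[OF ns(2) **] obtain g :: "nat \<Rightarrow> _" where g: "\<forall>i. g i \<in> \<Gamma>" "y = X g 0 + Z g 1" "Y g 1 = 0" "X g 1 = 0" by auto
    have "Z g 1 \<in> B" using c7[of "Z g 1"] fam0[OF g(1), of 1] fam00[OF g(1), of 1] family[OF g(1), of 1] g(3,4) by simp
    then show ?thesis unfolding g(2) by (intro B_add BI[OF family[OF g(1)]])
  qed
  have c9: "y0 \<in> B" if *: "(0, b, z0) \<in> \<Gamma>" "(b, y0, s) \<in> \<Gamma>" for b z0 y0 s
  proof -
    from c6'[OF *(1)] obtain x1 y1 s1 where **: "(0, b, y1) \<in> \<Gamma>" "(x1, y1, s1) \<in> \<Gamma>" by blast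
    have "(b, (y0 - x1) + x1, s) \<in> \<Gamma>" using * by simp
    from summand_T8[OF ns(8) this **] obtain g :: "nat \<Rightarrow> _" where g: "\<forall>i. g i \<in> \<Gamma>" "y0 - x1 = X g 0 + Y g 1 + Z g 2"
      "X g 1 = 0" "Y g 2 = 0" "X g 2 = 0" by auto
    have 1: "Y g 1 \<in> B" by (rule c8[OF fam0[OF g(1,3)]])
    have 2: "Z g 2 \<in> B" by (rule c7[OF fam00[OF g(1,5,4)]])
    have "y0 = x1 + (X g 0 + Y g 1 + Z g 2)" using g(2) by (simp add: algebra_simps)
    then show ?thesis using 1 2 by (auto intro!: B_add BI[OF **(2)] BI[OF family[OF g(1)]])
  qed
  have c10: "b = 0" if b: "(0, b, z) \<in> \<Gamma>" for b z
  proof -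
    from c8[OF b] obtain y0 s where 1: "(b, y0, s) \<in> \<Gamma>" by (auto simp: B_def)
    from c9[OF b 1] obtain u s' where 2: "(y0, u, s') \<in> \<Gamma>" by (auto simp: B_def)
    from c5[OF b 1 2] obtain b' y where 3: "b' \<in> B" "y \<in> R3" "z - u = b' + y" by blast
    from 3(2) have "y \<in> B" using c9 by (auto simp: R3_def)
    then have "(0, 0, z - u) \<in> \<Gamma>" unfolding 3(3) by (intro B4 B_add 3(1))
    then have "(0, b, u) \<in> \<Gamma>" using third[OF b, of "z - u"] by simp
    \<comment> \<open>The chain \<open>b\<close>, \<open>y0\<close>, \<open>u\<close> is the start
      of a copy of \<open>k[[t]]\<close> in the module, provided that
      \<open>(0, b, u) \<in> \<Gamma>\<close>. What was known is \<open>(0, b, z)\<close>;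
      \<open>c5\<close> and \<open>c9\<close> show that \<open>z - u\<close> lies in
      \<open>B\<close>, which is the freedom in the third coordinate.\<close>
    from summand_T6[OF ns(6) 1 this 2] show ?thesis by blast
  qed
  have c11: "v \<in> B" if v: "(b, v, s) \<in> \<Gamma>" for b v s
  proof -
    from summand_T7[OF ns(7) v] obtain g :: "nat \<Rightarrow> _" where g: "\<forall>i. g i \<in> \<Gamma>" "v = X g 0 + Y g 1 + Z g 3"
      "Y g 2 = X g 1" "X g 2 + Y g 3 = 0" "X g 3 = 0" by auto
    have Y3: "Y g 3 = 0" by (rule c10[OF fam0[OF g(1,5)]])
    then have X2: "X g 2 = 0" using g(4) by simp
    have X1: "X g 1 = 0" using c10[OF fam0[OF g(1) X2]] g(3) by simp
    have "Y g 1 = 0" by (rule c10[OF fam0[OF g(1) X1]])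
    moreover have "Z g 3 \<in> B" by (rule c7[OF fam00[OF g(1,5) Y3]])
    ultimately show ?thesis unfolding g(2) by (auto intro!: B_add BI[OF family[OF g(1)]])
  qed
  have c12: "b = 0" if b: "(b, y, s) \<in> \<Gamma>" for b y s
  proof -
    from c11[OF b] obtain u s' where 2: "(y, u, s') \<in> \<Gamma>" by (auto simp: B_def)
    from summand_T5[OF ns(5) b 2] obtain g :: "nat \<Rightarrow> _" where g: "\<forall>i. g i \<in> \<Gamma>" "b = Y g 0" "X g 0 = 0" by auto
    show ?thesis using c10[OF fam0[OF g(1,3)]] g(2) by simp
  qed
  \<comment> \<open>\<open>T1\<close> describes the smaller ring itself. Its failure writes every
    vector as a sum of entries of elements of \<open>\<Gamma>\<close>, and by now all such entries
    vanish.\<close>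
  from summand_T1[OF ns(1) v(1)] obtain g :: "nat \<Rightarrow> _" where g: "\<forall>i. g i \<in> \<Gamma>" "v = X g 0 + Y g 1 + Z g 2" "X g 2 = 0" by auto
  have x: "X g i = 0" for i by (rule c12[OF family[OF g(1)]])
  have y: "Y g i = 0" for i by (rule c10[OF fam0[OF g(1) x]])
  have "Z g 2 \<in> B" by (rule c7[OF fam00[OF g(1) x y]])
  then have "Z g 2 = 0" using c12 by (auto simp: B_def)
  then show False using g(2) x y v(2) by simp
qed

end

section \<open>Maps between modules of power series\<close>

definition fps_act :: "('k::field \<Rightarrow> 'v \<Rightarrow> 'v) \<Rightarrow> 'k fps \<Rightarrow> (nat \<Rightarrow> 'v) \<Rightarrow> nat \<Rightarrow> 'v::ab_group_add" where
  "fps_act sc s v n = (\<Sum>i\<le>n. sc (fps_nth s i) (v (n - i)))"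

definition lattice_seq :: "'v set \<Rightarrow> ('v \<times> 'v \<times> 'v) set \<Rightarrow> (nat \<Rightarrow> 'v) set" where
  "lattice_seq V \<Gamma> = {v. (\<forall>n. v n \<in> V) \<and> (v 1, v 2, v 4) \<in> \<Gamma>}"

text \<open>The \<open>k[[t]]\<close>-linear map given by the operator-valued power series with
  coefficients \<open>\<Phi> j\<close>.\<close>

definition convolution :: "(nat \<Rightarrow> 'v \<Rightarrow> 'w) \<Rightarrow> (nat \<Rightarrow> 'v) \<Rightarrow> nat \<Rightarrow> 'w::ab_group_add" where
  "convolution \<Phi> v n = (\<Sum>j\<le>n. \<Phi> j (v (n - j)))"

lemma sum_triangle_swap:
  fixes F :: "nat \<Rightarrow> nat \<Rightarrow> nat \<Rightarrow> 'a::comm_monoid_add"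
  shows "(\<Sum>i\<le>n. \<Sum>j\<le>n - i. F i j (n - i - j)) = (\<Sum>j\<le>n. \<Sum>i\<le>n - j. F i j (n - j - i))"
proof -
  have "(\<Sum>i\<le>n. \<Sum>j\<le>n - i. F i j (n - i - j)) = (\<Sum>(i, j)\<in>{(i, j). i + j \<le> n}. F i j (n - i - j))"
    by (subst sum.Sigma) (auto intro!: sum.cong)
  also have "\<dots> = (\<Sum>(j, i)\<in>{(i, j). i + j \<le> n}. F i j (n - j - i))"
    by (rule sum.reindex_bij_witness[of _ prod.swap prod.swap]) (auto simp: add.commute diff_right_commute)
  also have "\<dots> = (\<Sum>j\<le>n. \<Sum>i\<le>n - j. F i j (n - j - i))"
    by (subst sum.Sigma) (auto intro!: sum.cong)
  finally show ?thesis .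
qed

lemma convolution_fps_act:
  assumes lin: "\<And>j. Vector_Spaces.linear s1 s2 (\<Phi> j)"
  shows "convolution \<Phi> (fps_act s1 r v) = fps_act s2 r (convolution \<Phi> v)"
proof
  fix n
  have *: "\<Phi> j (\<Sum>i\<in>A. f i) = (\<Sum>i\<in>A. \<Phi> j (f i))" "\<Phi> j (s1 c x) = s2 c (\<Phi> j x)"
    for j A f c x
  proof -
    interpret Vector_Spaces.linear s1 s2 "\<Phi> j" by (rule lin)
    show "\<Phi> j (\<Sum>i\<in>A. f i) = (\<Sum>i\<in>A. \<Phi> j (f i))" "\<Phi> j (s1 c x) = s2 c (\<Phi> j x)"
      by (simp_all add: sum scale)
  qed
  interpret L: Vector_Spaces.linear s1 s2 "\<Phi> 0" by (rule lin)
  have "convolution \<Phi> (fps_act s1 r v) n = (\<Sum>j\<le>n. \<Sum>i\<le>n - j. s2 (fps_nth r i) (\<Phi> j (v (n - j - i))))"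
    by (simp add: convolution_def fps_act_def *)
  also have "\<dots> = (\<Sum>i\<le>n. \<Sum>j\<le>n - i. s2 (fps_nth r i) (\<Phi> j (v (n - i - j))))"
    by (rule sum_triangle_swap[symmetric])
  also have "\<dots> = fps_act s2 r (convolution \<Phi> v) n"
    by (simp add: convolution_def fps_act_def L.vs2.scale_sum_right)
  finally show "convolution \<Phi> (fps_act s1 r v) n = fps_act s2 r (convolution \<Phi> v) n" .
qed

lemma convolution_add:
  assumes "\<And>j. Vector_Spaces.linear s1 s2 (\<Phi> j)"
  shows "convolution \<Phi> (u + v) = convolution \<Phi> u + convolution \<Phi> v"
proof -
  have "\<Phi> j (x + y) = \<Phi> j x + \<Phi> j y" for j x y
  proof -
    interpret Vector_Spaces.linear s1 s2 "\<Phi> j" by (rule assms)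
    show ?thesis by (rule add)
  qed
  then show ?thesis by (auto simp: convolution_def sum.distrib)
qed

definition hom_seq where
  "hom_seq f0 f1 f2 f3 f4 j = (if j = 0 then f0 else if j = 1 then f1 else if j = 2 then f2
     else if j = 3 then f3 else if j = 4 then f4 else (\<lambda>_. 0))" for j :: nat

lemma hom_seq_linear:
  assumes "graded_hom s V \<Gamma> s' V' \<Gamma>' f0 f1 f2 f3 f4"
  shows "Vector_Spaces.linear s s' (hom_seq f0 f1 f2 f3 f4 j)"
proof -
  have l: "Vector_Spaces.linear s s' f" if "f \<in> {f0, f1, f2, f3, f4}" for f
    using assms that unfolding graded_hom_def by blast
  interpret Vector_Spaces.linear s s' f0 by (rule l) simp
  have "Vector_Spaces.linear s s' (\<lambda>_. 0)" by unfold_locales auto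
  then show ?thesis using l by (auto simp: hom_seq_def)
qed

lemma convolution_lattice_seq:
  assumes h: "graded_hom s V \<Gamma> s' V' \<Gamma>' f0 f1 f2 f3 f4" and "triple_space s' V' \<Gamma>'"
    and v: "v \<in> lattice_seq V \<Gamma>"
  shows "convolution (hom_seq f0 f1 f2 f3 f4) v \<in> lattice_seq V' \<Gamma>'"
proof -
  interpret T: triple_space s' V' \<Gamma>' by fact
  have V: "v n \<in> V" for n using v by (auto simp: lattice_seq_def)
  have seq [intro]: "hom_seq f0 f1 f2 f3 f4 j x \<in> V'" if "x \<in> V" for j x
    using h that T.subspace_0[OF T.V] by (auto simp: graded_hom_def hom_seq_def)
  then have 1: "convolution (hom_seq f0 f1 f2 f3 f4) v n \<in> V'" for n
    unfolding convolution_def by (intro T.subspace_sum[OF T.V]) (auto intro: V)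
  have h1: "(f1 x, f2 x, f4 x) \<in> \<Gamma>'" if "x \<in> V" for x using h that by (auto simp: graded_hom_def)
  have h2: "(f0 (v 1), f0 (v 2) + f1 (v 1), f0 (v 4) + f2 (v 2) + f3 (v 1)) \<in> \<Gamma>'"
    using h v by (auto simp: graded_hom_def lattice_seq_def)
  \<comment> \<open>The coefficient \<open>v 3\<close> reaches the recorded degrees only through
    \<open>f1\<close>, in degree 4, and this contribution lies in \<open>\<Gamma>'\<close> by
    \<open>shift\<close>. The degree 0 coefficient contributes the triple of
    \<open>h1\<close>.\<close>
  have "(f0 (v 1) + f1 (v 0) + 0, f0 (v 2) + f1 (v 1) + f2 (v 0) + 0,
      f0 (v 4) + f2 (v 2) + f3 (v 1) + f4 (v 0) + f1 (v 3)) \<in> \<Gamma>'"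
    by (intro T.add h1 h2 V T.shift[OF h1])
  then have "(convolution (hom_seq f0 f1 f2 f3 f4) v 1, convolution (hom_seq f0 f1 f2 f3 f4) v 2,
      convolution (hom_seq f0 f1 f2 f3 f4) v 4) \<in> \<Gamma>'"
    by (simp add: convolution_def hom_seq_def numeral_nat atMost_Suc algebra_simps)
  with 1 show ?thesis by (auto simp: lattice_seq_def)
qed

text \<open>
  The map \<open>f\<close> respects the \<open>t\<close>-adic filtration and is unipotent on its graded pieces; the preimage of
  \<open>u\<close> is the limit of the partial sums \<open>t u j\<close> of the Neumann series.
\<close>

lemma neumann_bij:
  fixes f :: "(nat \<Rightarrow> 'v::ab_group_add) \<Rightarrow> nat \<Rightarrow> 'v"
  assumes T: "triple_space s V \<Gamma>"
    and maps: "\<And>v. v \<in> lattice_seq V \<Gamma> \<Longrightarrow> f v \<in> lattice_seq V \<Gamma>"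
    and add: "\<And>u v. f (u + v) = f u + f v"
    and low: "\<And>v n. \<forall>n. v n \<in> V \<Longrightarrow> (\<And>m. m < n \<Longrightarrow> v m = 0) \<Longrightarrow> (\<forall>m<n. f v m = 0) \<and> f v n = f0 (v n)"
    and nil: "\<And>x. x \<in> V \<Longrightarrow> ((\<lambda>x. f0 x - x) ^^ 3) x = 0"
  shows "bij_betw f (lattice_seq V \<Gamma>) (lattice_seq V \<Gamma>)"
proof -
  interpret T: triple_space s V \<Gamma> by (rule T)
  define g where "g v = f v - v" for v
  have f0: "f 0 = 0" using add[of 0 0] by simp
  have f_diff: "f (u - v) = f u - f v" for u v using add[of "u - v" v] by simp
  have f_neg: "f (- v) = - f v" for v using f_diff[of 0 v] f0 by simp
  have L0: "0 \<in> lattice_seq V \<Gamma>" using T.zero T.V0 by (auto simp: lattice_seq_def)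
  have L_diff: "u - v \<in> lattice_seq V \<Gamma>" if "u \<in> lattice_seq V \<Gamma>" "v \<in> lattice_seq V \<Gamma>" for u v
    using that T.subspace_diff[OF T.V] by (auto simp: lattice_seq_def intro!: T.diff)
  have g_diff: "g (u - v) = g u - g v" for u v by (simp add: g_def f_diff)
  have g0: "g 0 = 0" by (simp add: g_def f0)
  have gL: "g v \<in> lattice_seq V \<Gamma>" if "v \<in> lattice_seq V \<Gamma>" for v
    unfolding g_def by (intro L_diff maps that)
  have gnL: "(g ^^ k) v \<in> lattice_seq V \<Gamma>" if "v \<in> lattice_seq V \<Gamma>" for v k
    by (induction k) (auto intro: that gL)
  have rng: "\<forall>n. v n \<in> V" if "v \<in> lattice_seq V \<Gamma>" for v using that by (auto simp: lattice_seq_def)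
  have glow: "(\<forall>m<n. g v m = 0) \<and> g v n = f0 (v n) - v n"
    if "v \<in> lattice_seq V \<Gamma>" "\<And>m. m < n \<Longrightarrow> v m = 0" for v n
    using low[OF rng[OF that(1)] that(2), of n] that(2) by (auto simp: g_def)
  have gklow: "(\<forall>m<n. (g ^^ k) v m = 0) \<and> (g ^^ k) v n = ((\<lambda>x. f0 x - x) ^^ k) (v n)"
    if "v \<in> lattice_seq V \<Gamma>" "\<And>m. m < n \<Longrightarrow> v m = 0" for v n k
  proof (induction k)
    case 0 then show ?case using that by simp
  next
    case (Suc k)
    then show ?case using glow[OF gnL[OF that(1)], of n k] by auto
  qed
  have g3: "(g ^^ 3) v m = 0" if "v \<in> lattice_seq V \<Gamma>" "\<And>m. m < n \<Longrightarrow> v m = 0" "m \<le> n" for v n m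
  proof (cases "m = n")
    case True
    have "v n \<in> V" using that(1) by (auto simp: lattice_seq_def)
    then show ?thesis using True gklow[OF that(1,2), of n 3] nil by simp
  qed (use that gklow[OF that(1,2), of n 3] in auto)
  \<comment> \<open>As \<open>g\<close> is nilpotent of order three on each graded piece, three
    applications of \<open>g\<close> gain one degree of the filtration.\<close>
  have g3n: "(g ^^ (3 * n)) v m = 0" if "v \<in> lattice_seq V \<Gamma>" "m < n" for v n m
    using that(2)
  proof (induction n arbitrary: m)
    case (Suc n)
    have "(g ^^ (3 * Suc n)) v = (g ^^ 3) ((g ^^ (3 * n)) v)" by (simp only: mult_Suc_right funpow_add o_apply)
    then show ?case using g3[OF gnL[OF that(1)] Suc.IH, of n m] Suc.prems by simp
  qed simp
  have inj: "v = 0" if v: "v \<in> lattice_seq V \<Gamma>" "f v = 0" for v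
  proof
    fix n
    \<comment> \<open>On the kernel of \<open>f\<close> every power of \<open>g\<close> acts as a
      sign, while high powers kill any given coefficient.\<close>
    have "g v = 0 - v" using v by (simp add: g_def)
    then have "(g ^^ k) v = v \<or> (g ^^ k) v = 0 - v" for k
      by (induction k) (auto simp: g_def f0 f_neg f_diff)
    from this[of "3 * Suc n"] g3n[OF v(1), of n "Suc n"] show "v n = 0 n" by auto
  qed
  define t where "t u j = rec_nat 0 (\<lambda>j w. u - g w) j" for u :: "nat \<Rightarrow> 'v" and j :: nat
  have tS: "t u 0 = 0" "t u (Suc j) = u - g (t u j)" for u j by (simp_all add: t_def)
  have tL: "t u j \<in> lattice_seq V \<Gamma>" if "u \<in> lattice_seq V \<Gamma>" for u j
    by (induction j) (simp_all only: tS L0 L_diff gL that)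
  \<comment> \<open>The difference is \<open>(-g)^j u\<close>. The sign is left open, since only the
    vanishing of coefficients matters.\<close>
  have td: "t u (Suc j) - t u j = (g ^^ j) u \<or> t u (Suc j) - t u j = 0 - (g ^^ j) u" for u j
  proof (induction j)
    case 0 then show ?case by (simp only: tS g_def f0) simp
  next
    case (Suc j)
    have "t u (Suc (Suc j)) - t u (Suc j) = g (t u j) - g (t u (Suc j))"
      by (simp only: tS) (simp add: g_diff)
    also have "\<dots> = 0 - g (t u (Suc j) - t u j)" by (simp add: g_diff)
    finally have "t u (Suc (Suc j)) - t u (Suc j) = 0 - g (t u (Suc j) - t u j)" .
    moreover have "0 - (0 - g w) = g w" for w by simp
    ultimately show ?case using Suc g0 by (metis comp_apply funpow.simps(2) g_diff)
  qed
  have stab1: "t u (Suc j) m = t u j m" if "u \<in> lattice_seq V \<Gamma>" "3 * Suc m \<le> j" for u j m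
  proof -
    have "(g ^^ j) u = (g ^^ (3 * Suc m)) ((g ^^ (j - 3 * Suc m)) u)"
      using that(2) by (metis funpow_add le_add_diff_inverse o_apply)
    then have "(g ^^ j) u m = 0"
      using g3n[OF gnL[OF that(1)], of m "Suc m" "j - 3 * Suc m"] by simp
    moreover have "(t u (Suc j) - t u j) m = (g ^^ j) u m \<or> (t u (Suc j) - t u j) m = (0 - (g ^^ j) u) m"
      using td[of u j] by metis
    ultimately have "t u (Suc j) m - t u j m = 0" by auto
    then show ?thesis by simp
  qed
  have stab: "t u (3 * Suc m + k) m = t u (3 * Suc m) m" if "u \<in> lattice_seq V \<Gamma>" for u m k
  proof (induction k)
    case (Suc k)
    then show ?case using stab1[OF that, of m "3 * Suc m + k"] by (simp only: add_Suc_right le_add1)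
  qed simp
  have surj: "\<exists>v\<in>lattice_seq V \<Gamma>. f v = u" if u: "u \<in> lattice_seq V \<Gamma>" for u
  proof (intro bexI)
    define v where "v m = t u (3 * Suc m) m" for m
    have v: "v m = t u (3 * Suc n) m" if "m \<le> n" for m n
      using stab[OF u, of m "3 * (n - m)"] that by (simp add: v_def algebra_simps)
    \<comment> \<open>Membership in \<open>\<Gamma>\<close> concerns degrees 1, 2 and 4 jointly, so
      a single partial sum is needed that agrees with the limit in all three of them; stage
      \<open>3 * Suc 4\<close> is final up to degree 4.\<close>
    have "v 1 = t u (3 * Suc 4) 1" "v 2 = t u (3 * Suc 4) 2" "v 4 = t u (3 * Suc 4) 4"
      using v[of 1 4] v[of 2 4] v[of 4 4] by simp_all
    moreover have "v n \<in> V" for n using tL[OF u] by (auto simp: lattice_seq_def v_def)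
    ultimately show vL: "v \<in> lattice_seq V \<Gamma>"
      using tL[OF u, of "3 * Suc 4"] by (simp only: lattice_seq_def mem_Collect_eq) simp
    show "f v = u"
    proof
      fix n
      let ?w = "t u (3 * Suc n)"
      have "(v - ?w) m = 0" if "m < Suc n" for m using v[of m n] that by simp
      from low[OF rng[OF L_diff[OF vL tL[OF u]]] this, THEN conjunct1] have "f (v - ?w) n = 0" by blast
      then have "f v n = f ?w n" by (simp add: f_diff)
      also have "\<dots> = (g ?w + ?w) n" by (simp add: g_def)
      also have "\<dots> = (u - t u (Suc (3 * Suc n)) + ?w) n" by (simp only: tS) simp
      also have "\<dots> = u n" using stab1[OF u, of n "3 * Suc n"] by simp
      finally show "f v n = u n" .
    qed
  qed
  show ?thesis
    unfolding bij_betw_def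
  proof
    show "inj_on f (lattice_seq V \<Gamma>)"
      by (rule inj_onI) (metis L_diff eq_iff_diff_eq_0 f_diff inj)
    show "f ` lattice_seq V \<Gamma> = lattice_seq V \<Gamma>" using maps surj by auto
  qed
qed

lemma triple_space_models:
  assumes "(V', \<Gamma>') \<in> models"
  shows "triple_space scale3 V' \<Gamma>'"
proof -
  interpret k3: vector_space scale3
    by unfold_locales (auto simp: scale3_def algebra_simps)
  show ?thesis
    using assms unfolding models_def
    by (elim insertE; unfold_locales)
      (auto simp: models_defs scale3_def k3.subspace_def zero_prod_def)
qed

section \<open>Numerical semigroup rings\<close>

lemma numerical_semigroup_conductor:
  assumes "numerical_semigroup H"
  obtains c where "\<And>n. c \<le> n \<Longrightarrow> n \<in> H"
proof -
  have "finite (- H)" using assms by (simp add: numerical_semigroup_def)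
  then obtain c where "\<forall>n\<in>- H. n < c" using finite_nat_set_iff_bounded by blast
  then have "\<And>n. c \<le> n \<Longrightarrow> n \<in> H" by (meson ComplI linorder_not_less)
  then show thesis by (rule that)
qed

lemma fps_nth_power_neq_0:
  fixes f :: "'k::idom fps"
  assumes "fps_nth f 0 = 0" "n < k"
  shows "fps_nth (f ^ k) n = 0"
  using assms startsby_zero_power_prefix[of f k] by auto

locale semigroup_ring_conductor =
  fixes H :: "nat set" and c :: nat and S :: "'k::field fps ring"
  assumes sg: "nat_submonoid H" and c: "\<And>n. c \<le> n \<Longrightarrow> n \<in> H"
    and S_def: "S = semigroup_ring H"
begin

lemma sr_simps:
  "carrier S = {f. \<forall>n. fps_nth f n \<noteq> 0 \<longrightarrow> n \<in> H}" "\<one>\<^bsub>S\<^esub> = 1" "\<zero>\<^bsub>S\<^esub> = 0"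
  "x \<otimes>\<^bsub>S\<^esub> y = x * y" "x \<oplus>\<^bsub>S\<^esub> y = x + y"
  by (simp_all add: S_def semigroup_ring_def)

lemma cring_sr: "cring S"
  unfolding S_def by (rule cring_semigroup_ring[OF sg])

sublocale S: cring S by (rule cring_sr)

lemma zero_mem_H: "0 \<in> H"
  using sg by (simp add: nat_submonoid_def)

lemma sr_const: "fps_const a \<in> carrier S"
  by (simp add: sr_simps zero_mem_H)

lemma sr_a_inv: "x \<in> carrier S \<Longrightarrow> \<ominus>\<^bsub>S\<^esub> x = - x"
  by (rule S.minus_equality) (auto simp: sr_simps)

lemma sr_X_power: "n \<in> H \<Longrightarrow> fps_X ^ n \<in> carrier S"
  by (simp add: sr_simps fps_X_power_nth)

lemma sr_X_mult: "c \<le> n \<Longrightarrow> fps_X ^ n * f \<in> carrier S"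
  using c by (auto simp: sr_simps fps_X_power_mult_nth)

lemma sr_mult: "x \<in> carrier S \<Longrightarrow> y \<in> carrier S \<Longrightarrow> x * y \<in> carrier S"
  using S.m_closed by (simp add: sr_simps(4))

lemma sr_add: "x \<in> carrier S \<Longrightarrow> y \<in> carrier S \<Longrightarrow> x + y \<in> carrier S"
  using S.a_closed by (simp add: sr_simps(5))

text \<open>In the recursion for the inverse, a nonzero coefficient at a positive \<open>n\<close>
  comes from some \<open>i\<close> in \<open>H\<close> together with a nonzero coefficient at
  \<open>n - i\<close>, which is in \<open>H\<close> by induction.\<close>

lemma sr_inverse:
  assumes f: "f \<in> carrier S" "fps_nth f 0 \<noteq> 0"
  shows "inverse f \<in> carrier S"
proof -
  have "n \<in> H" if "fps_nth (inverse f) n \<noteq> 0" for n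
    using that
  proof (induction n rule: less_induct)
    case (less n)
    show ?case
    proof (cases "n = 0")
      case False
      have "fps_nth (f * inverse f) n = 0"
        using False f(2) by (simp add: inverse_mult_eq_1')
      then have "fps_nth f 0 * fps_nth (inverse f) n + (\<Sum>i = 1..n. fps_nth f i * fps_nth (inverse f) (n - i)) = 0"
        using False by (simp add: fps_mult_nth sum.atLeast_Suc_atMost)
      then have "(\<Sum>i = 1..n. fps_nth f i * fps_nth (inverse f) (n - i)) \<noteq> 0"
        using less.prems f(2) by auto
      then obtain i where i: "i \<in> {1..n}" "fps_nth f i * fps_nth (inverse f) (n - i) \<noteq> 0"
        by (meson sum.neutral)
      then have "i \<in> H" "n - i \<in> H" using f(1) less.IH[of "n - i"] by (auto simp: sr_simps)
      then have "i + (n - i) \<in> H" using sg by (simp add: nat_submonoid_def)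
      then show ?thesis using i by simp
    qed (simp add: zero_mem_H)
  qed
  then show ?thesis by (simp add: sr_simps)
qed

section \<open>Submodules of \<open>k[[t]]\<close> over \<open>S\<close>: finite generation, ideals,
  Krull dimension\<close>

definition sr_closed :: "'k fps set \<Rightarrow> bool" where
  "sr_closed N \<longleftrightarrow> 0 \<in> N \<and> (\<forall>x\<in>N. \<forall>y\<in>N. x + y \<in> N) \<and> (\<forall>s\<in>carrier S. \<forall>x\<in>N. s * x \<in> N)"

lemma sr_closed_neg: "sr_closed N \<Longrightarrow> x \<in> N \<Longrightarrow> - x \<in> N"
  unfolding sr_closed_def using sr_const[of "- 1"]
  by (metis (no_types, lifting) fps_const_1_eq_1 fps_const_neg mult_minus1)

lemma ideal_sr: "ideal I S \<longleftrightarrow> sr_closed I \<and> I \<subseteq> carrier S"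
proof
  assume "ideal I S"
  then interpret I: ideal I S .
  show "sr_closed I \<and> I \<subseteq> carrier S"
    using I.zero_closed I.a_closed I.I_l_closed I.a_subset by (auto simp: sr_closed_def sr_simps)
next
  assume I: "sr_closed I \<and> I \<subseteq> carrier S"
  show "ideal I S"
  proof (rule idealI)
    show "ring S" by (rule S.ring_axioms)
    show "subgroup I (add_monoid S)"
    proof (rule S.add.subgroupI)
      show "\<ominus>\<^bsub>S\<^esub> a \<in> I" if "a \<in> I" for a
        using I that sr_closed_neg[of I a] sr_a_inv[of a] by auto
    qed (use I in \<open>auto simp: sr_closed_def sr_simps\<close>)
    show l: "x \<otimes>\<^bsub>S\<^esub> a \<in> I" if "a \<in> I" "x \<in> carrier S" for a x
      using I that by (simp add: sr_closed_def sr_simps(4))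
    show "a \<otimes>\<^bsub>S\<^esub> x \<in> I" if "a \<in> I" "x \<in> carrier S" for a x
      using l[OF that] by (simp add: sr_simps(4) mult.commute)
  qed
qed

text \<open>Write \<open>p\<close> as a power of \<open>t\<close> times a unit \<open>u\<close> of
  \<open>k[[t]]\<close>. The factor \<open>t^(n - subdegree p) * f / u\<close> that carries
  \<open>p\<close> to \<open>t^n * f\<close> belongs to \<open>S\<close>, its exponent being at
  least the conductor. Most finiteness arguments below rest on this.\<close>

lemma sr_closed_tail:
  assumes N: "sr_closed N" and p: "p \<in> N" "p \<noteq> 0" and n: "subdegree p + c \<le> n"
  shows "fps_X ^ n * f \<in> N"
proof -
  let ?u = "unit_factor p"
  have u: "fps_nth ?u 0 \<noteq> 0" using p by simp
  have pd: "p = fps_X ^ subdegree p * ?u"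
    using subdegree_decompose[of p] by (simp add: mult.commute)
  have "fps_X ^ (n - subdegree p) * (f * inverse ?u) \<in> carrier S"
    using n by (intro sr_X_mult) simp
  then have "fps_X ^ (n - subdegree p) * (f * inverse ?u) * p \<in> N"
    using N p by (auto simp: sr_closed_def)
  also have "fps_X ^ (n - subdegree p) * (f * inverse ?u) * p =
      (fps_X ^ (n - subdegree p) * fps_X ^ subdegree p) * f * (inverse ?u * ?u)"
    by (subst (2) pd) (simp add: algebra_simps)
  also have "\<dots> = fps_X ^ n * f"
    using n u by (simp add: inverse_mult_eq_1 flip: power_add)
  finally show ?thesis .
qed

text \<open>\<open>N\<close> contains \<open>t^d k[[t]]\<close> for some \<open>d\<close>; below
  \<open>d\<close> there are only finitely many orders. One element of \<open>N\<close> for each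
  order that occurs allows leading terms to be removed until the order reaches
  \<open>d\<close>.\<close>

lemma sr_closed_fin_gen:
  assumes N: "sr_closed N"
  shows "\<exists>A\<subseteq>N. finite A \<and> (\<forall>N'. sr_closed N' \<longrightarrow> A \<subseteq> N' \<longrightarrow> N \<subseteq> N')"
proof (cases "N \<subseteq> {0}")
  case True
  then show ?thesis by (intro exI[of _ "{}"]) (auto simp: sr_closed_def)
next
  case False
  then obtain p where p: "p \<in> N" "p \<noteq> 0" by blast
  define d where "d = subdegree p + c"
  have tail: "fps_X ^ n * f \<in> N" if "d \<le> n" for n f
    using sr_closed_tail[OF N p] that by (simp add: d_def)
  define e where "e n = (SOME f. f \<in> N \<and> f \<noteq> 0 \<and> subdegree f = n)" for n
  define D where "D = {n. n < d \<and> (\<exists>f\<in>N. f \<noteq> 0 \<and> subdegree f = n)}"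
  have e: "e n \<in> N" "e n \<noteq> 0" "subdegree (e n) = n" if "n \<in> D" for n
    using someI_ex[of "\<lambda>f. f \<in> N \<and> f \<noteq> 0 \<and> subdegree f = n"] that by (auto simp: e_def D_def)
  \<comment> \<open>The monomials generate all of \<open>t^d k[[t]]\<close> over \<open>S\<close>:
    constants account for the coefficients up to \<open>d + c\<close>, and beyond that
    \<open>t^c k[[t]]\<close> lies in \<open>S\<close>.\<close>
  let ?A = "(\<lambda>j. fps_X ^ (d + j)) ` {..c} \<union> e ` D"
  show ?thesis
  proof (intro exI[of _ ?A] conjI allI impI)
    show "?A \<subseteq> N" using tail[of _ 1] e by auto
    show "finite ?A" by (auto simp: D_def)
    fix N' assume N': "sr_closed N'" "?A \<subseteq> N'"
    have add': "x + y \<in> N'" if "x \<in> N'" "y \<in> N'" for x y using N' that by (auto simp: sr_closed_def)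
    have smul': "s * x \<in> N'" if "s \<in> carrier S" "x \<in> N'" for x s using N' that by (auto simp: sr_closed_def)
    have X': "fps_X ^ (d + j) \<in> N'" if "j \<le> c" for j using N'(2) that by auto
    have head: "fps_X ^ d * (\<Sum>j<m. fps_const (a j) * fps_X ^ j) \<in> N'" if "m \<le> c" for m a
      using that
    proof (induction m)
      case 0 then show ?case using N'(1) by (simp add: sr_closed_def)
    next
      case (Suc m)
      have "fps_const (a m) * fps_X ^ (d + m) \<in> N'"
        using Suc.prems by (intro smul' sr_const X') simp
      then show ?case using Suc by (auto simp: algebra_simps power_add intro: add')
    qed
    have tail': "fps_X ^ d * f \<in> N'" for f
    proof -
      have "f = fps_cutoff c f + fps_X ^ c * fps_shift c f"
        by (metis add.commute fps_shift_cutoff mult.commute)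
      moreover have "fps_cutoff c f = (\<Sum>j<c. fps_const (fps_nth f j) * fps_X ^ j)"
        by (rule fps_ext) (simp add: fps_sum_nth fps_X_power_nth if_distrib cong: if_cong)
      moreover have "(fps_X ^ c * fps_shift c f) * fps_X ^ (d + 0) \<in> N'"
        by (intro smul' sr_X_mult X') auto
      ultimately show ?thesis
        using head[of c "fps_nth f"]
        by (metis (no_types, lifting) add' add_0_right distrib_left mult.commute order_refl)
    qed
    have "f \<in> N'" if "f \<in> N" "\<forall>m<n. fps_nth f m = 0" "n \<le> d" for f n
      using that(3,1,2)
    proof (induction n arbitrary: f rule: inc_induct)
      case base
      then have "f = fps_X ^ d * fps_shift d f"
        by (intro fps_ext) (simp add: fps_X_power_mult_nth)
      then show ?case using tail'[of "fps_shift d f"] by simp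
    next
      case (step n)
      show ?case
      proof (cases "fps_nth f n = 0")
        case True
        then show ?thesis using step by (auto simp: less_Suc_eq)
      next
        case False
        then have sd: "subdegree f = n" "f \<noteq> 0" using step.prems by (auto intro: subdegreeI)
        then have n: "n \<in> D" using step by (auto simp: D_def)
        define a where "a = fps_nth f n / fps_nth (e n) n"
        have en: "fps_nth (e n) n \<noteq> 0" "\<forall>m<n. fps_nth (e n) m = 0" using e[OF n]
          by (metis nth_subdegree_nonzero, metis nth_less_subdegree_zero)
        let ?g = "f + fps_const (- a) * e n"
        have "?g \<in> N" using N step.prems(1) e(1)[OF n] sr_const unfolding sr_closed_def by blast
        moreover have "\<forall>m<Suc n. fps_nth ?g m = 0"
          using en step.prems(2) by (auto simp: less_Suc_eq a_def)
        ultimately have "?g \<in> N'" by (rule step.IH)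
        moreover have "fps_const a * e n \<in> N'" using N'(2) n by (intro smul' sr_const) auto
        ultimately have "?g + fps_const a * e n \<in> N'" by (rule add')
        then show ?thesis by (simp add: algebra_simps flip: fps_const_neg)
      qed
    qed
    from this[of _ 0] show "N \<subseteq> N'" by auto
  qed
qed

lemma noetherian_sr: "noetherian_ring S"
proof (rule S.noetherian_ringI)
  fix I assume I: "ideal I S"
  then have I': "sr_closed I" "I \<subseteq> carrier S" by (auto simp: ideal_sr)
  from sr_closed_fin_gen[OF I'(1)] obtain A where A: "A \<subseteq> I" "finite A"
    "\<And>N'. sr_closed N' \<Longrightarrow> A \<subseteq> N' \<Longrightarrow> I \<subseteq> N'" by blast
  have Ac: "A \<subseteq> carrier S" using A I' by blast
  have "ideal (Idl\<^bsub>S\<^esub> A) S" by (rule S.genideal_ideal[OF Ac])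
  then have "I \<subseteq> Idl\<^bsub>S\<^esub> A" using A(3) S.genideal_self[OF Ac] by (auto simp: ideal_sr)
  moreover have "Idl\<^bsub>S\<^esub> A \<subseteq> I" by (rule S.genideal_minimal[OF I A(1)])
  ultimately show "\<exists>A\<subseteq>carrier S. finite A \<and> I = Idl\<^bsub>S\<^esub> A" using A(2) Ac by blast
qed

definition "sr_max = {f \<in> carrier S. fps_nth f 0 = 0}"

lemma ideal_sr_max: "ideal sr_max S"
  unfolding ideal_sr sr_closed_def
proof (intro conjI ballI)
  show "0 \<in> sr_max" by (simp add: sr_max_def sr_simps)
  show "sr_max \<subseteq> carrier S" by (auto simp: sr_max_def)
  show "x + y \<in> sr_max" if "x \<in> sr_max" "y \<in> sr_max" for x y
    using that sr_add[of x y] by (simp add: sr_max_def)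
  show "s * x \<in> sr_max" if "s \<in> carrier S" "x \<in> sr_max" for s x
    using that sr_mult[of s x] by (simp add: sr_max_def)
qed

lemma ideal_unit:
  assumes "ideal I S" "f \<in> I" "fps_nth f 0 \<noteq> 0"
  shows "I = carrier S"
proof -
  have I: "sr_closed I" "I \<subseteq> carrier S" using assms by (auto simp: ideal_sr)
  have f: "f \<in> carrier S" using I assms by blast
  have "g \<in> I" if "g \<in> carrier S" for g
  proof -
    have "(g * inverse f) * f \<in> I"
      using I assms(2) sr_mult[OF that sr_inverse[OF f assms(3)]] by (auto simp: sr_closed_def)
    also have "(g * inverse f) * f = g" using assms(3) by (simp add: mult.assoc inverse_mult_eq_1)
    finally show ?thesis .
  qed
  then show ?thesis using I by blast
qed

lemma proper_ideal_subset:
  assumes "ideal I S" "I \<noteq> carrier S"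
  shows "I \<subseteq> sr_max"
  using assms ideal_unit[OF assms(1)] by (auto simp: sr_max_def ideal_sr)

lemma sr_max_neq: "sr_max \<noteq> carrier S"
proof
  assume "sr_max = carrier S"
  moreover have "1 \<in> carrier S" using S.one_closed by (simp add: sr_simps)
  ultimately have "1 \<in> sr_max" by simp
  then show False by (simp add: sr_max_def)
qed

lemma maximalideal_sr_iff: "maximalideal m S \<longleftrightarrow> m = sr_max"
proof
  assume m: "maximalideal m S"
  interpret m: maximalideal m S by (rule m)
  have "m \<noteq> carrier S" using m.I_notcarr by simp
  then have "m \<subseteq> sr_max" by (rule proper_ideal_subset[OF m.is_ideal])
  then show "m = sr_max"
    using m.I_maximal[OF ideal_sr_max] sr_max_neq by (auto simp: sr_max_def)
next
  assume m: "m = sr_max"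
  show "maximalideal m S"
    unfolding m
  proof (rule maximalidealI[OF ideal_sr_max])
    show "carrier S \<noteq> sr_max" using sr_max_neq by simp
    fix J assume "ideal J S" "sr_max \<subseteq> J"
    then show "J = sr_max \<or> J = carrier S" using proper_ideal_subset by blast
  qed
qed

lemma noetherian_local_sr: "noetherian_local_ring S"
  unfolding noetherian_local_ring_def
  using cring_sr noetherian_sr by (simp add: maximalideal_sr_iff)

lemma max_ideal_sr: "max_ideal S = sr_max"
  unfolding max_ideal_def by (rule the_equality) (simp_all add: maximalideal_sr_iff)

text \<open>A nonzero ideal contains all series of large order, hence a power of every nonunit of
  \<open>S\<close>; a prime ideal then contains the nonunit itself.\<close>

lemma prime_sr:
  assumes P: "primeideal P S" and "P \<noteq> {0}"
  shows "P = sr_max"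
proof
  have P_ideal: "ideal P S" using P by (rule primeideal.axioms(1))
  have P_proper: "carrier S \<noteq> P" using P by (rule primeideal.I_notcarr)
  have I: "sr_closed P" "P \<subseteq> carrier S" using P_ideal unfolding ideal_sr by blast+
  show "P \<subseteq> sr_max"
    by (rule proper_ideal_subset[OF P_ideal P_proper[symmetric]])
  have "0 \<in> P" using I(1) by (simp add: sr_closed_def)
  then obtain p where p: "p \<in> P" "p \<noteq> 0" using assms(2) by blast
  have one: "1 \<in> carrier S" using S.one_closed by (simp add: sr_simps)
  show "sr_max \<subseteq> P"
  proof
    fix f assume "f \<in> sr_max"
    then have f: "f \<in> carrier S" "fps_nth f 0 = 0" by (auto simp: sr_max_def)
    have fk: "f ^ k \<in> carrier S" for k by (induction k) (auto intro: sr_mult f one)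
    let ?n = "subdegree p + c"
    have "f ^ ?n = fps_X ^ ?n * fps_shift ?n (f ^ ?n)"
      by (rule fps_ext) (simp add: fps_X_power_mult_nth fps_nth_power_neq_0[OF f(2)])
    then have "f ^ ?n \<in> P" using sr_closed_tail[OF I(1) p order_refl, of "fps_shift ?n (f ^ ?n)"] by simp
    moreover have "f \<in> P" if "f ^ k \<in> P" for k
      using that
    proof (induction k)
      case 0
      then have "1 \<in> P" by simp
      then show ?case using ideal_unit[OF P_ideal, of 1] P_proper by simp
    next
      case (Suc k)
      then show ?case using primeideal.I_prime[OF P f(1) fk[of k]] by (auto simp: sr_simps)
    qed
    ultimately show "f \<in> P" by blast
  qed
qed

lemma primeideal_zero: "primeideal {0} S"
proof (rule primeidealI[OF _ cring_sr])
  show "ideal {0} S" using S.zeroideal by (simp add: sr_simps)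
  have "1 \<in> carrier S" using S.one_closed by (simp add: sr_simps)
  then show "carrier S \<noteq> {0}" by auto
qed (auto simp: sr_simps)

lemma krull_dim_sr: "krull_dim S = 1"
proof -
  have m: "primeideal sr_max S" by (rule S.maximalideal_prime) (simp add: maximalideal_sr_iff)
  have z: "0 \<in> P" if "primeideal P S" for P
    using primeideal.axioms(1)[OF that] by (simp add: ideal_sr sr_closed_def)
  have "fps_X ^ Suc c \<in> sr_max" using sr_X_power[of "Suc c"] c[of "Suc c"] by (simp add: sr_max_def)
  moreover have "fps_X ^ Suc c \<noteq> (0 :: 'k fps)" by simp
  ultimately have lt: "{0} \<subset> sr_max" using z[OF m] by blast
  let ?A = "{enat n | n. \<exists>P. (\<forall>i\<le>n. primeideal (P i) S) \<and> (\<forall>i<n. P i \<subset> P (Suc i))}"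
  have "enat 1 \<in> ?A"
    using m primeideal_zero lt
    by (auto intro!: exI[of _ "\<lambda>i. if i = 0 then {0} else sr_max"])
  moreover have "x \<le> enat 1" if xA: "x \<in> ?A" for x
  proof -
    obtain n P where x: "x = enat n" and P: "\<forall>i\<le>n. primeideal (P i) S" "\<forall>i<n. P i \<subset> P (Suc i)"
      using xA by blast
    have "n \<le> 1"
    proof (rule ccontr)
      assume "\<not> n \<le> 1"
      then have 0: "P 0 \<subset> P 1" "P 1 \<subset> P 2" "primeideal (P 0) S" "primeideal (P 1) S" "primeideal (P 2) S"
        using P(1) P(2)[rule_format, of 0] P(2)[rule_format, of 1] by (auto simp: numeral_2_eq_2)
      then have "P 1 = sr_max" "P 2 = sr_max" using z by (auto intro!: prime_sr)
      then show False using 0 by simp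
    qed
    then show ?thesis using x by simp
  qed
  ultimately have "Sup ?A = enat 1"
    by (intro antisym Sup_least Sup_upper) auto
  then show ?thesis by (simp add: krull_dim_def one_enat_def)
qed

end

section \<open>Torsion-free modules over rings containing \<open>k[[t^3, t^5, t^7]]\<close>\<close>

definition torsion_free :: "('r, 'x) ring_scheme \<Rightarrow> ('r, 'a) module \<Rightarrow> bool" where
  "torsion_free R M \<longleftrightarrow> (\<forall>s\<in>carrier R. \<forall>v\<in>carrier M.
     s \<odot>\<^bsub>M\<^esub> v = \<zero>\<^bsub>M\<^esub> \<longrightarrow> s = \<zero>\<^bsub>R\<^esub> \<or> v = \<zero>\<^bsub>M\<^esub>)"

section \<open>From depth one to torsion-freeness\<close>

context semigroup_ring_conductor
begin

text \<open>Depth one provides an element \<open>x\<close> of the maximal ideal that is regular on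
  \<open>M\<close>. For nonzero \<open>s\<close>, a high power of \<open>x\<close> has large order
  and is therefore a multiple of \<open>s\<close> in \<open>S\<close>; so \<open>s v = 0\<close>
  gives \<open>x^n v = 0\<close> and \<open>v = 0\<close>.\<close>

lemma maximal_CM_torsion_free:
  assumes "maximal_CM_module S M"
  shows "torsion_free S M"
proof (cases "carrier M = {\<zero>\<^bsub>M\<^esub>}")
  case False
  have M: "Module.module S M" using assms by (simp add: maximal_CM_module_def fin_gen_module_def)
  interpret M: Module.module S M by (rule M)
  have "depth S M = 1" using assms False krull_dim_sr by (simp add: maximal_CM_module_def)
  then have "\<not> depth S M \<le> 0" by simp
  then have "\<exists>xs. set xs \<subseteq> max_ideal S \<and> regular_sequence S M xs \<and> \<not> enat (length xs) \<le> 0"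
    unfolding depth_def Sup_le_iff by blast
  then obtain xs where xs: "set xs \<subseteq> max_ideal S" "regular_sequence S M xs" "xs \<noteq> []"
    by (auto simp: zero_enat_def)
  define x where "x = xs ! 0"
  have x: "x \<in> sr_max" using xs by (auto simp: x_def max_ideal_sr)
  have reg: "v = \<zero>\<^bsub>M\<^esub>" if "v \<in> carrier M" "x \<odot>\<^bsub>M\<^esub> v = \<zero>\<^bsub>M\<^esub>" for v
    using xs(2,3) that unfolding regular_sequence_def x_def by fastforce
  have xS: "x \<in> carrier S" "fps_nth x 0 = 0" using x by (auto simp: sr_max_def)
  have one: "1 \<in> carrier S" using S.one_closed by (simp add: sr_simps(2))
  have xk: "x ^ k \<in> carrier S" for k by (induction k) (auto intro: sr_mult xS one)
  have regk: "v = \<zero>\<^bsub>M\<^esub>" if "v \<in> carrier M" "x ^ k \<odot>\<^bsub>M\<^esub> v = \<zero>\<^bsub>M\<^esub>" for v k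
    using that
  proof (induction k)
    case 0
    then show ?case using M.smult_one[OF 0(1)] by (simp add: sr_simps(2))
  next
    case (Suc k)
    have "x \<odot>\<^bsub>M\<^esub> (x ^ k \<odot>\<^bsub>M\<^esub> v) = \<zero>\<^bsub>M\<^esub>"
      using M.smult_assoc1[OF xS(1) xk[of k] Suc.prems(1)] Suc.prems(2) by (simp add: sr_simps(4))
    then have "x ^ k \<odot>\<^bsub>M\<^esub> v = \<zero>\<^bsub>M\<^esub>" using reg M.smult_closed[OF xk Suc.prems(1)] by blast
    then show ?case using Suc by blast
  qed
  show ?thesis
    unfolding torsion_free_def
  proof (intro ballI impI)
    fix s v assume s: "s \<in> carrier S" and v: "v \<in> carrier M" and sv: "s \<odot>\<^bsub>M\<^esub> v = \<zero>\<^bsub>M\<^esub>"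
    show "s = \<zero>\<^bsub>S\<^esub> \<or> v = \<zero>\<^bsub>M\<^esub>"
    proof (cases "s = 0")
      case False
      let ?N = "{r * s | r. r \<in> carrier S}"
      have N: "sr_closed ?N"
        unfolding sr_closed_def
      proof (intro conjI ballI)
        show "0 \<in> ?N" using S.zero_closed by (auto simp: sr_simps(3) intro!: exI[of _ 0])
        show "a + b \<in> ?N" if "a \<in> ?N" "b \<in> ?N" for a b
          using that sr_add by (auto simp: distrib_right[symmetric])
        show "a * b \<in> ?N" if "a \<in> carrier S" "b \<in> ?N" for a b
          using that sr_mult by (auto simp: mult.assoc[symmetric])
      qed
      have "s \<in> ?N" using one by (auto intro!: exI[of _ 1])
      let ?n = "subdegree s + c"
      have "x ^ ?n = fps_X ^ ?n * fps_shift ?n (x ^ ?n)"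
        by (rule fps_ext) (simp add: fps_X_power_mult_nth fps_nth_power_neq_0[OF xS(2)])
      then have "x ^ ?n \<in> ?N" using sr_closed_tail[OF N \<open>s \<in> ?N\<close> False order_refl, of "fps_shift ?n (x ^ ?n)"] by simp
      then obtain r where r: "r \<in> carrier S" "x ^ ?n = r * s" by blast
      have "x ^ ?n \<odot>\<^bsub>M\<^esub> v = \<zero>\<^bsub>M\<^esub>"
        using M.smult_assoc1[OF r(1) s v] sv r by (simp add: sr_simps(4))
      then show ?thesis using regk[OF v] by blast
    qed (simp add: sr_simps(3))
  qed
qed (auto simp: torsion_free_def)

end

section \<open>Bases inside torsion-free modules\<close>

definition fun_scale :: "'k::field \<Rightarrow> ('a \<Rightarrow> 'k) \<Rightarrow> 'a \<Rightarrow> 'k" where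
  "fun_scale r x = (\<lambda>a. r * x a)"

text \<open>
  The carrier of \<open>k[[t^3, t^5, t^7]]\<close>.
\<close>

definition core :: "'k::field fps set" where
  "core = {s. fps_nth s 1 = 0 \<and> fps_nth s 2 = 0 \<and> fps_nth s 4 = 0}"

lemma vector_space_fun_scale: "vector_space fun_scale"
  by unfold_locales (auto simp: fun_scale_def algebra_simps)

text \<open>Nothing is said about 1, 2 and 4, so both semigroups of the theorem are covered at
  once.\<close>

locale cusp_module = semigroup_ring_conductor H 5 S + Module.module S M
  for H and S :: "'k::field fps ring" and M :: "('k fps, 'a) module" (structure) +
  assumes core_H: "\<And>n. n \<noteq> 1 \<Longrightarrow> n \<noteq> 2 \<Longrightarrow> n \<noteq> 4 \<Longrightarrow> n \<in> H"
    and tf: "torsion_free S M"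
begin

lemma core_S: "s \<in> core \<Longrightarrow> s \<in> carrier S"
  unfolding sr_simps(1) mem_Collect_eq
proof (intro allI impI core_H)
  fix n assume "s \<in> core" and n: "fps_nth s n \<noteq> 0"
  then have "fps_nth s 1 = 0" "fps_nth s 2 = 0" "fps_nth s 4 = 0" by (simp_all add: core_def)
  then show "n \<noteq> 1" "n \<noteq> 2" "n \<noteq> 4" using n by (auto intro!: notI)
qed

lemma X5_mult_mem: "fps_X ^ 5 * f \<in> carrier S"
  by (rule sr_X_mult) simp

lemma X5_mem: "fps_X ^ 5 \<in> carrier S"
  using X5_mult_mem[of 1] by simp

lemma torsion_freeD: "s \<in> carrier S \<Longrightarrow> v \<in> carrier M \<Longrightarrow> s \<odot>\<^bsub>M\<^esub> v = \<zero>\<^bsub>M\<^esub> \<Longrightarrow> s \<noteq> 0 \<Longrightarrow> v = \<zero>\<^bsub>M\<^esub>"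
  using tf by (auto simp: torsion_free_def sr_simps(3))

lemma smult_cancel:
  assumes "s \<in> carrier S" "u \<in> carrier M" "v \<in> carrier M" "s \<odot>\<^bsub>M\<^esub> u = s \<odot>\<^bsub>M\<^esub> v" "s \<noteq> 0"
  shows "u = v"
proof -
  have "s \<odot>\<^bsub>M\<^esub> (u \<ominus>\<^bsub>M\<^esub> v) = \<zero>\<^bsub>M\<^esub>"
    using assms by (simp add: M.minus_eq smult_r_distr smult_r_minus M.r_neg)
  then have "u \<ominus>\<^bsub>M\<^esub> v = \<zero>\<^bsub>M\<^esub>" using torsion_freeD[of s "u \<ominus>\<^bsub>M\<^esub> v"] assms by simp
  then show ?thesis using M.minus_eq assms(2,3) by (metis M.add.inv_closed M.minus_equality M.minus_minus)
qed

text \<open>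
  Multiplication by \<open>t^5\<close>, which maps \<open>k[[t]]\<close> into \<open>S\<close>, allows linear combinations with arbitrary
  power series as coefficients without passing to a localisation of \<open>M\<close>.
\<close>

definition comb :: "'a set \<Rightarrow> ('a \<Rightarrow> 'k fps) \<Rightarrow> 'a" where
  "comb G c = (\<Oplus>\<^bsub>M\<^esub>g\<in>G. (fps_X ^ 5 * c g) \<odot>\<^bsub>M\<^esub> g)"

lemma comb_closed: "G \<subseteq> carrier M \<Longrightarrow> comb G c \<in> carrier M"
  unfolding comb_def using X5_mult_mem by (intro M.finsum_closed) auto

lemma comb_cong: "G \<subseteq> carrier M \<Longrightarrow> (\<And>g. g \<in> G \<Longrightarrow> c g = d g) \<Longrightarrow> comb G c = comb G d"
  unfolding comb_def using X5_mult_mem by (intro M.finsum_cong') auto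

lemma comb_add:
  assumes "G \<subseteq> carrier M"
  shows "comb G (\<lambda>g. c g + d g) = comb G c \<oplus>\<^bsub>M\<^esub> comb G d"
proof -
  have "comb G (\<lambda>g. c g + d g) = (\<Oplus>\<^bsub>M\<^esub>g\<in>G. (fps_X ^ 5 * c g) \<odot>\<^bsub>M\<^esub> g \<oplus>\<^bsub>M\<^esub> (fps_X ^ 5 * d g) \<odot>\<^bsub>M\<^esub> g)"
    unfolding comb_def
  proof (rule M.finsum_cong')
    fix g assume "g \<in> G"
    then show "(fps_X ^ 5 * (c g + d g)) \<odot>\<^bsub>M\<^esub> g = (fps_X ^ 5 * c g) \<odot>\<^bsub>M\<^esub> g \<oplus>\<^bsub>M\<^esub> (fps_X ^ 5 * d g) \<odot>\<^bsub>M\<^esub> g"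
      using smult_l_distr[OF X5_mult_mem X5_mult_mem, of g "c g" "d g"] assms by (auto simp: sr_simps(5) distrib_left)
  qed (use assms X5_mult_mem in auto)
  also have "\<dots> = comb G c \<oplus>\<^bsub>M\<^esub> comb G d"
    unfolding comb_def by (rule M.finsum_addf) (use assms X5_mult_mem in auto)
  finally show ?thesis .
qed

lemma comb_smult:
  assumes "G \<subseteq> carrier M" "finite G" "s \<in> carrier S"
  shows "s \<odot>\<^bsub>M\<^esub> comb G c = comb G (\<lambda>g. s * c g)"
proof -
  have "s \<odot>\<^bsub>M\<^esub> comb G c = (\<Oplus>\<^bsub>M\<^esub>g\<in>G. s \<odot>\<^bsub>M\<^esub> ((fps_X ^ 5 * c g) \<odot>\<^bsub>M\<^esub> g))"
    unfolding comb_def by (rule finsum_smult_ldistr) (use assms X5_mult_mem in auto)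
  also have "\<dots> = comb G (\<lambda>g. s * c g)"
    unfolding comb_def
  proof (rule M.finsum_cong')
    fix g assume "g \<in> G"
    then show "s \<odot>\<^bsub>M\<^esub> ((fps_X ^ 5 * c g) \<odot>\<^bsub>M\<^esub> g) = (fps_X ^ 5 * (s * c g)) \<odot>\<^bsub>M\<^esub> g"
      using smult_assoc1[OF assms(3) X5_mult_mem, of g "c g"] assms by (auto simp: sr_simps(4) mult.left_commute)
  qed (use assms X5_mult_mem in auto)
  finally show ?thesis .
qed

lemma comb_insert:
  assumes "insert g G \<subseteq> carrier M" "finite G" "g \<notin> G"
  shows "comb (insert g G) c = (fps_X ^ 5 * c g) \<odot>\<^bsub>M\<^esub> g \<oplus>\<^bsub>M\<^esub> comb G c"
  unfolding comb_def by (rule M.finsum_insert) (use assms X5_mult_mem in auto)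

lemma comb_zero: "G \<subseteq> carrier M \<Longrightarrow> comb G (\<lambda>_. 0) = \<zero>\<^bsub>M\<^esub>"
proof -
  assume G: "G \<subseteq> carrier M"
  have "comb G (\<lambda>_. 0) = (\<Oplus>\<^bsub>M\<^esub>g\<in>G. \<zero>\<^bsub>M\<^esub>)"
    unfolding comb_def
    by (rule M.finsum_cong') (use G smult_l_null in \<open>auto simp: sr_simps(3)\<close>)
  then show ?thesis by simp
qed

lemma comb_neg:
  assumes "G \<subseteq> carrier M" "finite G"
  shows "comb G (\<lambda>g. - c g) = \<ominus>\<^bsub>M\<^esub> comb G c"
proof -
  have "comb G (\<lambda>g. - c g) \<oplus>\<^bsub>M\<^esub> comb G c = \<zero>\<^bsub>M\<^esub>"
    using comb_add[OF assms(1), of "\<lambda>g. - c g" c] comb_zero[OF assms(1)] by simp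
  then show ?thesis using comb_closed[OF assms(1)] by (simp add: M.minus_equality)
qed

text \<open>Since \<open>comb\<close> carries a factor \<open>t^5\<close> of its own, the equation
  expresses \<open>m\<close> as the combination with coefficients \<open>c g\<close> in
  \<open>k[[t]] M\<close>.\<close>

definition spans :: "'a set \<Rightarrow> bool" where
  "spans G \<longleftrightarrow> finite G \<and> G \<subseteq> carrier M \<and> (\<forall>m\<in>carrier M. \<exists>c. fps_X ^ 5 \<odot>\<^bsub>M\<^esub> m = comb G c)"

lemma comb_single:
  assumes "G \<subseteq> carrier M" "finite G" "a \<in> G"
  shows "comb G (\<lambda>g. if g = a then r else 0) = (fps_X ^ 5 * r) \<odot>\<^bsub>M\<^esub> a"
proof -
  have "comb (insert a (G - {a})) (\<lambda>g. if g = a then r else 0) =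
      (fps_X ^ 5 * r) \<odot>\<^bsub>M\<^esub> a \<oplus>\<^bsub>M\<^esub> comb (G - {a}) (\<lambda>g. if g = a then r else 0)"
    using comb_insert[of a "G - {a}" "\<lambda>g. if g = a then r else 0"] assms by auto
  also have "comb (G - {a}) (\<lambda>g. if g = a then r else 0) = comb (G - {a}) (\<lambda>_. 0)"
    by (rule comb_cong) (use assms in auto)
  also have "\<dots> = \<zero>\<^bsub>M\<^esub>" by (rule comb_zero) (use assms in auto)
  finally show ?thesis using assms X5_mult_mem by (simp add: insert_absorb subset_iff)
qed

lemma spans_generators:
  assumes A: "A \<subseteq> carrier M" "finite A" and gen: "\<And>N. submodule N S M \<Longrightarrow> A \<subseteq> N \<Longrightarrow> N = carrier M"
  shows "spans A"
proof -
  let ?N = "{m \<in> carrier M. \<exists>c. fps_X ^ 5 \<odot>\<^bsub>M\<^esub> m = comb A c}"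
  have "submodule ?N S M"
  proof (rule submoduleI)
    show "\<zero>\<^bsub>M\<^esub> \<in> ?N" using comb_zero[OF A(1)] X5_mem by (auto intro!: exI[of _ "\<lambda>_. 0"])
    show "\<ominus>\<^bsub>M\<^esub> a \<in> ?N" if "a \<in> ?N" for a
    proof -
      obtain c where "a \<in> carrier M" "fps_X ^ 5 \<odot>\<^bsub>M\<^esub> a = comb A c" using \<open>a \<in> ?N\<close> by blast
      then have "fps_X ^ 5 \<odot>\<^bsub>M\<^esub> (\<ominus>\<^bsub>M\<^esub> a) = comb A (\<lambda>g. - c g)" "\<ominus>\<^bsub>M\<^esub> a \<in> carrier M"
        using comb_neg[OF A] X5_mem by (auto simp: smult_r_minus)
      then show ?thesis by blast
    qed
    show "a \<oplus>\<^bsub>M\<^esub> b \<in> ?N" if ab: "a \<in> ?N" "b \<in> ?N" for a b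
    proof -
      obtain c d where "a \<in> carrier M" "fps_X ^ 5 \<odot>\<^bsub>M\<^esub> a = comb A c" "b \<in> carrier M" "fps_X ^ 5 \<odot>\<^bsub>M\<^esub> b = comb A d"
        using ab by blast
      then have "fps_X ^ 5 \<odot>\<^bsub>M\<^esub> (a \<oplus>\<^bsub>M\<^esub> b) = comb A (\<lambda>g. c g + d g)" "a \<oplus>\<^bsub>M\<^esub> b \<in> carrier M"
        using comb_add[OF A(1)] X5_mem by (auto simp: smult_r_distr)
      then show ?thesis by blast
    qed
    show "s \<odot>\<^bsub>M\<^esub> a \<in> ?N" if s: "s \<in> carrier S" and "a \<in> ?N" for s a
    proof -
      obtain c where a: "a \<in> carrier M" "fps_X ^ 5 \<odot>\<^bsub>M\<^esub> a = comb A c" using \<open>a \<in> ?N\<close> by blast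
      have "fps_X ^ 5 \<odot>\<^bsub>M\<^esub> (s \<odot>\<^bsub>M\<^esub> a) = s \<odot>\<^bsub>M\<^esub> (fps_X ^ 5 \<odot>\<^bsub>M\<^esub> a)"
        using smult_assoc1[OF X5_mem s a(1)] smult_assoc1[OF s X5_mem a(1)] by (simp add: sr_simps(4) mult.commute)
      also have "\<dots> = comb A (\<lambda>g. s * c g)" using a comb_smult[OF A s] by simp
      finally show ?thesis using s a by blast
    qed
  qed auto
  moreover have "A \<subseteq> ?N"
  proof
    fix a assume a: "a \<in> A"
    then have "fps_X ^ 5 \<odot>\<^bsub>M\<^esub> a = comb A (\<lambda>g. if g = a then 1 else 0)"
      using comb_single[OF A a] by simp
    then show "a \<in> ?N" using a A by blast
  qed
  ultimately have "?N = carrier M" by (rule gen)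
  then show ?thesis using A by (auto simp: spans_def)
qed

text \<open>A relation with a unit as coefficient of \<open>g0\<close> allows \<open>g0\<close> to
  be eliminated. The quotient \<open>r\<close> need not lie in \<open>S\<close>, so the relation is
  multiplied by \<open>t^5 * r\<close> and \<open>t^5\<close> is cancelled by
  torsion-freeness.\<close>

lemma spans_reduce:
  assumes G: "spans G" and g0: "g0 \<in> G" and rel: "comb G c = \<zero>\<^bsub>M\<^esub>" and u: "fps_nth (c g0) 0 \<noteq> 0"
  shows "spans (G - {g0})"
proof -
  let ?G = "G - {g0}"
  have fin: "finite ?G" "?G \<subseteq> carrier M" "g0 \<in> carrier M" "insert g0 ?G = G"
    and GM: "finite G" "G \<subseteq> carrier M" using G g0 by (auto simp: spans_def)
  have split: "comb G d = (fps_X ^ 5 * d g0) \<odot>\<^bsub>M\<^esub> g0 \<oplus>\<^bsub>M\<^esub> comb ?G d" for d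
    using comb_insert[of g0 ?G d] fin by (auto simp: insert_absorb)
  show ?thesis
    unfolding spans_def
  proof (intro conjI ballI fin)
    fix m assume m: "m \<in> carrier M"
    obtain d where d: "fps_X ^ 5 \<odot>\<^bsub>M\<^esub> m = comb G d" using G m by (auto simp: spans_def)
    define r where "r = d g0 * inverse (c g0)"
    have r: "r * c g0 = d g0" using u by (simp add: r_def mult.assoc inverse_mult_eq_1)
    define d' where "d' g = d g - r * c g" for g
    have "fps_X ^ 5 \<odot>\<^bsub>M\<^esub> comb G (\<lambda>g. - (r * c g)) = comb G (\<lambda>g. fps_X ^ 5 * - (r * c g))"
      by (rule comb_smult[OF GM(2,1) X5_mem])
    also have "\<dots> = comb G (\<lambda>g. (fps_X ^ 5 * - r) * c g)" by (rule comb_cong) (use GM in auto)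
    also have "\<dots> = (fps_X ^ 5 * - r) \<odot>\<^bsub>M\<^esub> comb G c"
      by (rule comb_smult[OF GM(2,1) X5_mult_mem, symmetric])
    also have "\<dots> = \<zero>\<^bsub>M\<^esub>" unfolding rel by (rule smult_r_null[OF X5_mult_mem])
    finally have "comb G (\<lambda>g. - (r * c g)) = \<zero>\<^bsub>M\<^esub>"
      using torsion_freeD[OF X5_mem comb_closed[OF GM(2)]] by simp
    then have "comb G d = comb G (\<lambda>g. d g + - (r * c g))"
      using comb_add[OF GM(2), of d "\<lambda>g. - (r * c g)"] comb_closed[OF GM(2)] by simp
    also have "\<dots> = comb G d'" by (rule comb_cong[OF GM(2)]) (simp add: d'_def)
    also have "\<dots> = comb ?G d'"
      unfolding split[of d'] using r fin smult_l_null comb_closed[OF fin(2)] by (simp add: d'_def sr_simps(3))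
    finally show "\<exists>c. fps_X ^ 5 \<odot>\<^bsub>M\<^esub> m = comb ?G c" using d by auto
  qed
qed

text \<open>The usual argument over the discrete valuation ring \<open>k[[t]]\<close>: dividing a
  nontrivial relation by the least power of \<open>t\<close> in it makes some coefficient a unit,
  which contradicts minimality of the spanning set. That the basis is a subset of \<open>M\<close>,
  and not just of \<open>k[[t]] M\<close>, is essential for what follows.\<close>

lemma exists_basis:
  assumes "fin_gen_module S M"
  obtains G where "spans G" "\<And>c. comb G c = \<zero>\<^bsub>M\<^esub> \<Longrightarrow> \<forall>g\<in>G. c g = 0"
proof -
  from assms obtain A where "A \<subseteq> carrier M" "finite A" "\<And>N. submodule N S M \<Longrightarrow> A \<subseteq> N \<Longrightarrow> N = carrier M"
    unfolding fin_gen_module_def by metis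
  then have ex: "spans A" by (rule spans_generators)
  define G where "G = arg_min card spans"
  have G: "spans G" unfolding G_def by (rule arg_min_natI[of spans A card, OF ex])
  have min: "card G \<le> card G'" if "spans G'" for G' unfolding G_def by (rule arg_min_nat_le[of spans G' card, OF that])
  have GM: "finite G" "G \<subseteq> carrier M" using G by (auto simp: spans_def)
  have "\<forall>g\<in>G. c g = 0" if c: "comb G c = \<zero>\<^bsub>M\<^esub>" for c
  proof (rule ccontr)
    assume "\<not> ?thesis"
    then obtain g1 where g1: "g1 \<in> G" "c g1 \<noteq> 0" by blast
    define g0 where "g0 = arg_min (\<lambda>g. subdegree (c g)) (\<lambda>g. g \<in> G \<and> c g \<noteq> 0)"
    have g0: "g0 \<in> G" "c g0 \<noteq> 0"
      using arg_min_natI[of "\<lambda>g. g \<in> G \<and> c g \<noteq> 0" g1 "\<lambda>g. subdegree (c g)"] g1 by (auto simp: g0_def)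
    let ?d = "subdegree (c g0)"
    have le: "?d \<le> subdegree (c g)" if "g \<in> G" "c g \<noteq> 0" for g
      using arg_min_nat_le[of "\<lambda>g. g \<in> G \<and> c g \<noteq> 0" g "\<lambda>g. subdegree (c g)"] that by (auto simp: g0_def)
    define c' where "c' g = fps_shift ?d (c g)" for g
    have c': "c g = fps_X ^ ?d * c' g" if "g \<in> G" for g
    proof (cases "c g = 0")
      case False
      have "fps_X ^ ?d * fps_shift ?d (c g) = c g"
        using le[OF that False] by (simp add: fps_shift_times_fps_X_power mult.commute[of "fps_X ^ _"])
      then show ?thesis by (simp add: c'_def)
    qed (simp add: c'_def)
    have "(fps_X ^ 5 * fps_X ^ ?d) \<odot>\<^bsub>M\<^esub> comb G c' = comb G (\<lambda>g. fps_X ^ 5 * fps_X ^ ?d * c' g)"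
      by (rule comb_smult[OF GM(2,1) X5_mult_mem])
    also have "\<dots> = comb G (\<lambda>g. fps_X ^ 5 * c g)"
      by (rule comb_cong[OF GM(2)]) (simp add: c' mult.assoc)
    also have "\<dots> = fps_X ^ 5 \<odot>\<^bsub>M\<^esub> comb G c" by (rule comb_smult[OF GM(2,1) X5_mem, symmetric])
    also have "\<dots> = \<zero>\<^bsub>M\<^esub>" unfolding c by (rule smult_r_null[OF X5_mem])
    finally have "comb G c' = \<zero>\<^bsub>M\<^esub>" using torsion_freeD[OF X5_mult_mem comb_closed[OF GM(2)]] by simp
    moreover have "fps_nth (c' g0) 0 \<noteq> 0" using g0 by (simp add: c'_def)
    ultimately have "spans (G - {g0})" by (rule spans_reduce[OF G g0(1)])
    then have "card G \<le> card (G - {g0})" by (rule min)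
    then show False using g0 GM by (metis card_Diff1_less linorder_not_less)
  qed
  then show thesis using that G by blast
qed

text \<open>With coefficients in \<open>S\<close> the combination exists in \<open>M\<close> without
  the auxiliary factor. This is how all \<open>core\<close>-combinations of the basis are found in
  \<open>M\<close>.\<close>

lemma finsum_core:
  assumes "finite G" "G \<subseteq> carrier M" "\<And>g. g \<in> G \<Longrightarrow> c g \<in> carrier S"
  shows "(\<Oplus>\<^bsub>M\<^esub>g\<in>G. c g \<odot>\<^bsub>M\<^esub> g) \<in> carrier M"
    and "fps_X ^ 5 \<odot>\<^bsub>M\<^esub> (\<Oplus>\<^bsub>M\<^esub>g\<in>G. c g \<odot>\<^bsub>M\<^esub> g) = comb G c"
proof -
  have cl: "(\<lambda>g. c g \<odot>\<^bsub>M\<^esub> g) \<in> G \<rightarrow> carrier M" using assms by auto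
  then show "(\<Oplus>\<^bsub>M\<^esub>g\<in>G. c g \<odot>\<^bsub>M\<^esub> g) \<in> carrier M" by (rule M.finsum_closed)
  have "fps_X ^ 5 \<odot>\<^bsub>M\<^esub> (\<Oplus>\<^bsub>M\<^esub>g\<in>G. c g \<odot>\<^bsub>M\<^esub> g) = (\<Oplus>\<^bsub>M\<^esub>g\<in>G. fps_X ^ 5 \<odot>\<^bsub>M\<^esub> (c g \<odot>\<^bsub>M\<^esub> g))"
    by (rule finsum_smult_ldistr[OF assms(1) X5_mem cl])
  also have "\<dots> = comb G c"
    unfolding comb_def
  proof (rule M.finsum_cong')
    fix g assume "g \<in> G"
    then show "fps_X ^ 5 \<odot>\<^bsub>M\<^esub> (c g \<odot>\<^bsub>M\<^esub> g) = (fps_X ^ 5 * c g) \<odot>\<^bsub>M\<^esub> g"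
      using smult_assoc1[OF X5_mem assms(3)[OF \<open>g \<in> G\<close>], of g] assms(2) by (auto simp: sr_simps(4))
  qed (use assms X5_mult_mem in auto)
  finally show "fps_X ^ 5 \<odot>\<^bsub>M\<^esub> (\<Oplus>\<^bsub>M\<^esub>g\<in>G. c g \<odot>\<^bsub>M\<^esub> g) = comb G c" .
qed

end

section \<open>Coordinates with respect to a basis\<close>

lemma vector_space_triple: "vector_space scale3"
  by unfold_locales (auto simp: scale3_def algebra_simps)

lemma fps_act_core:
  assumes "triple_space sc V \<Gamma>" "s \<in> core" "v \<in> lattice_seq V \<Gamma>"
  shows "fps_act sc s v \<in> lattice_seq V \<Gamma>"
proof -
  interpret T: triple_space sc V \<Gamma> by fact
  have s: "fps_nth s (Suc 0) = 0" "fps_nth s 2 = 0" "fps_nth s 4 = 0" using assms(2) by (simp_all add: core_def)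
  have v: "(v 1, v 2, v 4) \<in> \<Gamma>" "\<And>n. v n \<in> V" using assms(3) by (simp_all add: lattice_seq_def)
  have "fps_act sc s v n \<in> V" for n
    unfolding fps_act_def by (intro T.subspace_sum[OF T.V] T.subspace_scale[OF T.V] v)
  moreover have "(sc (fps_nth s 0) (v 1) + sc (fps_nth s 3) 0, sc (fps_nth s 0) (v 2) + sc (fps_nth s 3) 0,
      sc (fps_nth s 0) (v 4) + sc (fps_nth s 3) (v 1)) \<in> \<Gamma>"
    by (intro T.add T.scl v(1) T.shift[OF v(1)])
  then have "(fps_act sc s v 1, fps_act sc s v 2, fps_act sc s v 4) \<in> \<Gamma>"
    using s by (simp add: fps_act_def numeral_nat atMost_Suc add.commute)
  ultimately show ?thesis by (simp add: lattice_seq_def)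
qed

text \<open>Linearity is demanded over \<open>core\<close> only, so that one notion fits every
  \<open>H\<close> containing 3, 5, 7; the action of the rest of \<open>S\<close> is recovered by
  \<open>core_linear_smult\<close>.\<close>

definition core_iso :: "('k::field \<Rightarrow> 'v \<Rightarrow> 'v) \<Rightarrow> ('k fps, 'a) module \<Rightarrow> 'v::ab_group_add set \<Rightarrow>
    ('v \<times> 'v \<times> 'v) set \<Rightarrow> ('a \<Rightarrow> nat \<Rightarrow> 'v) \<Rightarrow> bool" where
  "core_iso sc M V \<Gamma> f \<longleftrightarrow> bij_betw f (carrier M) (lattice_seq V \<Gamma>) \<and>
     (\<forall>x\<in>carrier M. \<forall>y\<in>carrier M. f (x \<oplus>\<^bsub>M\<^esub> y) = f x + f y) \<and>
     (\<forall>s\<in>core. \<forall>x\<in>carrier M. f (s \<odot>\<^bsub>M\<^esub> x) = fps_act sc s (f x))"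

text \<open>Coordinates with respect to a basis \<open>G\<close> in \<open>M\<close>. As
  \<open>M\<close> contains all \<open>core\<close>-combinations of \<open>G\<close>, membership of
  a family of series depends on its coefficients in degrees 1, 2, 4 alone, and
  \<open>\<Gamma>\<close> is the set of triples that occur. Functions supported on \<open>G\<close>
  play the part of \<open>k^G\<close>, whose dimension depends on \<open>M\<close>, inside one fixed
  type.\<close>

lemma exists_core_iso:
  fixes M :: "('k::field fps, 'a) module"
  assumes M: "cusp_module H S M" and fg: "fin_gen_module S M"
  shows "\<exists>V \<Gamma> f. triple_space fun_scale V \<Gamma> \<and> core_iso fun_scale M V \<Gamma> (f :: 'a \<Rightarrow> nat \<Rightarrow> 'a \<Rightarrow> 'k)"
proof -
  interpret cusp_module H S M by (rule M)
  obtain G where sp: "spans G" and ind: "\<And>c. comb G c = \<zero>\<^bsub>M\<^esub> \<Longrightarrow> \<forall>g\<in>G. c g = 0"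
    by (rule exists_basis[OF fg]) blast
  have GM: "finite G" "G \<subseteq> carrier M" using sp by (auto simp: spans_def)
  define F where "F = {c :: 'a \<Rightarrow> 'k fps. \<forall>g. g \<notin> G \<longrightarrow> c g = 0}"
  define coord where "coord m = (SOME c. c \<in> F \<and> fps_X ^ 5 \<odot>\<^bsub>M\<^esub> m = comb G c)" for m
  have coord: "coord m \<in> F \<and> fps_X ^ 5 \<odot>\<^bsub>M\<^esub> m = comb G (coord m)" if m: "m \<in> carrier M" for m
  proof -
    obtain c where c: "fps_X ^ 5 \<odot>\<^bsub>M\<^esub> m = comb G c" using sp m unfolding spans_def by blast
    have "comb G c = comb G (\<lambda>g. if g \<in> G then c g else 0)" by (rule comb_cong[OF GM(2)]) simp
    then have "\<exists>c. c \<in> F \<and> fps_X ^ 5 \<odot>\<^bsub>M\<^esub> m = comb G c"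
      using c by (intro exI[of _ "\<lambda>g. if g \<in> G then c g else 0"]) (simp add: F_def)
    from someI_ex[OF this] show ?thesis unfolding coord_def .
  qed
  have comb_inj: "c = d" if "c \<in> F" "d \<in> F" "comb G c = comb G d" for c d
  proof
    fix g
    have "comb G (\<lambda>g. c g + - d g) = \<zero>\<^bsub>M\<^esub>"
      using comb_add[OF GM(2), of c "\<lambda>g. - d g"] comb_neg[OF GM(2,1), of d] that(3) comb_closed[OF GM(2), of d]
      by (simp add: M.r_neg)
    then show "c g = d g" using ind[of "\<lambda>g. c g + - d g"] that(1,2) by (cases "g \<in> G") (auto simp: F_def)
  qed
  have coordI: "coord m = c" if "m \<in> carrier M" "c \<in> F" "fps_X ^ 5 \<odot>\<^bsub>M\<^esub> m = comb G c" for m c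
    using comb_inj[of "coord m" c] coord[OF that(1)] that by simp
  have F_add: "(\<lambda>g. c g + d g) \<in> F" if "c \<in> F" "d \<in> F" for c d using that by (simp add: F_def)
  have F_mult: "(\<lambda>g. s * c g) \<in> F" if "c \<in> F" for c s using that by (simp add: F_def)
  have coord_add: "coord (x \<oplus>\<^bsub>M\<^esub> y) = (\<lambda>g. coord x g + coord y g)"
    if "x \<in> carrier M" "y \<in> carrier M" for x y
    using that coord[OF that(1)] coord[OF that(2)] X5_mem
    by (intro coordI F_add) (simp_all add: smult_r_distr comb_add[OF GM(2)])
  have coord_smult: "coord (s \<odot>\<^bsub>M\<^esub> x) = (\<lambda>g. s * coord x g)"
    if "s \<in> carrier S" "x \<in> carrier M" for s x
  proof (intro coordI F_mult)
    have "fps_X ^ 5 \<odot>\<^bsub>M\<^esub> (s \<odot>\<^bsub>M\<^esub> x) = s \<odot>\<^bsub>M\<^esub> (fps_X ^ 5 \<odot>\<^bsub>M\<^esub> x)"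
      using smult_assoc1[OF X5_mem that] smult_assoc1[OF that(1) X5_mem that(2)]
      by (simp add: sr_simps(4) mult.commute)
    then show "fps_X ^ 5 \<odot>\<^bsub>M\<^esub> (s \<odot>\<^bsub>M\<^esub> x) = comb G (\<lambda>g. s * coord x g)"
      using coord[OF that(2)] comb_smult[OF GM(2,1) that(1)] by simp
  qed (use that coord in auto)
  have coord_inj: "x = y" if "x \<in> carrier M" "y \<in> carrier M" "coord x = coord y" for x y
    using smult_cancel[OF X5_mem that(1,2)] coord[OF that(1)] coord[OF that(2)] that(3) by simp
  have coord_core: "\<exists>m\<in>carrier M. coord m = c" if "c \<in> F" "\<And>g. c g \<in> core" for c
  proof -
    have cS: "c g \<in> carrier S" for g by (rule core_S[OF that(2)])
    have "coord (\<Oplus>\<^bsub>M\<^esub>g\<in>G. c g \<odot>\<^bsub>M\<^esub> g) = c"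
      by (intro coordI finsum_core GM cS that(1))
    moreover have "(\<Oplus>\<^bsub>M\<^esub>g\<in>G. c g \<odot>\<^bsub>M\<^esub> g) \<in> carrier M"
      by (intro finsum_core GM cS)
    ultimately show ?thesis by blast
  qed
  define part where "part x y z g = fps_X * fps_const (x g) + fps_X ^ 2 * fps_const (y g) + fps_X ^ 4 * fps_const (z g)"
    for x y z :: "'a \<Rightarrow> 'k" and g
  have part_nth: "fps_nth (part x y z g) n = (if n = 1 then x g else if n = 2 then y g else if n = 4 then z g else 0)"
    for x y z g n
    by (auto simp: part_def fps_X_power_mult_nth)
  define V where "V = {x :: 'a \<Rightarrow> 'k. \<forall>g. g \<notin> G \<longrightarrow> x g = 0}"
  define \<Gamma> where "\<Gamma> = {(x, y, z). x \<in> V \<and> y \<in> V \<and> z \<in> V \<and> (\<exists>m\<in>carrier M. coord m = part x y z)}"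
  \<comment> \<open>An element with the right coefficients at the gaps is enough: its deviation from
    \<open>part x y z\<close> lies in \<open>core\<close> and is removed by adding another element
    of \<open>M\<close>.\<close>
  have \<Gamma>I: "(x, y, z) \<in> \<Gamma>" if "x \<in> V" "y \<in> V" "z \<in> V" "m \<in> carrier M"
    "\<And>g. coord m g - part x y z g \<in> core" for x y z m
  proof -
    have pF: "part x y z \<in> F" using that(1-3) by (auto simp: F_def V_def part_def)
    have "(\<lambda>g. - 1 * coord m g) \<in> F" using coord[OF that(4)] by (intro F_mult) simp
    from F_add[OF pF this] have "(\<lambda>g. part x y z g - coord m g) \<in> F" by simp
    moreover have "part x y z g - coord m g \<in> core" for g
      using that(5)[of g] by (auto simp: core_def)
    ultimately obtain m' where m': "m' \<in> carrier M" "coord m' = (\<lambda>g. part x y z g - coord m g)"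
      using coord_core by blast
    have "coord (m \<oplus>\<^bsub>M\<^esub> m') = part x y z" using coord_add[OF that(4) m'(1)] m'(2) by simp
    then show ?thesis using that m'(1) by (auto simp: \<Gamma>_def)
  qed
  interpret W: vector_space "fun_scale :: 'k \<Rightarrow> ('a \<Rightarrow> 'k) \<Rightarrow> _" by (rule vector_space_fun_scale)
  have sub: "W.subspace V" by (auto simp: W.subspace_def V_def fun_scale_def)
  have T: "triple_space fun_scale V \<Gamma>"
  proof (unfold_locales)
    show "W.subspace V" by (rule sub)
    show "x \<in> V \<and> y \<in> V \<and> z \<in> V" if "(x, y, z) \<in> \<Gamma>" for x y z using that by (simp add: \<Gamma>_def)
    show "(0, 0, 0) \<in> \<Gamma>"
    proof (rule \<Gamma>I)
      show "coord \<zero>\<^bsub>M\<^esub> g - part 0 0 0 g \<in> core" for g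
        using coordI[of "\<zero>\<^bsub>M\<^esub>" "\<lambda>_. 0"] X5_mem comb_zero[OF GM(2)] by (simp add: F_def part_def core_def)
    qed (auto simp: V_def)
    show "(x + x', y + y', z + z') \<in> \<Gamma>" if "(x, y, z) \<in> \<Gamma>" "(x', y', z') \<in> \<Gamma>" for x y z x' y' z'
    proof -
      obtain m m' where m: "m \<in> carrier M" "coord m = part x y z" "m' \<in> carrier M" "coord m' = part x' y' z'"
        using \<open>(x, y, z) \<in> \<Gamma>\<close> \<open>(x', y', z') \<in> \<Gamma>\<close> unfolding \<Gamma>_def by blast
      show ?thesis
      proof (rule \<Gamma>I)
        show "m \<oplus>\<^bsub>M\<^esub> m' \<in> carrier M" using m by simp
        show "coord (m \<oplus>\<^bsub>M\<^esub> m') g - part (x + x') (y + y') (z + z') g \<in> core" for g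
          using coord_add[OF m(1,3)] m by (simp add: core_def part_nth)
      qed (use that W.subspace_add[OF sub] in \<open>simp_all add: \<Gamma>_def\<close>)
    qed
    show "(fun_scale r x, fun_scale r y, fun_scale r z) \<in> \<Gamma>" if xyz: "(x, y, z) \<in> \<Gamma>" for r x y z
    proof -
      obtain m where m: "m \<in> carrier M" "coord m = part x y z"
        using xyz unfolding \<Gamma>_def by blast
      show ?thesis
      proof (rule \<Gamma>I)
        show "fps_const r \<odot>\<^bsub>M\<^esub> m \<in> carrier M" using m sr_const by simp
        show "coord (fps_const r \<odot>\<^bsub>M\<^esub> m) g - part (fun_scale r x) (fun_scale r y) (fun_scale r z) g \<in> core" for g
          using coord_smult[OF sr_const m(1)] m by (simp add: core_def part_nth fun_scale_def)
      qed (use that W.subspace_scale[OF sub] in \<open>simp_all add: \<Gamma>_def\<close>)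
    qed
    show "(0, 0, x) \<in> \<Gamma>" if xyz: "(x, y, z) \<in> \<Gamma>" for x y z
    proof -
      obtain m where m: "m \<in> carrier M" "coord m = part x y z"
        using xyz unfolding \<Gamma>_def by blast
      \<comment> \<open>Multiplication by \<open>t^3\<close> moves the coefficient of degree 1 to
        degree 4; that of degree 2 moves to degree 5, where \<open>core\<close> absorbs it.\<close>
      have X3: "fps_X ^ 3 \<in> carrier S" by (rule sr_X_power) (rule core_H, auto)
      show ?thesis
      proof (rule \<Gamma>I)
        show "fps_X ^ 3 \<odot>\<^bsub>M\<^esub> m \<in> carrier M" using m X3 by simp
        show "coord (fps_X ^ 3 \<odot>\<^bsub>M\<^esub> m) g - part 0 0 x g \<in> core" for g
          using coord_smult[OF X3 m(1)] m by (simp add: core_def part_nth fps_X_power_mult_nth)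
      qed (use that in \<open>auto simp: \<Gamma>_def V_def\<close>)
    qed
  qed
  define f where "f m n g = fps_nth (coord m g) n" for m n g
  have fV: "f m n \<in> V" if "m \<in> carrier M" for m n
    using coord[OF that] by (simp add: f_def V_def F_def)
  have "f m \<in> lattice_seq V \<Gamma>" if m: "m \<in> carrier M" for m
  proof -
    have "(f m 1, f m 2, f m 4) \<in> \<Gamma>"
      by (rule \<Gamma>I[OF fV fV fV m]) (use m in \<open>simp_all add: core_def part_nth f_def\<close>)
    then show ?thesis using fV[OF m] by (simp add: lattice_seq_def)
  qed
  moreover have "\<exists>m\<in>carrier M. f m = v" if v: "v \<in> lattice_seq V \<Gamma>" for v
  proof -
    have vV: "v n \<in> V" for n using v by (simp add: lattice_seq_def)
    have vg: "(v 1, v 2, v 4) \<in> \<Gamma>" using v by (simp add: lattice_seq_def)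
    obtain m where m: "m \<in> carrier M" "coord m = part (v 1) (v 2) (v 4)" using vg unfolding \<Gamma>_def by blast
    let ?r = "\<lambda>g. Abs_fps (\<lambda>n. v n g) - part (v 1) (v 2) (v 4) g"
    have "?r \<in> F"
      using vV by (auto simp: F_def V_def part_nth intro!: fps_ext)
    moreover have "?r g \<in> core" for g by (simp add: core_def part_nth)
    ultimately obtain m' where m': "m' \<in> carrier M" "coord m' = ?r" using coord_core by blast
    have "f (m \<oplus>\<^bsub>M\<^esub> m') = v"
      using coord_add[OF m(1) m'(1)] m(2) m'(2) by (simp add: f_def fun_eq_iff)
    then show ?thesis using m m' by blast
  qed
  moreover have "inj_on f (carrier M)"
  proof (rule inj_onI)
    fix x y assume xy: "x \<in> carrier M" "y \<in> carrier M" "f x = f y"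
    have "fps_nth (coord x g) n = fps_nth (coord y g) n" for g n
      using fun_cong[OF fun_cong[OF xy(3), of n], of g] by (simp add: f_def)
    then have "coord x = coord y" by (intro ext fps_ext)
    then show "x = y" by (rule coord_inj[OF xy(1,2)])
  qed
  ultimately have "bij_betw f (carrier M) (lattice_seq V \<Gamma>)"
    unfolding bij_betw_def by blast
  moreover have "f (x \<oplus>\<^bsub>M\<^esub> y) = f x + f y" if "x \<in> carrier M" "y \<in> carrier M" for x y
    using coord_add[OF that] by (simp add: f_def fun_eq_iff)
  moreover have "f (s \<odot>\<^bsub>M\<^esub> x) = fps_act fun_scale s (f x)" if "s \<in> core" "x \<in> carrier M" for s x
  proof -
    have *: "(\<Sum>i\<in>A. h i) g = (\<Sum>i\<in>A. h i g)" for h :: "nat \<Rightarrow> 'a \<Rightarrow> 'k" and A g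
      by (induction A rule: infinite_finite_induct) auto
    show ?thesis
      using coord_smult[OF core_S[OF that(1)] that(2)]
      by (simp add: f_def fun_eq_iff fps_act_def fps_mult_nth * fun_scale_def atLeast0AtMost)
  qed
  ultimately have "core_iso fun_scale M V \<Gamma> f" by (simp add: core_iso_def)
  with T show ?thesis by blast
qed

section \<open>From linearity over \<open>core\<close> to linearity over \<open>S\<close>; the
  classification\<close>

lemma core_mult: "s \<in> carrier (semigroup_ring H) \<Longrightarrow> fps_X ^ 5 * s \<in> core"
  by (simp add: core_def fps_X_power_mult_nth)

lemma X5_core: "fps_X ^ 5 \<in> core"
  by (simp add: core_def fps_X_power_nth)

text \<open>For \<open>s\<close> in \<open>S\<close> the product \<open>t^5 * s\<close> is in
  \<open>core\<close>, so a \<open>core\<close>-linear map commutes with \<open>s\<close> after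
  multiplication by \<open>t^5\<close>. Where \<open>t^5\<close> can be cancelled, it commutes with
  \<open>s\<close>.\<close>

lemma (in cusp_module) core_linear_smult:
  assumes f: "\<And>s x. s \<in> core \<Longrightarrow> x \<in> X \<Longrightarrow> h (s \<odot>\<^bsub>M\<^esub> x) = fps_act sc s (h x)"
    and "s \<in> carrier S" "x \<in> X" "X = carrier M"
  shows "fps_act sc (fps_X ^ 5) (h (s \<odot>\<^bsub>M\<^esub> x)) = fps_act sc (fps_X ^ 5 * s) (h x)"
proof -
  have "fps_X ^ 5 \<odot>\<^bsub>M\<^esub> (s \<odot>\<^bsub>M\<^esub> x) = (fps_X ^ 5 * s) \<odot>\<^bsub>M\<^esub> x"
    using smult_assoc1[OF X5_mem assms(2), of x] assms(3,4) by (simp add: sr_simps(4))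
  then show ?thesis
    using f[OF X5_core, of "s \<odot>\<^bsub>M\<^esub> x"] f[OF core_mult, of s H x] assms(2-4) S_def by simp
qed

lemma fps_act_X5_0: "fps_act sc (fps_X ^ 5) u = (\<lambda>n. \<Sum>i\<le>n. sc (if i = 5 then 1 else 0) (u (n - i)))"
  by (rule ext) (simp add: fps_act_def fps_X_power_nth)

lemma fps_act_X5_inj:
  assumes "vector_space sc" and "fps_act sc (fps_X ^ 5) u = fps_act sc (fps_X ^ 5) v"
  shows "u = v"
proof
  fix n
  interpret vector_space sc by fact
  have "fps_act sc (fps_X ^ 5) w (n + 5) = w n" for w
    unfolding fps_act_X5_0 by (simp add: if_distrib[of "\<lambda>c. sc c _"] cong: if_cong)
  then show "u n = v n" using assms(2) by metis
qed

text \<open>\<open>P\<close> after \<open>I\<close> is bijective on the model by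
  \<open>neumann_bij\<close>, so in \<open>M\<close> the image of \<open>J\<close> and the kernel of
  \<open>Q\<close> are complementary. Indecomposability kills the kernel, because the model is
  nonzero, and \<open>Q\<close> itself is then the required isomorphism.\<close>

lemma model_core_iso:
  fixes M :: "('k::field fps, 'a) module" and \<phi> :: "'a \<Rightarrow> nat \<Rightarrow> 'v::ab_group_add"
  assumes M: "cusp_module H S M" and ind: "indecomposable_module S M"
    and T: "triple_space sc V \<Gamma>" and \<phi>: "core_iso sc M V \<Gamma> \<phi>"
  shows "\<exists>(V', \<Gamma>')\<in>models. \<exists>\<psi>. core_iso scale3 M V' \<Gamma>' \<psi>"
proof -
  interpret cusp_module H S M by (rule M)
  interpret T: triple_space sc V \<Gamma> by (rule T)
  have \<phi>_bij: "bij_betw \<phi> (carrier M) (lattice_seq V \<Gamma>)"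
    and \<phi>_add: "\<And>x y. x \<in> carrier M \<Longrightarrow> y \<in> carrier M \<Longrightarrow> \<phi> (x \<oplus>\<^bsub>M\<^esub> y) = \<phi> x + \<phi> y"
    and \<phi>_core: "\<And>s x. s \<in> core \<Longrightarrow> x \<in> carrier M \<Longrightarrow> \<phi> (s \<odot>\<^bsub>M\<^esub> x) = fps_act sc s (\<phi> x)"
    using \<phi> by (auto simp: core_iso_def)
  have M0: "carrier M \<noteq> {\<zero>\<^bsub>M\<^esub>}" using ind by (simp add: indecomposable_module_def)
  have \<phi>0: "\<phi> \<zero>\<^bsub>M\<^esub> = 0" using \<phi>_add[of "\<zero>\<^bsub>M\<^esub>" "\<zero>\<^bsub>M\<^esub>"] by simp
  have \<phi>_inj: "x = y" if "x \<in> carrier M" "y \<in> carrier M" "\<phi> x = \<phi> y" for x y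
    using \<phi>_bij that by (meson bij_betw_imp_inj_on inj_onD)
  have \<phi>_mem: "\<phi> x \<in> lattice_seq V \<Gamma>" if "x \<in> carrier M" for x using \<phi>_bij that by (rule bij_betwE[rule_format])
  have "\<exists>v\<in>V. v \<noteq> 0"
  proof (rule ccontr)
    assume no: "\<not> ?thesis"
    have "\<phi> x = 0" if "x \<in> carrier M" for x
    proof
      fix n
      have "\<phi> x n \<in> V" using \<phi>_mem[OF that] by (simp add: lattice_seq_def)
      then show "\<phi> x n = 0 n" using no by auto
    qed
    then have "carrier M \<subseteq> {\<zero>\<^bsub>M\<^esub>}" using \<phi>_inj \<phi>0 by (metis M.zero_closed insertCI subsetI)
    then show False using M0 by auto
  qed
  then obtain v where v: "v \<in> V" "v \<noteq> 0" by blast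
  obtain V' \<Gamma>' where mod: "(V', \<Gamma>') \<in> models" and sm: "T.summand V' \<Gamma>'"
    using T.exists_summand[OF v] by blast
  obtain i0 i1 i2 i3 i4 p0 p1 p2 p3 p4 where
    i: "graded_hom scale3 V' \<Gamma>' sc V \<Gamma> i0 i1 i2 i3 i4" and
    p: "graded_hom sc V \<Gamma> scale3 V' \<Gamma>' p0 p1 p2 p3 p4" and
    nil: "\<And>x. x \<in> V' \<Longrightarrow> ((\<lambda>x. p0 (i0 x) - x) ^^ 3) x = 0"
    using sm unfolding T.summand_def by blast
  have T': "triple_space scale3 V' \<Gamma>'" by (rule triple_space_models[OF mod])
  interpret T': triple_space scale3 V' \<Gamma>' by (rule T')
  let ?X = "lattice_seq V' \<Gamma>'"
  define I where "I = convolution (hom_seq i0 i1 i2 i3 i4)"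
  define P where "P = convolution (hom_seq p0 p1 p2 p3 p4)"
  have I_mem: "I x \<in> lattice_seq V \<Gamma>" if "x \<in> ?X" for x unfolding I_def by (rule convolution_lattice_seq[OF i T that])
  have P_mem: "P x \<in> ?X" if "x \<in> lattice_seq V \<Gamma>" for x unfolding P_def by (rule convolution_lattice_seq[OF p T' that])
  have I_add: "I (x + y) = I x + I y" for x y unfolding I_def by (rule convolution_add[OF hom_seq_linear[OF i]])
  have P_add: "P (x + y) = P x + P y" for x y unfolding P_def by (rule convolution_add[OF hom_seq_linear[OF p]])
  have I_act: "I (fps_act scale3 s x) = fps_act sc s (I x)" for s x
    unfolding I_def by (rule convolution_fps_act[OF hom_seq_linear[OF i]])
  have P_act: "P (fps_act sc s x) = fps_act scale3 s (P x)" for s x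
    unfolding P_def by (rule convolution_fps_act[OF hom_seq_linear[OF p]])
  have lin0: "hom_seq i0 i1 i2 i3 i4 j 0 = 0" "hom_seq p0 p1 p2 p3 p4 j 0 = 0" for j
  proof -
    interpret a: Vector_Spaces.linear scale3 sc "hom_seq i0 i1 i2 i3 i4 j" by (rule hom_seq_linear[OF i])
    interpret b: Vector_Spaces.linear sc scale3 "hom_seq p0 p1 p2 p3 p4 j" by (rule hom_seq_linear[OF p])
    show "hom_seq i0 i1 i2 i3 i4 j 0 = 0" "hom_seq p0 p1 p2 p3 p4 j 0 = 0" by (rule a.zero, rule b.zero)
  qed
  have I_low: "I u m = 0" if "\<And>m. m < n \<Longrightarrow> u m = 0" "m < n" for u n m
    unfolding I_def convolution_def by (rule sum.neutral) (use that lin0 in auto)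
  have P_low: "P u m = 0" if "\<And>m. m < n \<Longrightarrow> u m = 0" "m < n" for u n m
    unfolding P_def convolution_def by (rule sum.neutral) (use that lin0 in auto)
  have sum_low: "(\<Sum>j\<le>n. h j (u (n - j))) = h 0 (u n)"
    if "\<And>m. m < n \<Longrightarrow> u m = 0" "\<And>j. h j 0 = 0"
    for h :: "nat \<Rightarrow> 'x::ab_group_add \<Rightarrow> 'y::ab_group_add" and u n
    by (subst sum.remove[of _ 0]) (auto intro!: sum.neutral simp: that)
  have I_n: "I u n = i0 (u n)" if "\<And>m. m < n \<Longrightarrow> u m = 0" for u n
    unfolding I_def convolution_def
    using sum_low[of n u "hom_seq i0 i1 i2 i3 i4", OF that lin0(1)] by (simp add: hom_seq_def)
  have P_n: "P u n = p0 (u n)" if "\<And>m. m < n \<Longrightarrow> u m = 0" for u n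
    unfolding P_def convolution_def
    using sum_low[of n u "hom_seq p0 p1 p2 p3 p4", OF that lin0(2)] by (simp add: hom_seq_def)
  have f_bij: "bij_betw (\<lambda>x. P (I x)) ?X ?X"
  proof (rule neumann_bij[OF T'])
    fix w :: "nat \<Rightarrow> 'k \<times> 'k \<times> 'k" and n
    assume w: "\<And>m. m < n \<Longrightarrow> w m = 0"
    show "(\<forall>m<n. P (I w) m = 0) \<and> P (I w) n = p0 (i0 (w n))"
      using P_low[OF I_low[OF w]] P_n[OF I_low[OF w]] I_n[OF w] by auto
  qed (use I_mem P_mem I_add P_add nil in auto)
  define J where "J x = inv_into (carrier M) \<phi> (I x)" for x
  define Q where "Q m = P (\<phi> m)" for m
  have J_mem: "J x \<in> carrier M" and \<phi>J: "\<phi> (J x) = I x" if "x \<in> ?X" for x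
    using I_mem[OF that] \<phi>_bij unfolding J_def bij_betw_def
    by (metis inv_into_into, metis f_inv_into_f)
  have Q_mem: "Q m \<in> ?X" if "m \<in> carrier M" for m unfolding Q_def by (rule P_mem[OF \<phi>_mem[OF that]])
  have Q_add: "Q (x \<oplus>\<^bsub>M\<^esub> y) = Q x + Q y" if "x \<in> carrier M" "y \<in> carrier M" for x y
    unfolding Q_def using \<phi>_add[OF that] P_add by simp
  have Q_core: "Q (s \<odot>\<^bsub>M\<^esub> x) = fps_act scale3 s (Q x)" if "s \<in> core" "x \<in> carrier M" for s x
    unfolding Q_def using \<phi>_core[OF that] P_act by simp
  have X_add: "x + y \<in> ?X" if "x \<in> ?X" "y \<in> ?X" for x y
    using that T'.subspace_add[OF T'.V] T'.add by (simp add: lattice_seq_def)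
  have X_neg: "- x \<in> ?X" if "x \<in> ?X" for x
    using that T'.subspace_neg[OF T'.V] T'.neg by (simp add: lattice_seq_def)
  have J_add: "J (x + y) = J x \<oplus>\<^bsub>M\<^esub> J y" if "x \<in> ?X" "y \<in> ?X" for x y
    using that X_add J_mem by (intro \<phi>_inj) (simp_all add: \<phi>_add \<phi>J I_add)
  have J_core: "J (fps_act scale3 s x) = s \<odot>\<^bsub>M\<^esub> J x" if "s \<in> core" "x \<in> ?X" for s x
    using that fps_act_core[OF T' that] J_mem core_S by (intro \<phi>_inj) (simp_all add: \<phi>_core \<phi>J I_act)
  have QJ: "Q (J x) = P (I x)" if "x \<in> ?X" for x using \<phi>J[OF that] by (simp add: Q_def)
  have J_0: "J 0 = \<zero>\<^bsub>M\<^esub>" and X0: "0 \<in> ?X"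
  proof -
    show "0 \<in> ?X" using T'.zero T'.V0 by (simp add: lattice_seq_def)
    from J_add[OF this this] J_mem[OF this] show "J 0 = \<zero>\<^bsub>M\<^esub>" by simp
  qed
  have Q0: "Q \<zero>\<^bsub>M\<^esub> = 0" using Q_add[of "\<zero>\<^bsub>M\<^esub>" "\<zero>\<^bsub>M\<^esub>"] by simp
  have f_surj: "\<exists>y\<in>?X. Q (J y) = x" if "x \<in> ?X" for x
    using f_bij that QJ unfolding bij_betw_def by (metis imageE)
  have f_inj: "x = y" if "x \<in> ?X" "y \<in> ?X" "Q (J x) = Q (J y)" for x y
    using f_bij that QJ unfolding bij_betw_def by (metis inj_onD)
  define A where "A = J ` ?X"
  define B where "B = {m \<in> carrier M. Q m = 0}"
  have neg: "\<ominus>\<^bsub>M\<^esub> m = (\<ominus>\<^bsub>S\<^esub> \<one>\<^bsub>S\<^esub>) \<odot>\<^bsub>M\<^esub> m" if "m \<in> carrier M" for m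
    using that by (simp add: smult_l_minus)
  have A: "submodule A S M"
  proof (rule submoduleI)
    show "A \<subseteq> carrier M" using J_mem by (auto simp: A_def)
    show "\<zero>\<^bsub>M\<^esub> \<in> A" unfolding A_def using J_0 X0 by (metis imageI)
    show "a \<oplus>\<^bsub>M\<^esub> b \<in> A" if "a \<in> A" "b \<in> A" for a b
      using that X_add by (auto simp: A_def J_add[symmetric])
    \<comment> \<open>\<open>J\<close> is linear over \<open>core\<close> only, so stability of its
      image under \<open>S\<close> needs an argument: the candidate \<open>J y\<close> is the
      element of the image with the same value under \<open>Q\<close> as \<open>s a\<close>. After
      multiplication by \<open>t^5\<close> both come from the same element of the model, and
      \<open>t^5\<close> cancels.\<close>
    show sA: "s \<odot>\<^bsub>M\<^esub> a \<in> A" if s: "s \<in> carrier S" and a: "a \<in> A" for s a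
    proof -
      obtain x where x: "x \<in> ?X" "a = J x" using a by (auto simp: A_def)
      have sa: "s \<odot>\<^bsub>M\<^esub> a \<in> carrier M" using s x J_mem by simp
      obtain y where y: "y \<in> ?X" "Q (J y) = Q (s \<odot>\<^bsub>M\<^esub> a)" using f_surj[OF Q_mem[OF sa]] by blast
      have c: "fps_X ^ 5 * s \<in> core" using core_mult s S_def by blast
      have "Q (J (fps_act scale3 (fps_X ^ 5) y)) = fps_act scale3 (fps_X ^ 5) (Q (s \<odot>\<^bsub>M\<^esub> a))"
        using J_core[OF X5_core y(1)] Q_core[OF X5_core J_mem[OF y(1)]] y(2) by simp
      also have "\<dots> = fps_act scale3 (fps_X ^ 5 * s) (Q (J x))"
        using core_linear_smult[OF Q_core s _ refl, of a] x J_mem by simp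
      also have "\<dots> = Q (J (fps_act scale3 (fps_X ^ 5 * s) x))"
        using J_core[OF c x(1)] Q_core[OF c J_mem[OF x(1)]] by simp
      finally have "fps_act scale3 (fps_X ^ 5) y = fps_act scale3 (fps_X ^ 5 * s) x"
        using f_inj fps_act_core[OF T' X5_core y(1)] fps_act_core[OF T' c x(1)] by blast
      then have "fps_X ^ 5 \<odot>\<^bsub>M\<^esub> J y = (fps_X ^ 5 * s) \<odot>\<^bsub>M\<^esub> J x"
        using J_core[OF X5_core y(1)] J_core[OF c x(1)] by metis
      also have "\<dots> = fps_X ^ 5 \<odot>\<^bsub>M\<^esub> (s \<odot>\<^bsub>M\<^esub> a)"
        using smult_assoc1[OF X5_mem s J_mem[OF x(1)]] x(2) by (simp add: sr_simps(4))
      finally have "J y = s \<odot>\<^bsub>M\<^esub> a" using smult_cancel[OF X5_mem J_mem[OF y(1)] sa] by simp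
      then show ?thesis unfolding A_def using y(1) by (metis imageI)
    qed
    show "\<ominus>\<^bsub>M\<^esub> a \<in> A" if "a \<in> A" for a
      using sA[of "\<ominus>\<^bsub>S\<^esub> \<one>\<^bsub>S\<^esub>" a] that neg[of a] J_mem by (auto simp: A_def)
  qed
  have B: "submodule B S M"
  proof (rule submoduleI)
    show "B \<subseteq> carrier M" by (auto simp: B_def)
    show "\<zero>\<^bsub>M\<^esub> \<in> B" using Q0 by (simp add: B_def)
    show "a \<oplus>\<^bsub>M\<^esub> b \<in> B" if "a \<in> B" "b \<in> B" for a b
      using that Q_add by (simp add: B_def)
    show sB: "s \<odot>\<^bsub>M\<^esub> a \<in> B" if s: "s \<in> carrier S" and a: "a \<in> B" for s a
    proof -
      have a': "a \<in> carrier M" "Q a = 0" using a by (auto simp: B_def)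
      have act0: "fps_act scale3 r 0 = 0" for r :: "'k fps"
        by (rule ext) (simp add: fps_act_def)
      have "fps_act scale3 (fps_X ^ 5) (Q (s \<odot>\<^bsub>M\<^esub> a)) = fps_act scale3 (fps_X ^ 5) 0"
        using core_linear_smult[OF Q_core s a'(1) refl] by (simp only: a'(2) act0)
      then have "Q (s \<odot>\<^bsub>M\<^esub> a) = 0" by (rule fps_act_X5_inj[OF vector_space_triple])
      then show ?thesis using s a'(1) by (simp add: B_def)
    qed
    show "\<ominus>\<^bsub>M\<^esub> a \<in> B" if "a \<in> B" for a
      using sB[of "\<ominus>\<^bsub>S\<^esub> \<one>\<^bsub>S\<^esub>" a] that neg[of a] by (auto simp: B_def)
  qed
  have sub: "A \<subseteq> carrier M" "B \<subseteq> carrier M" using J_mem by (auto simp: A_def B_def)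
  have "A <+>\<^bsub>M\<^esub> B = carrier M"
  proof
    show "A <+>\<^bsub>M\<^esub> B \<subseteq> carrier M" using sub by (auto simp: set_add_def')
    show "carrier M \<subseteq> A <+>\<^bsub>M\<^esub> B"
    proof
      fix m assume m: "m \<in> carrier M"
      obtain y where y: "y \<in> ?X" "Q (J y) = Q m" using f_surj[OF Q_mem[OF m]] by blast
      have Jy: "J y \<in> carrier M" "\<ominus>\<^bsub>M\<^esub> J y \<in> carrier M" using J_mem[OF y(1)] by simp_all
      have "Q (J y) + Q (\<ominus>\<^bsub>M\<^esub> J y) = 0" using Q_add[OF Jy] Jy(1) by (simp add: M.r_neg Q0)
      then have "Q (m \<oplus>\<^bsub>M\<^esub> \<ominus>\<^bsub>M\<^esub> J y) = 0" using Q_add[OF m Jy(2)] y(2) by simp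
      then have "m \<oplus>\<^bsub>M\<^esub> \<ominus>\<^bsub>M\<^esub> J y \<in> B" using m Jy by (simp add: B_def)
      moreover have "m = J y \<oplus>\<^bsub>M\<^esub> (m \<oplus>\<^bsub>M\<^esub> \<ominus>\<^bsub>M\<^esub> J y)"
        using m Jy by (simp add: M.a_lcomm M.r_neg)
      ultimately show "m \<in> A <+>\<^bsub>M\<^esub> B" using y(1) by (auto simp: set_add_def' A_def)
    qed
  qed
  moreover have "A \<inter> B = {\<zero>\<^bsub>M\<^esub>}"
  proof
    show "A \<inter> B \<subseteq> {\<zero>\<^bsub>M\<^esub>}"
    proof
      fix m assume "m \<in> A \<inter> B"
      then obtain x where x: "x \<in> ?X" "m = J x" "Q (J x) = 0" by (auto simp: A_def B_def)
      then have "x = 0" using f_inj[OF x(1) X0] J_0 Q0 by simp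
      then show "m \<in> {\<zero>\<^bsub>M\<^esub>}" using x J_0 by simp
    qed
    show "{\<zero>\<^bsub>M\<^esub>} \<subseteq> A \<inter> B" using J_0 X0 Q0 by (auto simp: A_def B_def intro!: image_eqI[of _ _ 0])
  qed
  ultimately have AB: "A = {\<zero>\<^bsub>M\<^esub>} \<or> B = {\<zero>\<^bsub>M\<^esub>}"
    using ind A B unfolding indecomposable_module_def by blast
  have "A \<noteq> {\<zero>\<^bsub>M\<^esub>}"
  proof
    assume A0: "A = {\<zero>\<^bsub>M\<^esub>}"
    have Xz: "x = 0" if "x \<in> ?X" for x
    proof -
      have "J x = \<zero>\<^bsub>M\<^esub>" using A0 that by (auto simp: A_def)
      then show ?thesis using f_inj[OF that X0] J_0 by simp
    qed
    have V0: "\<exists>x\<in>V'. x \<noteq> 0"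
      using mod unfolding models_def V1_def V2_def
      by (auto simp: zero_prod_def intro!: bexI[of _ "(1, 0, 0)"])
    then obtain x where x: "x \<in> V'" "x \<noteq> 0" by blast
    have "(\<lambda>n. if n = 0 then x else 0) \<in> ?X" using x T'.zero T'.V0 by (simp add: lattice_seq_def)
    from fun_cong[OF Xz[OF this], of 0] x(2) show False by simp
  qed
  then have B0: "B = {\<zero>\<^bsub>M\<^esub>}" using AB by blast
  have "inj_on Q (carrier M)"
  proof (rule inj_onI)
    fix x y assume xy: "x \<in> carrier M" "y \<in> carrier M" "Q x = Q y"
    have ny: "\<ominus>\<^bsub>M\<^esub> y \<in> carrier M" using xy by simp
    have "Q y + Q (\<ominus>\<^bsub>M\<^esub> y) = 0" using Q_add[OF xy(2) ny] xy(2) by (simp add: M.r_neg Q0)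
    then have "Q (x \<oplus>\<^bsub>M\<^esub> \<ominus>\<^bsub>M\<^esub> y) = 0" using Q_add[OF xy(1) ny] xy(3) by simp
    then have "x \<oplus>\<^bsub>M\<^esub> \<ominus>\<^bsub>M\<^esub> y \<in> B" using xy ny by (simp add: B_def)
    then have "x \<oplus>\<^bsub>M\<^esub> \<ominus>\<^bsub>M\<^esub> y = \<zero>\<^bsub>M\<^esub>" using B0 by simp
    then show "x = y" using xy by (metis M.minus_equality M.minus_minus ny)
  qed
  moreover have "Q ` carrier M = ?X" using Q_mem f_surj J_mem by (auto simp: image_iff) metis
  ultimately have "core_iso scale3 M V' \<Gamma>' Q"
    using Q_add Q_core by (simp add: core_iso_def bij_betw_def)
  with mod show ?thesis by blast
qed

lemma core_iso_mod_iso: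
  assumes M: "cusp_module H S M" and N: "cusp_module H S N"
    and f: "core_iso sc M V \<Gamma> f" and g: "core_iso sc N V \<Gamma> g" and T: "triple_space sc V \<Gamma>"
  shows "mod_iso S M N"
proof -
  interpret M: cusp_module H S M by (rule M)
  interpret N: cusp_module H S N by (rule N)
  interpret T: triple_space sc V \<Gamma> by (rule T)
  have fb: "bij_betw f (carrier M) (lattice_seq V \<Gamma>)" and gb: "bij_betw g (carrier N) (lattice_seq V \<Gamma>)"
    and f_core: "\<And>s x. s \<in> core \<Longrightarrow> x \<in> carrier M \<Longrightarrow> f (s \<odot>\<^bsub>M\<^esub> x) = fps_act sc s (f x)"
    and g_core: "\<And>s x. s \<in> core \<Longrightarrow> x \<in> carrier N \<Longrightarrow> g (s \<odot>\<^bsub>N\<^esub> x) = fps_act sc s (g x)"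
    using f g by (auto simp: core_iso_def)
  define h where "h x = inv_into (carrier N) g (f x)" for x
  have hb: "bij_betw h (carrier M) (carrier N)"
    using bij_betw_trans[OF fb bij_betw_inv_into[OF gb]] by (simp add: h_def[abs_def] comp_def)
  have h_mem: "h x \<in> carrier N" if "x \<in> carrier M" for x using hb that by (rule bij_betwE[rule_format])
  have gh: "g (h x) = f x" if "x \<in> carrier M" for x
    unfolding h_def using fb gb that by (metis bij_betwE bij_betw_inv_into_right)
  have g_inj: "x = y" if "x \<in> carrier N" "y \<in> carrier N" "g x = g y" for x y
    using gb that by (meson bij_betw_imp_inj_on inj_onD)
  have "h \<in> mod_hom S M N"
    unfolding mod_hom_def
  proof (intro CollectI conjI ballI)
    show "h \<in> carrier M \<rightarrow> carrier N" using h_mem by blast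
    show "h (x \<oplus>\<^bsub>M\<^esub> y) = h x \<oplus>\<^bsub>N\<^esub> h y" if "x \<in> carrier M" "y \<in> carrier M" for x y
      using that h_mem f g by (intro g_inj) (simp_all add: gh core_iso_def)
    show "h (s \<odot>\<^bsub>M\<^esub> x) = s \<odot>\<^bsub>N\<^esub> h x" if s: "s \<in> carrier S" and x: "x \<in> carrier M" for s x
    proof (rule g_inj)
      have "fps_act sc (fps_X ^ 5) (g (h (s \<odot>\<^bsub>M\<^esub> x))) = fps_act sc (fps_X ^ 5 * s) (g (h x))"
        using M.core_linear_smult[OF f_core s x refl] s x by (simp add: gh)
      also have "\<dots> = fps_act sc (fps_X ^ 5) (g (s \<odot>\<^bsub>N\<^esub> h x))"
        using N.core_linear_smult[OF g_core s h_mem[OF x] refl] by simp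
      finally show "g (h (s \<odot>\<^bsub>M\<^esub> x)) = g (s \<odot>\<^bsub>N\<^esub> h x)"
        by (rule fps_act_X5_inj[OF T.vector_space_axioms])
    qed (use s x h_mem in auto)
  qed
  with hb show ?thesis by (auto simp: mod_iso_def)
qed

theorem finite_CM_type_cusp:
  fixes S :: "'k::field fps ring"
  assumes H: "nat_submonoid H" "\<And>n. n \<noteq> 1 \<Longrightarrow> n \<noteq> 2 \<Longrightarrow> n \<noteq> 4 \<Longrightarrow> n \<in> H" and S: "S = semigroup_ring H"
  shows "finite_CM_type S"
proof -
  interpret semigroup_ring_conductor H 5 S
    by unfold_locales (use H S in auto)
  define good where "good M \<longleftrightarrow> maximal_CM_module S M \<and> indecomposable_module S M"
    for M :: "('k fps, 'k fps mod_elt) module"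
  define rep where "rep M T \<longleftrightarrow> (\<exists>\<psi>. core_iso scale3 M (fst T) (snd T) \<psi>)"
    for M :: "('k fps, 'k fps mod_elt) module" and T
  have cusp: "cusp_module H S M" if "good M" for M
  proof -
    have "Module.module S M" "torsion_free S M"
      using that maximal_CM_torsion_free[of M]
      by (auto simp: good_def maximal_CM_module_def fin_gen_module_def)
    then show ?thesis
      by (intro cusp_module.intro cusp_module_axioms.intro semigroup_ring_conductor_axioms H(2))
  qed
  \<comment> \<open>For a model that is not realised over \<open>S\<close> the choice is an
    arbitrary module; an extra member of the finite set does no harm.\<close>
  define N where "N T = (SOME M. good M \<and> rep M T)" for T
  have "\<exists>N'\<in>N ` models. mod_iso S M N'" if M: "good M" for M
  proof -
    have fg: "fin_gen_module S M" "indecomposable_module S M" using M by (auto simp: good_def maximal_CM_module_def)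
    obtain V \<Gamma> and f :: "'k fps mod_elt \<Rightarrow> nat \<Rightarrow> 'k fps mod_elt \<Rightarrow> 'k"
      where "triple_space fun_scale V \<Gamma>" "core_iso fun_scale M V \<Gamma> f"
      using exists_core_iso[OF cusp[OF M] fg(1)] by blast
    from bexE[OF model_core_iso[OF cusp[OF M] fg(2) this]] obtain T where
      T: "T \<in> models" "case T of (V', \<Gamma>') \<Rightarrow> \<exists>\<psi>. core_iso scale3 M V' \<Gamma>' \<psi>" by metis
    have rT: "rep M T" unfolding rep_def using T(2) by (cases T) simp
    have N: "good (N T) \<and> rep (N T) T" unfolding N_def by (rule someI[of _ M]) (use M rT in blast)
    obtain f g where f: "core_iso scale3 M (fst T) (snd T) f" and g: "core_iso scale3 (N T) (fst T) (snd T) g"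
      using rT N unfolding rep_def by blast
    have "mod_iso S M (N T)"
      by (rule core_iso_mod_iso[OF cusp[OF M] cusp[OF conjunct1[OF N]] f g triple_space_models]) (use T(1) in simp)
    then show ?thesis using T(1) by blast
  qed
  moreover have "finite (N ` models)" by (simp add: models_def)
  ultimately show ?thesis unfolding finite_CM_type_def good_def by blast
qed

section \<open>Families of modules of rank one\<close>

lemma mod_iso_sym:
  assumes "Module.module R M" "mod_iso R M N"
  shows "mod_iso R N M"
proof -
  interpret M: Module.module R M by fact
  obtain f where f: "f \<in> mod_hom R M N" "bij_betw f (carrier M) (carrier N)"
    using assms(2) by (auto simp: mod_iso_def)
  define g where "g = inv_into (carrier M) f"
  have g: "bij_betw g (carrier N) (carrier M)" using f(2) by (simp add: g_def bij_betw_inv_into)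
  have gf: "g (f x) = x" if "x \<in> carrier M" for x
    using f(2) that by (simp add: g_def bij_betw_inv_into_left)
  have N: "\<exists>a\<in>carrier M. x = f a" if "x \<in> carrier N" for x
    using f(2) that unfolding bij_betw_def by blast
  have "g \<in> mod_hom R N M"
    unfolding mod_hom_def
  proof (intro CollectI conjI ballI)
    show "g \<in> carrier N \<rightarrow> carrier M" using g by (auto simp: bij_betw_def)
    show "g (x \<oplus>\<^bsub>N\<^esub> y) = g x \<oplus>\<^bsub>M\<^esub> g y" if xy: "x \<in> carrier N" "y \<in> carrier N" for x y
    proof -
      obtain a b where ab: "a \<in> carrier M" "x = f a" "b \<in> carrier M" "y = f b"
        using N[OF xy(1)] N[OF xy(2)] by blast
      have "x \<oplus>\<^bsub>N\<^esub> y = f (a \<oplus>\<^bsub>M\<^esub> b)" using f(1) ab by (simp add: mod_hom_def)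
      then show ?thesis using ab gf by simp
    qed
    show "g (r \<odot>\<^bsub>N\<^esub> x) = r \<odot>\<^bsub>M\<^esub> g x" if r: "r \<in> carrier R" and x: "x \<in> carrier N" for r x
    proof -
      obtain a where a: "a \<in> carrier M" "x = f a" using N[OF x] by blast
      have "r \<odot>\<^bsub>N\<^esub> x = f (r \<odot>\<^bsub>M\<^esub> a)" using f(1) a r by (simp add: mod_hom_def)
      then show ?thesis using a r gf by simp
    qed
  qed
  then show ?thesis using g by (auto simp: mod_iso_def)
qed

lemma mod_iso_trans:
  assumes "mod_iso R L M" "mod_iso R M N"
  shows "mod_iso R L N"
proof -
  obtain f g where f: "f \<in> mod_hom R L M" "bij_betw f (carrier L) (carrier M)"
    and g: "g \<in> mod_hom R M N" "bij_betw g (carrier M) (carrier N)"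
    using assms by (auto simp: mod_iso_def)
  have "g \<circ> f \<in> mod_hom R L N" using f(1) g(1) by (auto simp: mod_hom_def Pi_def)
  then show ?thesis using bij_betw_trans[OF f(2) g(2)] by (auto simp: mod_iso_def)
qed

text \<open>The modules in the infinite families consist of power series, whereas
  \<open>finite_CM_type\<close> speaks of modules with elements in \<open>mod_elt\<close>. Hence
  every property involved has to be carried along an isomorphism.\<close>

locale module_iso = M: Module.module R M + N: Module.module R N
  for R :: "('r, 'x) ring_scheme" and M :: "('r, 'a) module" and N :: "('r, 'b) module" +
  fixes f :: "'a \<Rightarrow> 'b"
  assumes hom: "f \<in> mod_hom R M N" and bij: "bij_betw f (carrier M) (carrier N)"
begin

lemma mem: "x \<in> carrier M \<Longrightarrow> f x \<in> carrier N"
  and add: "x \<in> carrier M \<Longrightarrow> y \<in> carrier M \<Longrightarrow> f (x \<oplus>\<^bsub>M\<^esub> y) = f x \<oplus>\<^bsub>N\<^esub> f y"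
  and smult: "r \<in> carrier R \<Longrightarrow> x \<in> carrier M \<Longrightarrow> f (r \<odot>\<^bsub>M\<^esub> x) = r \<odot>\<^bsub>N\<^esub> f x"
  using hom by (auto simp: mod_hom_def)

lemma inj: "x \<in> carrier M \<Longrightarrow> y \<in> carrier M \<Longrightarrow> f x = f y \<longleftrightarrow> x = y"
  using bij by (meson bij_betw_imp_inj_on inj_on_eq_iff)

lemma img: "f ` carrier M = carrier N"
  using bij by (simp add: bij_betw_def)

lemma f_zero: "f \<zero>\<^bsub>M\<^esub> = \<zero>\<^bsub>N\<^esub>"
  using add[of "\<zero>\<^bsub>M\<^esub>" "\<zero>\<^bsub>M\<^esub>"] mem[of "\<zero>\<^bsub>M\<^esub>"] by simp

lemma zero_iff: "x \<in> carrier M \<Longrightarrow> f x = \<zero>\<^bsub>N\<^esub> \<longleftrightarrow> x = \<zero>\<^bsub>M\<^esub>"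
  using inj[of x "\<zero>\<^bsub>M\<^esub>"] f_zero by simp

definition pre :: "'b set \<Rightarrow> 'a set" where
  "pre A = {x \<in> carrier M. f x \<in> A}"

lemma submodule_pre:
  assumes "submodule A R N"
  shows "submodule (pre A) R M"
proof (rule M.submoduleI)
  note A = N.submoduleE[OF assms]
  have z: "\<zero>\<^bsub>N\<^esub> \<in> A" using A(2-5) N.smult_l_null A(1)
    by (metis (no_types, lifting) M.R.zero_closed all_not_in_conv subsetD)
  have smul: "r \<odot>\<^bsub>M\<^esub> a \<in> pre A" if "r \<in> carrier R" "a \<in> pre A" for r a
    using that A(4) by (simp add: pre_def smult)
  show "\<zero>\<^bsub>M\<^esub> \<in> pre A" using z by (simp add: pre_def f_zero)
  show "a \<oplus>\<^bsub>M\<^esub> b \<in> pre A" if "a \<in> pre A" "b \<in> pre A" for a b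
    using that A(5) by (simp add: pre_def add)
  show "r \<odot>\<^bsub>M\<^esub> a \<in> pre A" if "r \<in> carrier R" "a \<in> pre A" for r a by (rule smul[OF that])
  show "\<ominus>\<^bsub>M\<^esub> a \<in> pre A" if "a \<in> pre A" for a
    using smul[of "\<ominus>\<^bsub>R\<^esub> \<one>\<^bsub>R\<^esub>" a] that by (simp add: pre_def M.smult_l_minus)
qed (auto simp: pre_def)

lemma img_pre: "A \<subseteq> carrier N \<Longrightarrow> f ` pre A = A"
  using img by (auto simp: pre_def)

lemma fin_gen:
  assumes "fin_gen_module R M"
  shows "fin_gen_module R N"
proof -
  from assms obtain A where A: "A \<subseteq> carrier M" "finite A"
    "\<And>L. submodule L R M \<Longrightarrow> A \<subseteq> L \<Longrightarrow> L = carrier M"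
    unfolding fin_gen_module_def by metis
  have "L = carrier N" if L: "submodule L R N" "f ` A \<subseteq> L" for L
  proof -
    have "A \<subseteq> pre L" using A(1) L(2) by (auto simp: pre_def)
    then have "pre L = carrier M" by (rule A(3)[OF submodule_pre[OF L(1)]])
    then show ?thesis using img_pre[of L] img N.submoduleE(1)[OF L(1)] by simp
  qed
  moreover have "f ` A \<subseteq> carrier N" using A(1) mem by auto
  ultimately show ?thesis
    unfolding fin_gen_module_def using A(2) N.module_axioms by blast
qed

lemma set_add_pre:
  assumes A: "A \<subseteq> carrier N" "B \<subseteq> carrier N"
  shows "pre A <+>\<^bsub>M\<^esub> pre B = pre (A <+>\<^bsub>N\<^esub> B)"
proof
  show "pre A <+>\<^bsub>M\<^esub> pre B \<subseteq> pre (A <+>\<^bsub>N\<^esub> B)"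
    by (auto simp: pre_def set_add_def' add) blast
  show "pre (A <+>\<^bsub>N\<^esub> B) \<subseteq> pre A <+>\<^bsub>M\<^esub> pre B"
  proof
    fix x assume "x \<in> pre (A <+>\<^bsub>N\<^esub> B)"
    then obtain a b where ab: "x \<in> carrier M" "a \<in> A" "b \<in> B" "f x = a \<oplus>\<^bsub>N\<^esub> b"
      by (auto simp: pre_def set_add_def')
    have "a \<in> f ` pre A" "b \<in> f ` pre B" using ab(2,3) img_pre A by auto
    then obtain u v where uv: "u \<in> pre A" "v \<in> pre B" "a = f u" "b = f v" by blast
    then have uv': "u \<in> carrier M" "v \<in> carrier M" by (auto simp: pre_def)
    have "f x = f (u \<oplus>\<^bsub>M\<^esub> v)" using ab(4) uv uv' by (simp add: add)
    then have "x = u \<oplus>\<^bsub>M\<^esub> v" using inj ab(1) uv' by simp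
    then show "x \<in> pre A <+>\<^bsub>M\<^esub> pre B" using uv by (auto simp: set_add_def')
  qed
qed

lemma zero_set: "A \<subseteq> carrier N \<Longrightarrow> pre A = {\<zero>\<^bsub>M\<^esub>} \<Longrightarrow> A = {\<zero>\<^bsub>N\<^esub>}"
  using img_pre[of A] f_zero by auto

lemma carrier_zero: "carrier M = {\<zero>\<^bsub>M\<^esub>} \<longleftrightarrow> carrier N = {\<zero>\<^bsub>N\<^esub>}"
proof
  assume "carrier M = {\<zero>\<^bsub>M\<^esub>}"
  then show "carrier N = {\<zero>\<^bsub>N\<^esub>}" using img f_zero by auto
next
  assume N0: "carrier N = {\<zero>\<^bsub>N\<^esub>}"
  have "x = \<zero>\<^bsub>M\<^esub>" if "x \<in> carrier M" for x using zero_iff[OF that] mem[OF that] N0 by simp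
  then show "carrier M = {\<zero>\<^bsub>M\<^esub>}" by blast
qed

lemma indecomposable:
  assumes "indecomposable_module R M"
  shows "indecomposable_module R N"
  unfolding indecomposable_module_def
proof (intro conjI allI impI)
  show "Module.module R N" by (rule N.module_axioms)
  show "carrier N \<noteq> {\<zero>\<^bsub>N\<^esub>}" using assms carrier_zero by (simp add: indecomposable_module_def)
  fix A B
  assume AB: "submodule A R N \<and> submodule B R N \<and> A <+>\<^bsub>N\<^esub> B = carrier N \<and> A \<inter> B = {\<zero>\<^bsub>N\<^esub>}"
  have sub: "A \<subseteq> carrier N" "B \<subseteq> carrier N" using AB N.submoduleE(1) by blast+
  have 1: "pre A <+>\<^bsub>M\<^esub> pre B = carrier M"
    using set_add_pre[OF sub] AB mem by (auto simp: pre_def)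
  have 2: "pre A \<inter> pre B = {\<zero>\<^bsub>M\<^esub>}"
  proof -
    have "pre A \<inter> pre B = {x \<in> carrier M. f x \<in> {\<zero>\<^bsub>N\<^esub>}}" using AB by (auto simp: pre_def)
    also have "\<dots> = {\<zero>\<^bsub>M\<^esub>}" using zero_iff by auto
    finally show ?thesis .
  qed
  have "pre A = {\<zero>\<^bsub>M\<^esub>} \<or> pre B = {\<zero>\<^bsub>M\<^esub>}"
    using assms submodule_pre AB 1 2 unfolding indecomposable_module_def by blast
  then show "A = {\<zero>\<^bsub>N\<^esub>} \<or> B = {\<zero>\<^bsub>N\<^esub>}" using zero_set sub by blast
qed

lemma seq_smult_subset: "set xs \<subseteq> carrier R \<Longrightarrow> seq_smult M xs \<subseteq> carrier M"
  by (induction xs) (auto simp: set_add_def')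

lemma seq_smult_image: "set xs \<subseteq> carrier R \<Longrightarrow> seq_smult N xs = f ` seq_smult M xs"
proof (induction xs)
  case Nil
  then show ?case by (simp add: f_zero)
next
  case (Cons x xs)
  have IH: "seq_smult N xs = f ` seq_smult M xs" and x: "x \<in> carrier R" using Cons by auto
  have sub: "v \<in> carrier M" if "v \<in> seq_smult M xs" for v
    using seq_smult_subset[of xs] Cons.prems that by auto
  show ?case
  proof
    show "seq_smult N (x # xs) \<subseteq> f ` seq_smult M (x # xs)"
    proof
      fix w assume "w \<in> seq_smult N (x # xs)"
      then obtain u v where uv: "u \<in> carrier N" "v \<in> seq_smult M xs" "w = x \<odot>\<^bsub>N\<^esub> u \<oplus>\<^bsub>N\<^esub> f v"
        unfolding seq_smult.simps IH by (auto simp: set_add_def')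
      obtain u' where u': "u' \<in> carrier M" "u = f u'" using uv(1) img by blast
      have "w = f (x \<odot>\<^bsub>M\<^esub> u' \<oplus>\<^bsub>M\<^esub> v)" using uv u' x sub by (simp add: add smult)
      moreover have "x \<odot>\<^bsub>M\<^esub> u' \<oplus>\<^bsub>M\<^esub> v \<in> seq_smult M (x # xs)"
        using u'(1) uv(2) by (auto simp: set_add_def')
      ultimately show "w \<in> f ` seq_smult M (x # xs)" by blast
    qed
    show "f ` seq_smult M (x # xs) \<subseteq> seq_smult N (x # xs)"
    proof
      fix w assume "w \<in> f ` seq_smult M (x # xs)"
      then obtain u v where uv: "u \<in> carrier M" "v \<in> seq_smult M xs" "w = f (x \<odot>\<^bsub>M\<^esub> u \<oplus>\<^bsub>M\<^esub> v)"
        by (auto simp: set_add_def')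
      then have "w = x \<odot>\<^bsub>N\<^esub> f u \<oplus>\<^bsub>N\<^esub> f v" using x sub by (simp add: add smult)
      moreover have "f v \<in> seq_smult N xs" using IH uv(2) by simp
      ultimately show "w \<in> seq_smult N (x # xs)" using mem[OF uv(1)] by (auto simp: set_add_def')
    qed
  qed
qed

lemma regular_sequence:
  assumes "regular_sequence R M xs"
  shows "regular_sequence R N xs"
proof -
  have xs: "set xs \<subseteq> carrier R" and ne: "seq_smult M xs \<noteq> carrier M"
    and reg: "\<And>i v. i < length xs \<Longrightarrow> v \<in> carrier M \<Longrightarrow> (xs ! i) \<odot>\<^bsub>M\<^esub> v \<in> seq_smult M (take i xs) \<Longrightarrow>
      v \<in> seq_smult M (take i xs)"
    using assms unfolding regular_sequence_def by auto
  have tk: "set (take i xs) \<subseteq> carrier R" for i using xs set_take_subset[of i xs] by blast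
  have img_mem: "f v \<in> f ` A \<longleftrightarrow> v \<in> A" if "A \<subseteq> carrier M" "v \<in> carrier M" for A v
    using that inj by auto
  show ?thesis
    unfolding regular_sequence_def
  proof (intro conjI allI ballI impI)
    show "set xs \<subseteq> carrier R" by (rule xs)
    fix i w assume i: "i < length xs" and w: "w \<in> carrier N"
      and h: "(xs ! i) \<odot>\<^bsub>N\<^esub> w \<in> seq_smult N (take i xs)"
    obtain v where v: "v \<in> carrier M" "w = f v" using w img by blast
    have xi: "xs ! i \<in> carrier R" using i xs nth_mem by blast
    have "f ((xs ! i) \<odot>\<^bsub>M\<^esub> v) \<in> f ` seq_smult M (take i xs)"
      using h v xi seq_smult_image[OF tk] by (simp add: smult)
    then have "(xs ! i) \<odot>\<^bsub>M\<^esub> v \<in> seq_smult M (take i xs)"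
      using img_mem[OF seq_smult_subset[OF tk]] v xi by simp
    then have "v \<in> seq_smult M (take i xs)" by (rule reg[OF i v(1)])
    then show "w \<in> seq_smult N (take i xs)" using v seq_smult_image[OF tk] by simp
  next
    show "seq_smult N xs \<noteq> carrier N"
    proof
      assume "seq_smult N xs = carrier N"
      then have "f v \<in> f ` seq_smult M xs" if "v \<in> carrier M" for v
        using seq_smult_image[OF xs] mem[OF that] by simp
      then have "carrier M \<subseteq> seq_smult M xs" using img_mem[OF seq_smult_subset[OF xs]] by blast
      then show False using ne seq_smult_subset[OF xs] by blast
    qed
  qed
qed

end

lemma mod_isoE:
  assumes "mod_iso R M N" "Module.module R M" "Module.module R N"
  obtains f where "module_iso R M N f"
  using assms unfolding mod_iso_def module_iso_def module_iso_axioms_def by blast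

lemma depth_mod_iso:
  assumes "mod_iso R M N" "Module.module R M" "Module.module R N"
  shows "depth R N = depth R M"
proof -
  obtain f where f: "module_iso R M N f" using assms by (rule mod_isoE)
  obtain g where g: "module_iso R N M g" using mod_iso_sym[OF assms(2,1)] assms by (rule_tac mod_isoE)
  have "regular_sequence R N xs \<longleftrightarrow> regular_sequence R M xs" for xs
    using module_iso.regular_sequence[OF f] module_iso.regular_sequence[OF g] by blast
  then show ?thesis by (simp add: depth_def)
qed

lemma maximal_CM_mod_iso:
  assumes iso: "mod_iso R M N" and N: "Module.module R N" and "maximal_CM_module R M"
  shows "maximal_CM_module R N"
proof -
  have M: "Module.module R M" using assms(3) by (simp add: maximal_CM_module_def fin_gen_module_def)
  obtain f where f: "module_iso R M N f" using iso M N by (rule mod_isoE)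
  show ?thesis
    using assms(3) module_iso.fin_gen[OF f] module_iso.carrier_zero[OF f] depth_mod_iso[OF iso M N]
    by (auto simp: maximal_CM_module_def)
qed

section \<open>Submodules of \<open>k[[t]]\<close> as maximal Cohen-Macaulay modules\<close>

context semigroup_ring_conductor
begin

definition frac_module :: "'k fps set \<Rightarrow> ('k fps, 'k fps) module" where
  "frac_module D = \<lparr>carrier = D, mult = (*), one = 1, zero = 0, add = (+), smult = (*)\<rparr>"

lemma frac_module_simps [simp]:
  "carrier (frac_module D) = D" "zero (frac_module D) = 0" "add (frac_module D) = (+)" "smult (frac_module D) = (*)"
  by (simp_all add: frac_module_def)

lemma sr_closedD:
  assumes "sr_closed D"
  shows "0 \<in> D" "x \<in> D \<Longrightarrow> y \<in> D \<Longrightarrow> x + y \<in> D" "s \<in> carrier S \<Longrightarrow> x \<in> D \<Longrightarrow> s * x \<in> D"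
  using assms by (auto simp: sr_closed_def)

lemma module_frac:
  assumes D: "sr_closed D"
  shows "Module.module S (frac_module D)"
proof (rule moduleI)
  show "cring S" by (rule cring_sr)
  show "abelian_group (frac_module D)"
  proof (rule abelian_groupI)
    show "\<exists>y\<in>carrier (frac_module D). y \<oplus>\<^bsub>frac_module D\<^esub> x = \<zero>\<^bsub>frac_module D\<^esub>" if "x \<in> carrier (frac_module D)" for x
      using that sr_closed_neg[OF D, of x] by (intro bexI[of _ "- x"]) simp_all
  qed (use sr_closedD[OF D] in \<open>simp_all add: add_ac\<close>)
qed (use sr_closedD[OF D] in \<open>simp_all add: sr_simps(2,4,5) algebra_simps\<close>)

lemma submodule_frac:
  assumes D: "sr_closed D"
  shows "submodule A S (frac_module D) \<longleftrightarrow> sr_closed A \<and> A \<subseteq> D"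
proof
  interpret M: Module.module S "frac_module D" by (rule module_frac[OF D])
  assume A: "submodule A S (frac_module D)"
  note E = M.submoduleE[OF A]
  obtain a where "a \<in> A" using E(2) by blast
  moreover have "0 \<in> carrier S" using S.zero_closed by (simp add: sr_simps(3))
  ultimately have "0 * a \<in> A" using E(4)[of 0 a] by simp
  then show "sr_closed A \<and> A \<subseteq> D" using E(1,4,5) by (simp add: sr_closed_def)
next
  interpret M: Module.module S "frac_module D" by (rule module_frac[OF D])
  assume A: "sr_closed A \<and> A \<subseteq> D"
  show "submodule A S (frac_module D)"
  proof (rule M.submoduleI)
    show "\<ominus>\<^bsub>frac_module D\<^esub> a \<in> A" if a: "a \<in> A" for a
    proof -
      have "\<ominus>\<^bsub>frac_module D\<^esub> a = - a"
        by (rule M.M.minus_equality) (use A a sr_closed_neg[OF D, of a] in auto)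
      then show ?thesis using sr_closed_neg[of A a] A a by simp
    qed
  qed (use A sr_closedD[of A] in auto)
qed

lemma fin_gen_frac:
  assumes D: "sr_closed D"
  shows "fin_gen_module S (frac_module D)"
proof -
  obtain A where A: "A \<subseteq> D" "finite A" "\<And>N. sr_closed N \<Longrightarrow> A \<subseteq> N \<Longrightarrow> D \<subseteq> N"
    using sr_closed_fin_gen[OF D] by blast
  have "N = D" if "submodule N S (frac_module D)" "A \<subseteq> N" for N
    using that A(3)[of N] by (auto simp: submodule_frac[OF D])
  then show ?thesis
    unfolding fin_gen_module_def using module_frac[OF D] A(1,2) by auto
qed

text \<open>Any two nonzero submodules of \<open>k[[t]]\<close> share a power of \<open>t\<close>,
  by \<open>sr_closed_tail\<close>.\<close>

lemma indecomposable_frac: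
  assumes D: "sr_closed D" "D \<noteq> {0}"
  shows "indecomposable_module S (frac_module D)"
  unfolding indecomposable_module_def
proof (intro conjI allI impI)
  show "Module.module S (frac_module D)" by (rule module_frac[OF D(1)])
  show "carrier (frac_module D) \<noteq> {\<zero>\<^bsub>frac_module D\<^esub>}" using D(2) by simp
  fix A B
  assume AB: "submodule A S (frac_module D) \<and> submodule B S (frac_module D) \<and> A <+>\<^bsub>frac_module D\<^esub> B = carrier (frac_module D) \<and>
    A \<inter> B = {\<zero>\<^bsub>frac_module D\<^esub>}"
  then have A: "sr_closed A" and B: "sr_closed B" by (auto simp: submodule_frac[OF D(1)])
  show "A = {\<zero>\<^bsub>frac_module D\<^esub>} \<or> B = {\<zero>\<^bsub>frac_module D\<^esub>}"
  proof (rule ccontr)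
    assume no: "\<not> ?thesis"
    have "0 \<in> A" "0 \<in> B" using sr_closedD(1) A B by auto
    then obtain a b where ab: "a \<in> A" "a \<noteq> 0" "b \<in> B" "b \<noteq> 0" using no by auto
    define n where "n = subdegree a + subdegree b + c"
    have "fps_X ^ n * 1 \<in> A \<inter> B"
      using sr_closed_tail[OF A ab(1,2), of n 1] sr_closed_tail[OF B ab(3,4), of n 1] by (simp add: n_def)
    then show False using AB by simp
  qed
qed

lemma set_add_frac: "a \<in> A \<Longrightarrow> b \<in> B \<Longrightarrow> a + b \<in> A <+>\<^bsub>frac_module D\<^esub> B"
  by (auto simp: set_add_def')

lemma seq_smult_frac: "seq_smult (frac_module D) [x] = (\<lambda>v. x * v) ` D"
  by (auto simp: set_add_def')

text \<open>A power of \<open>t\<close> gives a regular sequence of length one. If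
  \<open>x, y\<close> began a longer one, some \<open>y^n D\<close> would lie in \<open>x D\<close>,
  as all series of large order do; regularity of \<open>y\<close> modulo \<open>x D\<close> would
  strip off the powers of \<open>y\<close> and yield \<open>D = x D\<close>, which the definition of
  a regular sequence excludes.\<close>

lemma depth_frac:
  assumes D: "sr_closed D" "D \<noteq> {0}"
  shows "depth S (frac_module D) = 1"
proof -
  interpret M: Module.module S "frac_module D" by (rule module_frac[OF D(1)])
  let ?A = "{enat (length xs) | xs. set xs \<subseteq> max_ideal S \<and> regular_sequence S (frac_module D) xs}"
  obtain p where p: "p \<in> D" "p \<noteq> 0" using D sr_closedD(1)[OF D(1)] by auto
  let ?x = "fps_X ^ Suc c :: 'k fps"
  have x: "?x \<in> sr_max" using sr_X_power[of "Suc c"] c[of "Suc c"] by (simp add: sr_max_def)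
  then have xS: "?x \<in> carrier S" by (simp add: sr_max_def)
  have "regular_sequence S (frac_module D) [?x]"
    unfolding regular_sequence_def
  proof (intro conjI allI ballI impI)
    show "set [?x] \<subseteq> carrier S" using xS by simp
    show "seq_smult (frac_module D) [?x] \<noteq> carrier (frac_module D)"
    proof
      assume eq: "seq_smult (frac_module D) [?x] = carrier (frac_module D)"
      \<comment> \<open>An element of least order in \<open>D\<close> is not divisible by
        \<open>t^(c + 1)\<close> within \<open>D\<close>.\<close>
      define q where "q = arg_min subdegree (\<lambda>q. q \<in> D \<and> q \<noteq> 0)"
      have q: "q \<in> D \<and> q \<noteq> 0" unfolding q_def by (rule arg_min_natI[of _ p]) (use p in simp)
      have min: "subdegree q \<le> subdegree r" if "r \<in> D" "r \<noteq> 0" for r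
        unfolding q_def by (rule arg_min_nat_le) (use that in simp)
      obtain r where r: "r \<in> D" "q = ?x * r" using eq q unfolding seq_smult_frac by auto
      then have "r \<noteq> 0" using q by auto
      then have "subdegree q = Suc c + subdegree r" using r(2) by (simp add: subdegree_mult fps_X_power_subdegree del: power_Suc)
      then show False using min[OF r(1) \<open>r \<noteq> 0\<close>] by simp
    qed
  next
    fix i v assume "i < length [?x]" "v \<in> carrier (frac_module D)" "[?x] ! i \<odot>\<^bsub>frac_module D\<^esub> v \<in> seq_smult (frac_module D) (take i [?x])"
    then show "v \<in> seq_smult (frac_module D) (take i [?x])" by simp
  qed
  then have "enat 1 \<in> ?A" using x by (auto simp: max_ideal_sr intro!: exI[of _ "[?x]"])
  moreover have "a \<le> enat 1" if aA: "a \<in> ?A" for a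
  proof -
    obtain xs where xs: "a = enat (length xs)" "set xs \<subseteq> sr_max" "regular_sequence S (frac_module D) xs"
      using aA by (auto simp: max_ideal_sr)
    have "length xs \<le> 1"
    proof (rule ccontr)
      assume "\<not> length xs \<le> 1"
      then obtain x y zs where xyz: "xs = x # y # zs" by (metis One_nat_def le_0_eq length_0_conv length_Cons linorder_le_less_linear neq_Nil_conv not_less_eq_eq nat_le_linear)
      have xy: "x \<in> sr_max" "y \<in> sr_max" using xs(2) xyz by auto
      have regx: "v = 0" if "v \<in> D" "x * v = 0" for v
        using xs(3) that unfolding regular_sequence_def xyz by fastforce
      have regy: "v \<in> (\<lambda>v. x * v) ` D" if "v \<in> D" "y * v \<in> (\<lambda>v. x * v) ` D" for v
        using xs(3) that seq_smult_frac[of D x] unfolding regular_sequence_def xyz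
        by (metis (no_types, lifting) One_nat_def Suc_less_eq frac_module_simps(1,4) length_Cons nth_Cons_0 nth_Cons_Suc take0 take_Suc_Cons zero_less_Suc)
      have ne: "seq_smult (frac_module D) xs \<noteq> D" using xs(3) by (simp add: regular_sequence_def)
      have "x \<noteq> 0" using regx[OF p(1)] p(2) by auto
      have xc: "sr_closed ((\<lambda>v. x * v) ` D)"
        unfolding sr_closed_def
      proof (intro conjI ballI)
        show "0 \<in> (\<lambda>v. x * v) ` D" using sr_closedD(1)[OF D(1)] by (auto intro!: image_eqI[of _ _ 0])
        show "a + b \<in> (\<lambda>v. x * v) ` D" if "a \<in> (\<lambda>v. x * v) ` D" "b \<in> (\<lambda>v. x * v) ` D" for a b
          using that sr_closedD(2)[OF D(1)] by (auto simp: distrib_left[symmetric])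
        show "s * a \<in> (\<lambda>v. x * v) ` D" if s: "s \<in> carrier S" and a: "a \<in> (\<lambda>v. x * v) ` D" for s a
        proof -
          obtain v where v: "v \<in> D" "a = x * v" using a by blast
          show ?thesis using sr_closedD(3)[OF D(1) s v(1)] v(2) by (auto simp: mult.left_commute)
        qed
      qed
      have y0: "fps_nth y 0 = 0" "y \<in> carrier S" using xy(2) by (auto simp: sr_max_def)
      have "D \<subseteq> (\<lambda>v. x * v) ` D"
      proof
        fix v assume v: "v \<in> D"
        let ?n = "subdegree (x * p) + c"
        have yn: "y ^ ?n = fps_X ^ ?n * fps_shift ?n (y ^ ?n)"
          by (rule fps_ext) (simp add: fps_X_power_mult_nth fps_nth_power_neq_0[OF y0(1)])
        have "fps_X ^ ?n * (fps_shift ?n (y ^ ?n) * v) \<in> (\<lambda>v. x * v) ` D"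
          by (rule sr_closed_tail[OF xc, of "x * p"]) (use p \<open>x \<noteq> 0\<close> in auto)
        then have "y ^ ?n * v \<in> (\<lambda>v. x * v) ` D" by (subst yn) (simp only: mult.assoc)
        moreover have "v \<in> (\<lambda>v. x * v) ` D" if "y ^ k * v \<in> (\<lambda>v. x * v) ` D" for k
          using that
        proof (induction k)
          case (Suc k)
          have "y ^ k * v \<in> D" by (induction k) (use v sr_closedD(3)[OF D(1) y0(2)] in \<open>auto simp: mult.assoc\<close>)
          then show ?case using regy[of "y ^ k * v"] Suc by (simp add: mult.assoc)
        qed simp
        ultimately show "v \<in> (\<lambda>v. x * v) ` D" by blast
      qed
      moreover have z: "0 \<in> seq_smult (frac_module D) ys" if "set ys \<subseteq> carrier S" for ys
        using that
      proof (induction ys)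
        case (Cons a ys)
        then have "0 \<in> seq_smult (frac_module D) ys" by simp
        moreover have "0 \<in> (\<lambda>v. a * v) ` D" using sr_closedD(1)[OF D(1)] by (auto intro!: image_eqI[of _ _ 0])
        ultimately show ?case using set_add_frac[of 0 "(\<lambda>v. a * v) ` D" 0 _ D] by simp
      qed simp
      have sS: "set xs \<subseteq> carrier S" using xs(2) by (auto simp: sr_max_def)
      have "seq_smult (frac_module D) xs \<subseteq> D"
        using sS
      proof (induction xs)
        case (Cons a ys)
        then show ?case using sr_closedD(2,3)[OF D(1)] by (fastforce simp: set_add_def')
      qed (use sr_closedD(1)[OF D(1)] in simp)
      moreover have "(\<lambda>v. x * v) ` D \<subseteq> seq_smult (frac_module D) xs"
      proof
        fix w assume w: "w \<in> (\<lambda>v. x * v) ` D"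
        have "0 \<in> seq_smult (frac_module D) (y # zs)" by (rule z) (use sS xyz in simp)
        from set_add_frac[OF w this, of D] show "w \<in> seq_smult (frac_module D) xs"
          unfolding xyz seq_smult.simps(2)[of _ x] by (simp del: seq_smult.simps)
      qed
      ultimately show False using ne by blast
    qed
    then show ?thesis using xs(1) by simp
  qed
  ultimately have "Sup ?A = enat 1" by (intro antisym Sup_least Sup_upper) auto
  then show ?thesis by (simp add: depth_def one_enat_def)
qed

text \<open>A homomorphism between submodules of \<open>k[[t]]\<close> is multiplication by a
  series, here by \<open>h 1\<close>: compare \<open>h (t^c * f)\<close> computed with
  \<open>t^c\<close> and with \<open>t^c * f\<close> as the scalar. Since 1 is in the image,
  \<open>h 1\<close> has a nonzero constant term.\<close>

lemma mod_iso_frac: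
  assumes D: "1 \<in> D" "1 \<in> D'" and iso: "mod_iso S (frac_module D) (frac_module D')"
  obtains w where "w \<in> D'" "fps_nth w 0 \<noteq> 0" "\<And>f. f \<in> D \<Longrightarrow> w * f \<in> D'"
proof -
  obtain h where h: "h \<in> mod_hom S (frac_module D) (frac_module D')" "bij_betw h D D'"
    using iso by (auto simp: mod_iso_def)
  have h_smult: "h (s * x) = s * h x" if "s \<in> carrier S" "x \<in> D" for s x
    using h(1) that by (simp add: mod_hom_def)
  have h_mem: "h x \<in> D'" if "x \<in> D" for x using h(2) that by (rule bij_betwE[rule_format])
  have hf: "h f = h 1 * f" if f: "f \<in> D" for f
  proof -
    have "fps_X ^ c * h f = h (fps_X ^ c * f)"
      using h_smult[OF sr_X_power[OF c[OF order_refl]] f] by simp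
    also have "\<dots> = fps_X ^ c * f * h 1"
      using h_smult[OF sr_X_mult[OF order_refl] D(1), of f] by simp
    finally have "fps_X ^ c * h f = fps_X ^ c * (h 1 * f)" by (simp add: mult_ac)
    then show ?thesis by simp
  qed
  have "1 \<in> h ` D" using h(2) D(2) by (simp add: bij_betw_def)
  then obtain f where f: "f \<in> D" "1 = h f" by blast
  then have "fps_nth (h 1 * f) 0 = 1" using hf[OF f(1)] by (metis fps_one_nth)
  then have "fps_nth (h 1) 0 \<noteq> 0" by auto
  then show thesis using that[of "h 1"] h_mem D(1) hf by metis
qed

text \<open>By \<open>mod_iso_frac\<close>, \<open>noniso\<close> says that distinct members of the
  family are not isomorphic; so finitely many modules cannot represent all of them.\<close>

lemma infinite_CM_type:
  assumes inf: "infinite (UNIV :: 'i set)"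
    and D: "\<And>i :: 'i. sr_closed (D i)" "\<And>i. 1 \<in> D i"
    and noniso: "\<And>i j w. w \<in> D j \<Longrightarrow> fps_nth w 0 \<noteq> 0 \<Longrightarrow> (\<And>f. f \<in> D i \<Longrightarrow> w * f \<in> D j) \<Longrightarrow> i = j"
  shows "\<not> finite_CM_type S"
proof
  assume "finite_CM_type S"
  then obtain X :: "('k fps, 'k fps mod_elt) module set" where X: "finite X"
    "\<forall>M :: ('k fps, 'k fps mod_elt) module. maximal_CM_module S M \<and> indecomposable_module S M \<longrightarrow> (\<exists>N\<in>X. mod_iso S M N)"
    unfolding finite_CM_type_def by (elim exE conjE) (rule that, assumption+)
  have D0: "D i \<noteq> {0}" for i using D(2)[of i] by auto
  have "\<exists>N\<in>X. mod_iso S (frac_module (D i)) N" for i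
  proof -
    obtain M :: "('k fps, 'k fps mod_elt) module" where M: "Module.module S M" "mod_iso S (frac_module (D i)) M"
      using fin_gen_module_copy[OF fin_gen_frac[OF D(1)]] by blast
    obtain f where f: "module_iso S (frac_module (D i)) M f"
      using M(2) module_frac[OF D(1)] M(1) by (rule mod_isoE)
    have "maximal_CM_module S (frac_module (D i))"
      using fin_gen_frac[OF D(1)] depth_frac[OF D(1) D0] krull_dim_sr by (simp add: maximal_CM_module_def)
    then have "maximal_CM_module S M" by (rule maximal_CM_mod_iso[OF M(2,1)])
    moreover have "indecomposable_module S M"
      by (rule module_iso.indecomposable[OF f indecomposable_frac[OF D(1) D0]])
    ultimately have "\<exists>N\<in>X. mod_iso S M N" using X(2)[rule_format, of M] by simp
    then obtain N where "N \<in> X" "mod_iso S M N" by blast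
    then show ?thesis using mod_iso_trans[OF M(2)] by blast
  qed
  then obtain N where N: "\<And>i. N i \<in> X" "\<And>i. mod_iso S (frac_module (D i)) (N i)" by metis
  have "\<not> inj N"
  proof
    assume "inj N"
    moreover have "finite (range N)" using X(1) N(1) by (meson finite_subset image_subsetI)
    ultimately show False using inf by (simp add: finite_image_iff)
  qed
  then obtain i j where ij: "i \<noteq> j" "N i = N j" by (auto simp: inj_def)
  have iso: "mod_iso S (frac_module (D i)) (frac_module (D j))"
    using mod_iso_trans[OF N(2)[of i]] mod_iso_sym[OF module_frac[OF D(1)] N(2)[of j]] ij(2) by simp
  show False
  proof (rule mod_iso_frac[OF D(2) D(2) iso])
    fix w assume "w \<in> D j" "fps_nth w 0 \<noteq> 0" "\<And>f. f \<in> D i \<Longrightarrow> w * f \<in> D j"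
    then have "i = j" by (rule noniso)
    then show False using ij(1) by simp
  qed
qed

text \<open>Elements of \<open>S\<close> have no terms of degree 1, 2, 3, so they act on the
  coefficients in these degrees through the constant term, and any linear condition on them is
  preserved. The condition \<open>w 2 = 0\<close> keeps \<open>w\<close> from disturbing the ratio:
  for \<open>f = t + i * t^3\<close> one gets \<open>(w * f) 1 = w 0\<close> and
  \<open>(w * f) 3 = w 0 * i\<close>.\<close>

lemma infinite_CM_type_no_123:
  assumes "infinite (UNIV :: 'k set)" and H: "1 \<notin> H" "2 \<notin> H" "3 \<notin> H"
  shows "\<not> finite_CM_type S"
proof (rule infinite_CM_type[OF assms(1)])
  define D where "D r = {f :: 'k fps. fps_nth f 2 = 0 \<and> fps_nth f 3 = r * fps_nth f 1}" for r
  have prod: "fps_nth (s * f) 1 = fps_nth s 0 * fps_nth f 1 + fps_nth s 1 * fps_nth f 0"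
    "fps_nth (s * f) 2 = fps_nth s 0 * fps_nth f 2 + fps_nth s 1 * fps_nth f 1 + fps_nth s 2 * fps_nth f 0"
    "fps_nth (s * f) 3 = fps_nth s 0 * fps_nth f 3 + fps_nth s 1 * fps_nth f 2 + fps_nth s 2 * fps_nth f 1
      + fps_nth s 3 * fps_nth f 0" for s f :: "'k fps"
    by (simp_all add: fps_mult_nth atLeast0AtMost numeral_nat atMost_Suc algebra_simps)
  show "1 \<in> D r" for r by (simp add: D_def)
  show "sr_closed (D r)" for r
    unfolding sr_closed_def
  proof (intro conjI ballI)
    fix s x assume s: "s \<in> carrier S" and x: "x \<in> D r"
    have "fps_nth s 1 = 0" "fps_nth s 2 = 0" "fps_nth s 3 = 0"
      using s H unfolding sr_simps(1) mem_Collect_eq by blast+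
    then show "s * x \<in> D r" using x unfolding D_def mem_Collect_eq prod by simp
  qed (auto simp: D_def algebra_simps)
  fix i j :: 'k and w
  assume w: "w \<in> D j" "fps_nth w 0 \<noteq> 0" "\<And>f. f \<in> D i \<Longrightarrow> w * f \<in> D j"
  have "fps_X + fps_const i * fps_X ^ 3 \<in> D i"
    by (simp add: D_def fps_X_power_nth)
  from w(3)[OF this] show "i = j"
    using w(1,2) unfolding D_def mem_Collect_eq prod by (simp add: fps_X_power_nth)
qed

text \<open>Here \<open>t^3\<close> may be in \<open>S\<close>, so the ratio is placed in degrees 4
  and 5; these are reached by \<open>t^3\<close> only from degrees 1 and 2, where the coefficients
  vanish. The test element is \<open>t^4 + i * t^5\<close>, and \<open>w 1 = 0\<close> leaves its
  ratio unchanged.\<close>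

lemma infinite_CM_type_no_1245:
  assumes "infinite (UNIV :: 'k set)" and H: "1 \<notin> H" "2 \<notin> H" "4 \<notin> H" "5 \<notin> H"
  shows "\<not> finite_CM_type S"
proof (rule infinite_CM_type[OF assms(1)])
  define D where "D r = {f :: 'k fps. fps_nth f 1 = 0 \<and> fps_nth f 2 = 0 \<and> fps_nth f 5 = r * fps_nth f 4}" for r
  have prod: "fps_nth (s * f) 1 = fps_nth s 0 * fps_nth f 1 + fps_nth s 1 * fps_nth f 0"
    "fps_nth (s * f) 2 = fps_nth s 0 * fps_nth f 2 + fps_nth s 1 * fps_nth f 1 + fps_nth s 2 * fps_nth f 0"
    "fps_nth (s * f) 4 = fps_nth s 0 * fps_nth f 4 + fps_nth s 1 * fps_nth f 3 + fps_nth s 2 * fps_nth f 2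
      + fps_nth s 3 * fps_nth f 1 + fps_nth s 4 * fps_nth f 0"
    "fps_nth (s * f) 5 = fps_nth s 0 * fps_nth f 5 + fps_nth s 1 * fps_nth f 4 + fps_nth s 2 * fps_nth f 3
      + fps_nth s 3 * fps_nth f 2 + fps_nth s 4 * fps_nth f 1 + fps_nth s 5 * fps_nth f 0" for s f :: "'k fps"
    by (simp_all add: fps_mult_nth atLeast0AtMost numeral_nat atMost_Suc algebra_simps)
  show "1 \<in> D r" for r by (simp add: D_def)
  show "sr_closed (D r)" for r
    unfolding sr_closed_def
  proof (intro conjI ballI)
    fix s x assume s: "s \<in> carrier S" and x: "x \<in> D r"
    have "fps_nth s 1 = 0" "fps_nth s 2 = 0" "fps_nth s 4 = 0" "fps_nth s 5 = 0"
      using s H unfolding sr_simps(1) mem_Collect_eq by blast+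
    then show "s * x \<in> D r" using x unfolding D_def mem_Collect_eq prod by simp
  qed (auto simp: D_def algebra_simps)
  fix i j :: 'k and w
  assume w: "w \<in> D j" "fps_nth w 0 \<noteq> 0" "\<And>f. f \<in> D i \<Longrightarrow> w * f \<in> D j"
  have "fps_X ^ 4 + fps_const i * fps_X ^ 5 \<in> D i"
    by (simp add: D_def fps_X_power_nth)
  from w(3)[OF this] show "i = j"
    using w(1,2) unfolding D_def mem_Collect_eq prod by (simp add: fps_X_power_nth)
qed

end

section \<open>Symmetric semigroups\<close>

text \<open>Baer's criterion, by Zorn's lemma applied to the partial extensions.\<close>

lemma injective_moduleI:
  fixes R :: "('r, 'x) ring_scheme" and E :: "('r, 'e) module"
  assumes E: "Module.module R E"
    and baer: "\<And>I h. ideal I R \<Longrightarrow> (\<And>r. r \<in> I \<Longrightarrow> h r \<in> carrier E) \<Longrightarrow>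
      (\<And>r s. r \<in> I \<Longrightarrow> s \<in> I \<Longrightarrow> h (r \<oplus>\<^bsub>R\<^esub> s) = h r \<oplus>\<^bsub>E\<^esub> h s) \<Longrightarrow>
      (\<And>r s. r \<in> carrier R \<Longrightarrow> s \<in> I \<Longrightarrow> h (r \<otimes>\<^bsub>R\<^esub> s) = r \<odot>\<^bsub>E\<^esub> h s) \<Longrightarrow>
      \<exists>e\<in>carrier E. \<forall>r\<in>I. h r = r \<odot>\<^bsub>E\<^esub> e"
  shows "injective_module R E"
  unfolding injective_module_def
proof (intro conjI allI impI E)
  fix M :: "('r, 'r mod_elt) module" and N f
  assume asm: "Module.module R M \<and> submodule N R M \<and> f \<in> mod_hom R (M\<lparr>carrier := N\<rparr>) E"
  interpret M: Module.module R M using asm by blast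
  interpret E: Module.module R E by (rule E)
  have Nsub: "submodule N R M" using asm by blast
  note N = M.submoduleE[OF Nsub]
  have f: "\<And>x. x \<in> N \<Longrightarrow> f x \<in> carrier E"
    "\<And>x y. x \<in> N \<Longrightarrow> y \<in> N \<Longrightarrow> f (x \<oplus>\<^bsub>M\<^esub> y) = f x \<oplus>\<^bsub>E\<^esub> f y"
    "\<And>r x. r \<in> carrier R \<Longrightarrow> x \<in> N \<Longrightarrow> f (r \<odot>\<^bsub>M\<^esub> x) = r \<odot>\<^bsub>E\<^esub> f x"
    using asm by (auto simp: mod_hom_def)
  \<comment> \<open>Partial extensions are represented by their graphs, so that unions of chains
    need no gluing. The last clause expresses single-valuedness, which by additivity has to be
    required at zero only.\<close>
  define good where "good G \<longleftrightarrow> (\<lambda>x. (x, f x)) ` N \<subseteq> G \<and> G \<subseteq> carrier M \<times> carrier E \<and>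
      (\<forall>a b a' b'. (a, b) \<in> G \<longrightarrow> (a', b') \<in> G \<longrightarrow> (a \<oplus>\<^bsub>M\<^esub> a', b \<oplus>\<^bsub>E\<^esub> b') \<in> G) \<and>
      (\<forall>r a b. r \<in> carrier R \<longrightarrow> (a, b) \<in> G \<longrightarrow> (r \<odot>\<^bsub>M\<^esub> a, r \<odot>\<^bsub>E\<^esub> b) \<in> G) \<and>
      (\<forall>b. (\<zero>\<^bsub>M\<^esub>, b) \<in> G \<longrightarrow> b = \<zero>\<^bsub>E\<^esub>)" for G
  have m1: "\<ominus>\<^bsub>R\<^esub> \<one>\<^bsub>R\<^esub> \<in> carrier R" by simp
  have g0: "good ((\<lambda>x. (x, f x)) ` N)"
    unfolding good_def
  proof (intro conjI allI impI)
    fix b assume "(\<zero>\<^bsub>M\<^esub>, b) \<in> (\<lambda>x. (x, f x)) ` N"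
    then have z: "\<zero>\<^bsub>M\<^esub> \<in> N" "b = f \<zero>\<^bsub>M\<^esub>" by auto
    then show "b = \<zero>\<^bsub>E\<^esub>" using f(3)[of "\<zero>\<^bsub>R\<^esub>" "\<zero>\<^bsub>M\<^esub>"] f(1)[of "\<zero>\<^bsub>M\<^esub>"] by simp
  qed (use N f in auto)
  have "\<exists>G\<in>Collect good. \<forall>X\<in>Collect good. G \<subseteq> X \<longrightarrow> X = G"
  proof (rule subset_Zorn_nonempty)
    show "Collect good \<noteq> {}" using g0 by blast
    fix C assume C: "C \<noteq> {}" "subset.chain (Collect good) C"
    have Cg: "good G" if "G \<in> C" for G using C(2) that by (auto simp: subset.chain_def)
    have two: "\<exists>G\<in>C. p \<in> G \<and> q \<in> G" if "p \<in> \<Union> C" "q \<in> \<Union> C" for p q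
    proof -
      obtain G H where "G \<in> C" "p \<in> G" "H \<in> C" "q \<in> H" using \<open>p \<in> \<Union> C\<close> \<open>q \<in> \<Union> C\<close> by blast
      moreover from this have "G \<subseteq> H \<or> H \<subseteq> G" using C(2) by (auto simp: subset.chain_def)
      ultimately show ?thesis by blast
    qed
    have "good (\<Union> C)"
      unfolding good_def
    proof (intro conjI allI impI)
      obtain G where "G \<in> C" using C(1) by blast
      then show "(\<lambda>x. (x, f x)) ` N \<subseteq> \<Union> C" using Cg[OF \<open>G \<in> C\<close>] unfolding good_def by blast
      show "\<Union> C \<subseteq> carrier M \<times> carrier E" using Cg unfolding good_def by blast
      show "(a \<oplus>\<^bsub>M\<^esub> a', b \<oplus>\<^bsub>E\<^esub> b') \<in> \<Union> C" if "(a, b) \<in> \<Union> C" "(a', b') \<in> \<Union> C" for a b a' b'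
        using two[OF that] Cg unfolding good_def by blast
      show "(r \<odot>\<^bsub>M\<^esub> a, r \<odot>\<^bsub>E\<^esub> b) \<in> \<Union> C" if "r \<in> carrier R" "(a, b) \<in> \<Union> C" for r a b
        using that Cg unfolding good_def by blast
      show "b = \<zero>\<^bsub>E\<^esub>" if "(\<zero>\<^bsub>M\<^esub>, b) \<in> \<Union> C" for b
        using that Cg unfolding good_def by blast
    qed
    then show "\<Union> C \<in> Collect good" by simp
  qed
  then obtain G where G: "good G" and max: "\<And>X. good X \<Longrightarrow> G \<subseteq> X \<Longrightarrow> X = G" by blast
  have Gf: "(x, f x) \<in> G" if "x \<in> N" for x using G that unfolding good_def by blast
  have Gc: "a \<in> carrier M" "b \<in> carrier E" if "(a, b) \<in> G" for a b
    using G that unfolding good_def by blast+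
  have Ga: "(a \<oplus>\<^bsub>M\<^esub> a', b \<oplus>\<^bsub>E\<^esub> b') \<in> G" if "(a, b) \<in> G" "(a', b') \<in> G" for a b a' b'
    using G that unfolding good_def by blast
  have Gs: "(r \<odot>\<^bsub>M\<^esub> a, r \<odot>\<^bsub>E\<^esub> b) \<in> G" if "r \<in> carrier R" "(a, b) \<in> G" for r a b
    using G that unfolding good_def by blast
  have Gz: "b = \<zero>\<^bsub>E\<^esub>" if "(\<zero>\<^bsub>M\<^esub>, b) \<in> G" for b
    using G that unfolding good_def by blast
  have Gn: "(\<ominus>\<^bsub>M\<^esub> a, \<ominus>\<^bsub>E\<^esub> b) \<in> G" if "(a, b) \<in> G" for a b
    using Gs[OF m1 that] Gc[OF that] by (simp add: M.smult_l_minus E.smult_l_minus)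
  have Gu: "b = b'" if "(a, b) \<in> G" "(a, b') \<in> G" for a b b'
  proof -
    have "(a \<oplus>\<^bsub>M\<^esub> \<ominus>\<^bsub>M\<^esub> a, b \<oplus>\<^bsub>E\<^esub> \<ominus>\<^bsub>E\<^esub> b') \<in> G" by (intro Ga Gn that)
    then have "b \<oplus>\<^bsub>E\<^esub> \<ominus>\<^bsub>E\<^esub> b' = \<zero>\<^bsub>E\<^esub>" using Gz Gc(1)[OF that(1)] by (simp add: M.M.r_neg)
    then show ?thesis
      using Gc(2)[OF that(1)] Gc(2)[OF that(2)]
      by (metis E.M.minus_equality E.M.minus_minus E.M.a_inv_closed)
  qed
  define D where "D = fst ` G"
  have D: "x \<in> D \<longleftrightarrow> (\<exists>y. (x, y) \<in> G)" for x by (force simp: D_def)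
  define g where "g x = (THE y. (x, y) \<in> G)" for x
  have g: "(x, g x) \<in> G" if xD: "x \<in> D" for x
  proof -
    obtain y where y: "(x, y) \<in> G" using xD unfolding D by blast
    show ?thesis unfolding g_def by (rule theI[of "\<lambda>y. (x, y) \<in> G", OF y]) (rule Gu[OF _ y])
  qed
  have gI: "g x = y" if xy: "(x, y) \<in> G" for x y
  proof -
    have "x \<in> D" unfolding D using xy by blast
    from Gu[OF g[OF this] xy] show ?thesis .
  qed
  have all: "x \<in> D" if x: "x \<in> carrier M" for x
  proof -
    \<comment> \<open>The scalars that bring \<open>x\<close> into the domain form an ideal. The
      element \<open>e\<close> supplied for it is a consistent value at \<open>x\<close>, which
      enlarges the graph unless \<open>x\<close> is in the domain already.\<close>
    define I where "I = {r \<in> carrier R. r \<odot>\<^bsub>M\<^esub> x \<in> D}"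
    define h where "h r = g (r \<odot>\<^bsub>M\<^esub> x)" for r
    have hG: "(r \<odot>\<^bsub>M\<^esub> x, h r) \<in> G" if "r \<in> I" for r using that g by (simp add: I_def h_def)
    have II: "r \<in> I" if "r \<in> carrier R" "(r \<odot>\<^bsub>M\<^esub> x, y) \<in> G" for r y
      unfolding I_def D using that by blast
    have Ic: "r \<in> carrier R" if "r \<in> I" for r using that by (simp add: I_def)
    have I_add: "((r \<oplus>\<^bsub>R\<^esub> s) \<odot>\<^bsub>M\<^esub> x, h r \<oplus>\<^bsub>E\<^esub> h s) \<in> G" if "r \<in> I" "s \<in> I" for r s
      using Ga[OF hG[OF that(1)] hG[OF that(2)]] Ic[OF that(1)] Ic[OF that(2)] x by (simp add: M.smult_l_distr)
    have I_mult: "((r \<otimes>\<^bsub>R\<^esub> s) \<odot>\<^bsub>M\<^esub> x, r \<odot>\<^bsub>E\<^esub> h s) \<in> G" if "r \<in> carrier R" "s \<in> I" for r s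
      using Gs[OF that(1) hG[OF that(2)]] Ic[OF that(2)] that(1) x by (simp add: M.smult_assoc1)
    have "N \<noteq> {}" by (rule N(2))
    then obtain n where n: "n \<in> N" by blast
    have "(\<zero>\<^bsub>R\<^esub> \<odot>\<^bsub>M\<^esub> n, \<zero>\<^bsub>R\<^esub> \<odot>\<^bsub>E\<^esub> f n) \<in> G" by (rule Gs[OF _ Gf[OF n]]) simp
    then have zG: "(\<zero>\<^bsub>M\<^esub>, \<zero>\<^bsub>E\<^esub>) \<in> G" using n N(1) f(1)[OF n] by (simp add: subset_iff)
    have zI: "\<zero>\<^bsub>R\<^esub> \<in> I" using II[of "\<zero>\<^bsub>R\<^esub>" "\<zero>\<^bsub>E\<^esub>"] zG x by simp
    have "ideal I R"
    proof (rule idealI)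
      show "ring R" by (rule M.R.ring_axioms)
      show "subgroup I (add_monoid R)"
      proof (rule M.R.add.subgroupI)
        show "I \<subseteq> carrier R" using Ic by blast
        show "I \<noteq> {}" using zI by blast
        show "\<ominus>\<^bsub>R\<^esub> r \<in> I" if "r \<in> I" for r
          using II[of "\<ominus>\<^bsub>R\<^esub> \<one>\<^bsub>R\<^esub> \<otimes>\<^bsub>R\<^esub> r", OF _ I_mult[OF m1 that]] Ic[OF that] by (simp add: M.R.l_minus)
        show "r \<oplus>\<^bsub>R\<^esub> s \<in> I" if "r \<in> I" "s \<in> I" for r s
          using II[OF _ I_add[OF that]] Ic[OF that(1)] Ic[OF that(2)] by simp
      qed
      show l: "s \<otimes>\<^bsub>R\<^esub> r \<in> I" if "r \<in> I" "s \<in> carrier R" for r s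
        using II[OF _ I_mult[OF that(2,1)]] Ic[OF that(1)] that(2) by simp
      show "r \<otimes>\<^bsub>R\<^esub> s \<in> I" if "r \<in> I" "s \<in> carrier R" for r s
        using l[OF that] Ic[OF that(1)] that(2) by (simp add: M.R.m_comm)
    qed
    then have "\<exists>e\<in>carrier E. \<forall>r\<in>I. h r = r \<odot>\<^bsub>E\<^esub> e"
    proof (rule baer)
      show "h r \<in> carrier E" if "r \<in> I" for r using Gc(2)[OF hG[OF that]] .
      show "h (r \<oplus>\<^bsub>R\<^esub> s) = h r \<oplus>\<^bsub>E\<^esub> h s" if "r \<in> I" "s \<in> I" for r s
        using gI[OF I_add[OF that]] by (simp add: h_def)
      show "h (r \<otimes>\<^bsub>R\<^esub> s) = r \<odot>\<^bsub>E\<^esub> h s" if "r \<in> carrier R" "s \<in> I" for r s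
        using gI[OF I_mult[OF that]] by (simp add: h_def)
    qed
    then obtain e where e: "e \<in> carrier E" "\<And>r. r \<in> I \<Longrightarrow> (r \<odot>\<^bsub>M\<^esub> x, r \<odot>\<^bsub>E\<^esub> e) \<in> G" using hG by force
    define G' where "G' = {(a \<oplus>\<^bsub>M\<^esub> r \<odot>\<^bsub>M\<^esub> x, b \<oplus>\<^bsub>E\<^esub> r \<odot>\<^bsub>E\<^esub> e) | a b r. (a, b) \<in> G \<and> r \<in> carrier R}"
    have G'I: "(p, q) \<in> G'" if "(a, b) \<in> G" "r \<in> carrier R" "p = a \<oplus>\<^bsub>M\<^esub> r \<odot>\<^bsub>M\<^esub> x" "q = b \<oplus>\<^bsub>E\<^esub> r \<odot>\<^bsub>E\<^esub> e" for p q a b r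
      using that unfolding G'_def by blast
    have GG': "G \<subseteq> G'"
    proof
      fix p assume p: "p \<in> G"
      show "p \<in> G'"
        using G'I[of "fst p" "snd p" "\<zero>\<^bsub>R\<^esub>" "fst p" "snd p"] p Gc[of "fst p" "snd p"] x e(1) by simp
    qed
    have "good G'"
      unfolding good_def
    proof (intro conjI allI impI)
      show "(\<lambda>x. (x, f x)) ` N \<subseteq> G'" using Gf GG' by blast
      show "G' \<subseteq> carrier M \<times> carrier E"
        unfolding G'_def using Gc x e(1) by auto
    next
      fix p q p' q' assume "(p, q) \<in> G'" "(p', q') \<in> G'"
      then obtain a b r a' b' r' where *: "(a, b) \<in> G" "r \<in> carrier R" "p = a \<oplus>\<^bsub>M\<^esub> r \<odot>\<^bsub>M\<^esub> x" "q = b \<oplus>\<^bsub>E\<^esub> r \<odot>\<^bsub>E\<^esub> e"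
        "(a', b') \<in> G" "r' \<in> carrier R" "p' = a' \<oplus>\<^bsub>M\<^esub> r' \<odot>\<^bsub>M\<^esub> x" "q' = b' \<oplus>\<^bsub>E\<^esub> r' \<odot>\<^bsub>E\<^esub> e"
        unfolding G'_def by blast
      note c = Gc[OF *(1)] Gc[OF *(5)]
      show "(p \<oplus>\<^bsub>M\<^esub> p', q \<oplus>\<^bsub>E\<^esub> q') \<in> G'"
      proof (rule G'I[OF Ga[OF *(1,5)]])
        show "r \<oplus>\<^bsub>R\<^esub> r' \<in> carrier R" using * by simp
        show "p \<oplus>\<^bsub>M\<^esub> p' = a \<oplus>\<^bsub>M\<^esub> a' \<oplus>\<^bsub>M\<^esub> (r \<oplus>\<^bsub>R\<^esub> r') \<odot>\<^bsub>M\<^esub> x"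
          using * c x by (simp add: M.smult_l_distr M.M.a_ac)
        show "q \<oplus>\<^bsub>E\<^esub> q' = b \<oplus>\<^bsub>E\<^esub> b' \<oplus>\<^bsub>E\<^esub> (r \<oplus>\<^bsub>R\<^esub> r') \<odot>\<^bsub>E\<^esub> e"
          using * c e(1) by (simp add: E.smult_l_distr E.M.a_ac)
      qed
    next
      fix s p q assume s: "s \<in> carrier R" and "(p, q) \<in> G'"
      then obtain a b r where *: "(a, b) \<in> G" "r \<in> carrier R" "p = a \<oplus>\<^bsub>M\<^esub> r \<odot>\<^bsub>M\<^esub> x" "q = b \<oplus>\<^bsub>E\<^esub> r \<odot>\<^bsub>E\<^esub> e"
        unfolding G'_def by blast
      note c = Gc[OF *(1)]
      show "(s \<odot>\<^bsub>M\<^esub> p, s \<odot>\<^bsub>E\<^esub> q) \<in> G'"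
        by (rule G'I[OF Gs[OF s *(1)], of "s \<otimes>\<^bsub>R\<^esub> r"])
          (use * s c x e(1) in \<open>simp_all add: M.smult_r_distr M.smult_assoc1 E.smult_r_distr E.smult_assoc1\<close>)
    next
      fix q assume "(\<zero>\<^bsub>M\<^esub>, q) \<in> G'"
      then obtain a b r where *: "(a, b) \<in> G" "r \<in> carrier R" "\<zero>\<^bsub>M\<^esub> = a \<oplus>\<^bsub>M\<^esub> r \<odot>\<^bsub>M\<^esub> x" "q = b \<oplus>\<^bsub>E\<^esub> r \<odot>\<^bsub>E\<^esub> e"
        unfolding G'_def by blast
      note c = Gc[OF *(1)]
      have rx: "r \<odot>\<^bsub>M\<^esub> x \<in> carrier M" using *(2) x by simp
      have "r \<odot>\<^bsub>M\<^esub> x = \<ominus>\<^bsub>M\<^esub> a"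
        using M.M.minus_equality[of "r \<odot>\<^bsub>M\<^esub> x" a] *(3) c(1) rx by (simp add: M.M.a_comm)
      then have n: "(r \<odot>\<^bsub>M\<^esub> x, \<ominus>\<^bsub>E\<^esub> b) \<in> G" using Gn[OF *(1)] by simp
      have "r \<odot>\<^bsub>E\<^esub> e = \<ominus>\<^bsub>E\<^esub> b" by (rule Gu[OF e(2)[OF II[OF *(2) n]] n])
      then show "q = \<zero>\<^bsub>E\<^esub>" using *(4) c(2) by (simp add: E.M.r_neg)
    qed
    then have "G' = G" using max GG' by blast
    moreover have "(x, e) \<in> G'"
      using G'I[OF zG, of "\<one>\<^bsub>R\<^esub>" x e] x e(1) by simp
    ultimately show ?thesis using D by blast
  qed
  have "g \<in> mod_hom R M E"
    unfolding mod_hom_def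
  proof (intro CollectI conjI ballI)
    show "g \<in> carrier M \<rightarrow> carrier E" using Gc(2)[OF g[OF all]] by blast
    show "g (x \<oplus>\<^bsub>M\<^esub> y) = g x \<oplus>\<^bsub>E\<^esub> g y" if "x \<in> carrier M" "y \<in> carrier M" for x y
      by (rule gI[OF Ga[OF g[OF all[OF that(1)]] g[OF all[OF that(2)]]]])
    show "g (r \<odot>\<^bsub>M\<^esub> x) = r \<odot>\<^bsub>E\<^esub> g x" if "r \<in> carrier R" "x \<in> carrier M" for r x
      by (rule gI[OF Gs[OF that(1) g[OF all[OF that(2)]]]])
  qed
  moreover have "\<forall>x\<in>N. g x = f x" using gI[OF Gf] by blast
  ultimately show "\<exists>g\<in>mod_hom R M E. \<forall>x\<in>N. g x = f x" by blast
qed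

lemma injective_mod_iso:
  assumes iso: "mod_iso R E E'" and E': "Module.module R E'" and inj: "injective_module R E"
  shows "injective_module R E'"
  unfolding injective_module_def
proof (intro conjI allI impI E')
  have E: "Module.module R E" using inj by (simp add: injective_module_def)
  obtain a where a: "a \<in> mod_hom R E E'" "bij_betw a (carrier E) (carrier E')"
    using iso by (auto simp: mod_iso_def)
  have bhom: "inv_into (carrier E) a \<in> mod_hom R E' E"
  proof -
    interpret module_iso R E E' a
      by (intro module_iso.intro module_iso_axioms.intro E E' a)
    have ia: "inv_into (carrier E) a (a x) = x" if "x \<in> carrier E" for x
      using a(2) that by (simp add: bij_betw_inv_into_left)
    have ex: "\<exists>u\<in>carrier E. x = a u" if "x \<in> carrier E'" for x using img that by blast
    show ?thesis
      unfolding mod_hom_def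
    proof (intro CollectI conjI ballI)
      show "inv_into (carrier E) a \<in> carrier E' \<rightarrow> carrier E"
        using ex ia by fastforce
      fix x assume x: "x \<in> carrier E'"
      obtain u where u: "u \<in> carrier E" "x = a u" using ex[OF x] by blast
      show "inv_into (carrier E) a (x \<oplus>\<^bsub>E'\<^esub> y) = inv_into (carrier E) a x \<oplus>\<^bsub>E\<^esub> inv_into (carrier E) a y"
        if y: "y \<in> carrier E'" for y
      proof -
        obtain v where v: "v \<in> carrier E" "y = a v" using ex[OF y] by blast
        show ?thesis using u v ia[of "u \<oplus>\<^bsub>E\<^esub> v"] ia by (simp add: add)
      qed
      show "inv_into (carrier E) a (r \<odot>\<^bsub>E'\<^esub> x) = r \<odot>\<^bsub>E\<^esub> inv_into (carrier E) a x" if "r \<in> carrier R" for r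
        using u that ia[of "r \<odot>\<^bsub>E\<^esub> u"] ia by (simp add: smult)
    qed
  qed
  fix M :: "('a, 'a mod_elt) module" and N f
  assume asm: "Module.module R M \<and> submodule N R M \<and> f \<in> mod_hom R (M\<lparr>carrier := N\<rparr>) E'"
  define f' where "f' = inv_into (carrier E) a \<circ> f"
  have "f' \<in> mod_hom R (M\<lparr>carrier := N\<rparr>) E"
    using asm bhom by (auto simp: f'_def mod_hom_def Pi_def)
  then obtain g where g: "g \<in> mod_hom R M E" "\<forall>x\<in>N. g x = f' x"
    using inj asm unfolding injective_module_def by blast
  have "a \<circ> g \<in> mod_hom R M E'" using a(1) g(1) by (auto simp: mod_hom_def Pi_def)
  moreover have "(a \<circ> g) x = f x" if "x \<in> N" for x
  proof -
    have "f x \<in> carrier E'" using asm that by (auto simp: mod_hom_def)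
    then show ?thesis using g(2) that a(2) by (simp add: f'_def bij_betw_inv_into_right)
  qed
  ultimately show "\<exists>g\<in>mod_hom R M E'. \<forall>x\<in>N. g x = f x" by blast
qed

section \<open>Laurent series and the dual of \<open>S\<close>\<close>

lemma fps_to_fls_mult_nth:
  fixes s :: "'k::field fps" and G :: "'k fls"
  assumes G: "\<And>i. N < i \<Longrightarrow> fls_nth G (n - int i) = 0"
  shows "fls_nth (fps_to_fls s * G) n = (\<Sum>i\<le>N. fps_nth s i * fls_nth G (n - int i))"
proof -
  let ?f = "fps_to_fls s" and ?dg = "fls_subdegree G"
  have "fls_nth (?f * G) n = (\<Sum>i=fls_subdegree ?f..n - ?dg. fls_nth ?f i * fls_nth G (n - i))"
    by (rule fls_times_nth(2))
  also have "\<dots> = (\<Sum>i\<in>int ` {..N}. fls_nth ?f i * fls_nth G (n - i))"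
  proof (rule sum.mono_neutral_cong)
    fix i assume i: "i \<in> int ` {..N} - {fls_subdegree ?f..n - ?dg}"
    then show "fls_nth ?f i * fls_nth G (n - i) = 0"
    proof (cases "i < fls_subdegree ?f")
      case False
      then have "n - i < ?dg" using i by auto
      then show ?thesis by simp
    next
      case True
      show ?thesis unfolding fls_eq0_below_subdegree[OF True] by simp
    qed
  next
    fix i assume i: "i \<in> {fls_subdegree ?f..n - ?dg} - int ` {..N}"
    show "fls_nth ?f i * fls_nth G (n - i) = 0"
    proof (cases "i < 0")
      case False
      then obtain j where j: "i = int j" by (metis linorder_not_less nonneg_int_cases)
      then have "N < j" using i by force
      then show ?thesis using G[of j] j by simp
    qed simp
  qed auto
  also have "\<dots> = (\<Sum>i\<le>N. fps_nth s i * fls_nth G (n - int i))"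
    by (subst sum.reindex) (auto simp: inj_on_def)
  finally show ?thesis .
qed

lemma fls_lower_bound:
  obtains N :: nat where "\<And>i. N < i \<Longrightarrow> fls_nth G (n - int i) = 0"
proof -
  have "fls_nth G (n - int i) = 0" if "nat (n - fls_subdegree G) < i" for i
    using that by simp
  then show thesis by (rule that)
qed

context semigroup_ring_conductor
begin

definition laurent_module :: "('k fps, 'k fls) module" where
  "laurent_module = \<lparr>carrier = UNIV, mult = (*), one = 1, zero = 0, add = (+), smult = \<lambda>s f. fps_to_fls s * f\<rparr>"

definition trunc :: "'k fls \<Rightarrow> 'k fls" where
  "trunc f = Abs_fls (\<lambda>n. if - n \<in> int ` H then fls_nth f n else 0)"

text \<open>
  The module of continuous functionals on \<open>S\<close>: a series \<open>f\<close> acts on \<open>s\<close> by the constant coefficient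
  of \<open>s * f\<close>.
\<close>

definition dual_module :: "('k fps, 'k fls) module" where
  "dual_module = \<lparr>carrier = {f. \<forall>n. fls_nth f n \<noteq> 0 \<longrightarrow> - n \<in> int ` H}, mult = (*), one = 1, zero = 0, add = (+),
     smult = \<lambda>s f. trunc (fps_to_fls s * f)\<rparr>"

lemma laurent_module_simps [simp]:
  "carrier laurent_module = UNIV" "zero laurent_module = 0" "add laurent_module = (+)" "smult laurent_module = (\<lambda>s f. fps_to_fls s * f)"
  by (simp_all add: laurent_module_def)

lemma dual_module_simps [simp]:
  "carrier dual_module = {f. \<forall>n. fls_nth f n \<noteq> 0 \<longrightarrow> - n \<in> int ` H}" "zero dual_module = 0" "add dual_module = (+)"
  "smult dual_module = (\<lambda>s f. trunc (fps_to_fls s * f))"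
  by (simp_all add: dual_module_def)

lemma trunc_nth: "fls_nth (trunc f) n = (if - n \<in> int ` H then fls_nth f n else 0)"
  unfolding trunc_def
  by (rule nth_Abs_fls_lower_bound[of "fls_subdegree f"]) simp

lemma trunc_add: "trunc (f + g) = trunc f + trunc g"
  by (rule fls_eqI) (simp add: trunc_nth)

lemma trunc_dual: "f \<in> carrier dual_module \<Longrightarrow> trunc f = f"
  by (rule fls_eqI) (auto simp: trunc_nth)

lemma H_add: "a \<in> H \<Longrightarrow> b \<in> H \<Longrightarrow> a + b \<in> H"
  using sg by (simp add: nat_submonoid_def)

text \<open>For \<open>-n\<close> in \<open>H\<close> and \<open>i\<close> in \<open>H\<close> also
  \<open>i - n\<close> is in \<open>H\<close>. So a coefficient of the product that survives the
  truncation uses only coefficients of \<open>f\<close> that survive it as well.\<close>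

lemma trunc_mult:
  assumes s: "s \<in> carrier S"
  shows "trunc (fps_to_fls s * trunc f) = trunc (fps_to_fls s * f)"
proof (rule fls_eqI)
  fix n
  show "fls_nth (trunc (fps_to_fls s * trunc f)) n = fls_nth (trunc (fps_to_fls s * f)) n"
  proof (cases "- n \<in> int ` H")
    case True
    then obtain h where h: "h \<in> H" "n = - int h" by force
    obtain N where N: "\<And>i. N < i \<Longrightarrow> fls_nth f (n - int i) = 0" using fls_lower_bound by blast
    have N': "fls_nth (trunc f) (n - int i) = 0" if "N < i" for i using N[OF that] by (simp add: trunc_nth)
    have eq: "fps_nth s i * fls_nth (trunc f) (n - int i) = fps_nth s i * fls_nth f (n - int i)" for i
    proof (cases "fps_nth s i = 0")
      case False
      then have "i \<in> H" using s by (simp add: sr_simps(1))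
      then have "- (n - int i) \<in> int ` H" using H_add[OF h(1)] h(2) by (auto intro!: image_eqI[of _ _ "h + i"])
      then show ?thesis by (simp add: trunc_nth)
    qed simp
    have "fls_nth (fps_to_fls s * trunc f) n = fls_nth (fps_to_fls s * f) n"
      by (simp only: fps_to_fls_mult_nth[of N "trunc f" n s, OF N'] fps_to_fls_mult_nth[of N f n s, OF N] eq)
    then show ?thesis by (simp add: trunc_nth)
  qed (simp add: trunc_nth)
qed

lemma module_laurent: "Module.module S laurent_module"
proof (rule moduleI[OF cring_sr])
  show "abelian_group laurent_module"
  proof (rule abelian_groupI)
    show "\<exists>y\<in>carrier laurent_module. y \<oplus>\<^bsub>laurent_module\<^esub> x = \<zero>\<^bsub>laurent_module\<^esub>" for x
      by (intro bexI[of _ "- x"]) simp_all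
  qed (simp_all add: add_ac)
qed (simp_all add: sr_simps(2,4,5) algebra_simps fls_times_fps_to_fls)

lemma trunc_mem: "trunc f \<in> carrier dual_module"
  by (simp add: trunc_nth)

lemma dual_add: "f \<in> carrier dual_module \<Longrightarrow> g \<in> carrier dual_module \<Longrightarrow> f + g \<in> carrier dual_module"
  by (metis trunc_add trunc_dual trunc_mem)

lemma module_dual: "Module.module S dual_module"
proof (rule moduleI[OF cring_sr])
  show "abelian_group dual_module"
  proof (rule abelian_groupI)
    show "x \<oplus>\<^bsub>dual_module\<^esub> y \<in> carrier dual_module" if "x \<in> carrier dual_module" "y \<in> carrier dual_module" for x y
      using dual_add[OF that] by simp
    show "\<exists>y\<in>carrier dual_module. y \<oplus>\<^bsub>dual_module\<^esub> x = \<zero>\<^bsub>dual_module\<^esub>" if "x \<in> carrier dual_module" for x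
      using that by (intro bexI[of _ "- x"]) simp_all
  qed (simp_all add: add_ac)
  fix a b x y assume a: "a \<in> carrier S" and x: "x \<in> carrier dual_module"
  show "a \<odot>\<^bsub>dual_module\<^esub> x \<in> carrier dual_module" using trunc_mem by simp
  show "(a \<oplus>\<^bsub>S\<^esub> b) \<odot>\<^bsub>dual_module\<^esub> x = a \<odot>\<^bsub>dual_module\<^esub> x \<oplus>\<^bsub>dual_module\<^esub> b \<odot>\<^bsub>dual_module\<^esub> x"
    by (simp add: sr_simps(5) distrib_right trunc_add)
  show "a \<odot>\<^bsub>dual_module\<^esub> (x \<oplus>\<^bsub>dual_module\<^esub> y) = a \<odot>\<^bsub>dual_module\<^esub> x \<oplus>\<^bsub>dual_module\<^esub> a \<odot>\<^bsub>dual_module\<^esub> y"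
    by (simp add: distrib_left trunc_add)
  show "(a \<otimes>\<^bsub>S\<^esub> b) \<odot>\<^bsub>dual_module\<^esub> x = a \<odot>\<^bsub>dual_module\<^esub> (b \<odot>\<^bsub>dual_module\<^esub> x)"
    using trunc_mult[OF a] by (simp add: sr_simps(4) fls_times_fps_to_fls mult.assoc)
next
  fix x assume "x \<in> carrier dual_module"
  then show "\<one>\<^bsub>S\<^esub> \<odot>\<^bsub>dual_module\<^esub> x = x" using trunc_dual[of x] by (simp add: sr_simps(2))
qed

text \<open>In the field of Laurent series \<open>h\<close> is multiplication by
  \<open>h p / p\<close> for any nonzero \<open>p\<close> in the ideal.\<close>

lemma injective_laurent: "injective_module S laurent_module"
proof (rule injective_moduleI[OF module_laurent])
  fix I h
  assume "ideal I S"
    and lin: "\<And>r s. r \<in> carrier S \<Longrightarrow> s \<in> I \<Longrightarrow> h (r \<otimes>\<^bsub>S\<^esub> s) = r \<odot>\<^bsub>laurent_module\<^esub> h s"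
  then have I: "sr_closed I" "I \<subseteq> carrier S" by (simp_all add: ideal_sr)
  have z: "0 \<in> I" by (rule sr_closedD(1)[OF I(1)])
  have lin': "h (r * s) = fps_to_fls r * h s" if "r \<in> carrier S" "s \<in> I" for r s
    using lin[OF that] by (simp add: sr_simps(4))
  have "\<exists>e. \<forall>r\<in>I. h r = fps_to_fls r * e"
  proof (cases "I = {0}")
    case True
    have "h 0 = 0" using lin'[of 0 0] z I(2) by auto
    then show ?thesis using True by simp
  next
    case False
    then obtain p where p: "p \<in> I" "p \<noteq> 0" using z by blast
    have "h r = fps_to_fls r * (h p / fps_to_fls p)" if "r \<in> I" for r
    proof -
      have "fps_to_fls p * h r = fps_to_fls r * h p"
        using lin'[of p r] lin'[of r p] that p(1) I(2) by (simp add: mult.commute subset_iff)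
      then show ?thesis using p(2) by (simp add: field_simps)
    qed
    then show ?thesis by blast
  qed
  then show "\<exists>e\<in>carrier laurent_module. \<forall>r\<in>I. h r = r \<odot>\<^bsub>laurent_module\<^esub> e" by simp
qed

text \<open>A homomorphism \<open>h\<close> from an ideal is determined by the functional
  \<open>\<phi>\<close>, the constant coefficient of \<open>h r\<close>: the coefficient at
  \<open>-n\<close> is the value of \<open>\<phi>\<close> at \<open>t^n * r\<close>. Extending
  \<open>\<phi>\<close> linearly to all power series and reading off its values at the powers of
  \<open>t\<close> produces the element \<open>e\<close>.\<close>

lemma injective_dual: "injective_module S dual_module"
proof (rule injective_moduleI[OF module_dual])
  fix I h
  assume "ideal I S" and mem: "\<And>r. r \<in> I \<Longrightarrow> h r \<in> carrier dual_module"
    and add: "\<And>r s. r \<in> I \<Longrightarrow> s \<in> I \<Longrightarrow> h (r \<oplus>\<^bsub>S\<^esub> s) = h r \<oplus>\<^bsub>dual_module\<^esub> h s"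
    and lin: "\<And>r s. r \<in> carrier S \<Longrightarrow> s \<in> I \<Longrightarrow> h (r \<otimes>\<^bsub>S\<^esub> s) = r \<odot>\<^bsub>dual_module\<^esub> h s"
  then have I: "sr_closed I" "I \<subseteq> carrier S" by (simp_all add: ideal_sr)
  have z: "0 \<in> I" by (rule sr_closedD(1)[OF I(1)])
  have lin': "h (r * s) = trunc (fps_to_fls r * h s)" if "r \<in> carrier S" "s \<in> I" for r s
    using lin[OF that] by (simp add: sr_simps(4))
  have add': "h (r + s) = h r + h s" if "r \<in> I" "s \<in> I" for r s
    using add[OF that] by (simp add: sr_simps(5))
  show "\<exists>e\<in>carrier dual_module. \<forall>r\<in>I. h r = r \<odot>\<^bsub>dual_module\<^esub> e"
  proof (cases "I = {0}")
    case True
    have "h 0 = 0" using add'[OF z z] by (metis add_0 add_cancel_right_right)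
    then show ?thesis using True by (intro bexI[of _ 0]) (simp_all add: trunc_dual)
  next
    case False
    then obtain p where p: "p \<in> I" "p \<noteq> 0" using z by blast
    define \<phi> where "\<phi> r = fls_nth (h r) 0" for r
    have zH: "- 0 \<in> int ` H" using zero_mem_H by force
    have \<phi>_nth: "fls_nth (h r) (- int n) = \<phi> (fps_X ^ n * r)" if "n \<in> H" "r \<in> I" for n r
    proof -
      have "\<phi> (fps_X ^ n * r) = fls_nth (fps_to_fls (fps_X ^ n) * h r) 0"
        using lin'[OF sr_X_power[OF that(1)] that(2)] zH by (simp add: \<phi>_def trunc_nth)
      also have "\<dots> = (\<Sum>i\<le>max n (nat (- fls_subdegree (h r))). fps_nth (fps_X ^ n) i * fls_nth (h r) (0 - int i))"
        by (rule fps_to_fls_mult_nth, rule fls_eq0_below_subdegree) auto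
      also have "\<dots> = (\<Sum>i\<le>max n (nat (- fls_subdegree (h r))). if i = n then fls_nth (h r) (0 - int i) else 0)"
        by (rule sum.cong) (auto simp: fps_X_power_nth)
      also have "\<dots> = fls_nth (h r) (- int n)" by simp
      finally show ?thesis ..
    qed
    define m where "m = subdegree p + c"
    have Xm: "fps_X ^ m * f \<in> I" for f
      by (rule sr_closed_tail[OF I(1) p]) (simp add: m_def)
    have Xm1: "fps_X ^ m \<in> I" using Xm[of 1] by simp
    obtain B where B: "\<And>i. B < i \<Longrightarrow> fls_nth (h (fps_X ^ m)) (0 - int i) = 0" using fls_lower_bound by blast
    \<comment> \<open>Continuity of \<open>\<phi>\<close>: a multiple of \<open>t^N\<close> is
      \<open>t^m\<close> times a series in \<open>S\<close> of order above \<open>B\<close>, and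
      \<open>h (t^m)\<close> has no coefficient below \<open>-B\<close> to match it.\<close>
    define N where "N = m + max c (Suc B)"
    have XN: "fps_X ^ N * f \<in> I" for f
      using Xm[of "fps_X ^ max c (Suc B) * f"] by (simp add: N_def power_add mult.assoc)
    have tail: "\<phi> (fps_X ^ N * f) = 0" for f
    proof -
      let ?s = "fps_X ^ max c (Suc B) * f"
      have "\<phi> (fps_X ^ N * f) = \<phi> (?s * fps_X ^ m)" by (simp add: N_def power_add mult_ac)
      also have "\<dots> = fls_nth (fps_to_fls ?s * h (fps_X ^ m)) 0"
        using lin'[OF sr_X_mult Xm1, of "max c (Suc B)" f] zH by (simp add: \<phi>_def trunc_nth)
      also have "\<dots> = (\<Sum>i\<le>B. fps_nth ?s i * fls_nth (h (fps_X ^ m)) (0 - int i))"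
        by (rule fps_to_fls_mult_nth[OF B])
      also have "\<dots> = 0" by (rule sum.neutral) (auto simp: fps_X_power_mult_nth)
      finally show ?thesis .
    qed
    interpret F: vector_space "\<lambda>a (f :: 'k fps). fps_const a * f"
      by unfold_locales (simp_all add: algebra_simps flip: fps_const_add fps_const_mult)
    have subI: "F.subspace I"
      unfolding F.subspace_def using sr_closedD[OF I(1)] sr_const by blast
    have \<phi>_add: "\<phi> (x + y) = \<phi> x + \<phi> y" if "x \<in> I" "y \<in> I" for x y
      using add'[OF that] by (simp add: \<phi>_def)
    have \<phi>_scale: "\<phi> (fps_const a * x) = a * \<phi> x" if "x \<in> I" for a x
    proof -
      have "\<phi> (fps_const a * x) = fls_nth (fps_to_fls (fps_const a) * h x) 0"
        using lin'[OF sr_const that, of a] zH by (simp add: \<phi>_def trunc_nth)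
      then show ?thesis by (simp add: \<phi>_def)
    qed
    \<comment> \<open>An arbitrary linear extension is good enough: \<open>t^N k[[t]]\<close> lies
      in the ideal, so the extension agrees with \<open>\<phi>\<close> there and vanishes. Hence
      only finitely many powers of \<open>t\<close> have a nonzero value, and \<open>e\<close> is a
      Laurent series.\<close>
    obtain \<Phi> where \<Phi>: "Vector_Spaces.linear (\<lambda>a (f :: 'k fps). fps_const a * f) (*) \<Phi>"
      "\<And>r. r \<in> I \<Longrightarrow> \<Phi> r = \<phi> r"
      by (rule F.functional_extend[OF subI, of \<phi>]) (simp_all add: \<phi>_add \<phi>_scale)
    interpret \<Phi>: Vector_Spaces.linear "\<lambda>a (f :: 'k fps). fps_const a * f" "(*)" \<Phi> by (rule \<Phi>(1))
    have \<Phi>0: "\<Phi> (fps_X ^ n) = 0" if "N \<le> n" for n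
      using tail[of "fps_X ^ (n - N)"] \<Phi>(2)[OF XN, of "fps_X ^ (n - N)"] that by (simp flip: power_add)
    define e where "e = Abs_fls (\<lambda>n. if - n \<in> int ` H then \<Phi> (fps_X ^ nat (- n)) else 0)"
    have e: "fls_nth e n = (if - n \<in> int ` H then \<Phi> (fps_X ^ nat (- n)) else 0)" for n
      unfolding e_def
      by (rule nth_Abs_fls_lower_bound[of "- int N"]) (auto simp: \<Phi>0)
    have "e \<in> carrier dual_module" by (simp add: e)
    moreover have "h r = trunc (fps_to_fls r * e)" if r: "r \<in> I" for r
    proof (rule fls_eqI)
      fix n
      show "fls_nth (h r) n = fls_nth (trunc (fps_to_fls r * e)) n"
      proof (cases "- n \<in> int ` H")
        case False
        then show ?thesis using mem[OF r] by (auto simp: trunc_nth)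
      next
        case True
        then obtain j where j: "j \<in> H" "n = - int j" by force
        have rS: "r \<in> carrier S" using r I by blast
        have e0: "fls_nth e (n - int i) = 0" if "N < i" for i
          using that j by (auto simp: e intro!: \<Phi>0)
        have XrI: "fps_X ^ j * r \<in> I" by (rule sr_closedD(3)[OF I(1) sr_X_power[OF j(1)] r])
        have r_dec: "fps_X ^ j * r = (\<Sum>i\<le>N. fps_const (fps_nth r i) * fps_X ^ (j + i)) +
            fps_X ^ N * (fps_X ^ Suc j * fps_shift (Suc N) r)"
        proof -
          have "r = (\<Sum>i\<le>N. fps_const (fps_nth r i) * fps_X ^ i) + fps_X ^ Suc N * fps_shift (Suc N) r"
            by (rule fps_ext) (simp add: fps_sum_nth fps_X_power_nth fps_X_power_mult_nth if_distrib
              less_Suc_eq_le del: power_Suc cong: if_cong)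
          then have "fps_X ^ j * r = fps_X ^ j * (\<Sum>i\<le>N. fps_const (fps_nth r i) * fps_X ^ i) +
              fps_X ^ j * (fps_X ^ Suc N * fps_shift (Suc N) r)" by (metis distrib_left)
          then show ?thesis by (simp add: sum_distrib_left power_add mult_ac)
        qed
        have "fls_nth (h r) n = \<Phi> (fps_X ^ j * r)"
          using \<phi>_nth[OF j(1) r] \<Phi>(2)[OF XrI] j(2) by simp
        also have "\<dots> = (\<Sum>i\<le>N. fps_nth r i * \<Phi> (fps_X ^ (j + i)))"
          unfolding r_dec \<Phi>.add \<Phi>.sum \<Phi>.scale using tail \<Phi>(2)[OF XN] by simp
        also have "\<dots> = (\<Sum>i\<le>N. fps_nth r i * fls_nth e (n - int i))"
        proof (rule sum.cong[OF refl])
          fix i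
          show "fps_nth r i * \<Phi> (fps_X ^ (j + i)) = fps_nth r i * fls_nth e (n - int i)"
          proof (cases "fps_nth r i = 0")
            case False
            then have "i \<in> H" using rS by (simp add: sr_simps(1))
            then have "j + i \<in> H" by (rule H_add[OF j(1)])
            then have "- (n - int i) \<in> int ` H" "nat (- (n - int i)) = j + i"
              using j(2) by (auto intro!: image_eqI[of _ _ "j + i"])
            then show ?thesis by (simp only: e if_True)
          qed simp
        qed
        also have "\<dots> = fls_nth (fps_to_fls r * e) n"
          by (rule fps_to_fls_mult_nth[OF e0, symmetric])
        finally show ?thesis using True by (simp add: trunc_nth)
      qed
    qed
    ultimately show ?thesis by auto
  qed
qed

text \<open>
  Write \<open>K\<close> for the Laurent series.  By symmetry of \<open>H\<close>, shifting by \<open>F\<close> and truncating is a map of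
  \<open>K\<close> onto the dual of \<open>S\<close> with kernel \<open>S\<close>, so that \<open>0 \<rightarrow> S \<rightarrow> K \<rightarrow> K / S \<rightarrow> 0\<close> is an injective
  resolution.
\<close>

lemma gorenstein_symmetric:
  assumes sym: "\<And>n :: int. n \<in> int ` H \<longleftrightarrow> F - n \<notin> int ` H"
  shows "gorenstein_local_ring S"
proof -
  \<comment> \<open>To fit the type \<open>mod_elt\<close>, a Laurent series is stored as a
    singleton whose function sends \<open>i\<close> to the power series of the coefficients from
    degree \<open>-i\<close> on. Only injectivity matters.\<close>
  define enc where "enc f = {\<lambda>i. Abs_fps (\<lambda>n. fls_nth f (int n - int i))}" for f :: "'k fls"
  have enc: "inj enc"
  proof (rule injI)
    fix f g :: "'k fls" assume "enc f = enc g"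
    then have eq: "Abs_fps (\<lambda>n. fls_nth f (int n - int i)) = Abs_fps (\<lambda>n. fls_nth g (int n - int i))" for i
      by (auto simp: enc_def fun_eq_iff)
    show "f = g"
    proof (rule fls_eqI)
      fix k :: int
      have "fps_nth (Abs_fps (\<lambda>n. fls_nth f (int n - int (nat (- k))))) (nat k) =
          fps_nth (Abs_fps (\<lambda>n. fls_nth g (int n - int (nat (- k))))) (nat k)"
        by (simp only: eq)
      then show "fls_nth f k = fls_nth g k" by (cases "k \<ge> 0") auto
    qed
  qed
  obtain K :: "('k fps, 'k fps mod_elt) module" where K: "Module.module S K" "mod_iso S laurent_module K"
    using module_transport[OF module_laurent inj_on_subset[OF enc subset_UNIV]] by blast
  obtain E :: "('k fps, 'k fps mod_elt) module" where E: "Module.module S E" "mod_iso S dual_module E"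
    using module_transport[OF module_dual inj_on_subset[OF enc subset_UNIV]] by blast
  define Z :: "('k fps, 'k fps mod_elt) module" where
    "Z = \<lparr>carrier = {{}}, mult = \<lambda>_ _. {}, one = {}, zero = {}, add = \<lambda>_ _. {}, smult = \<lambda>_ _. {}\<rparr>"
  have Z_simps: "carrier Z = {{}}" "zero Z = {}" "add Z = (\<lambda>_ _. {})" "smult Z = (\<lambda>_ _. {})"
    by (simp_all add: Z_def)
  have Zm: "Module.module S Z"
    by (rule moduleI[OF cring_sr]) (auto intro!: abelian_groupI simp: Z_simps)
  have Zi: "injective_module S Z"
    by (rule injective_moduleI[OF Zm]) (auto simp: Z_simps)
  have Ki: "injective_module S K" by (rule injective_mod_iso[OF K(2,1) injective_laurent])
  have Ei: "injective_module S E" by (rule injective_mod_iso[OF E(2,1) injective_dual])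
  obtain a where a: "a \<in> mod_hom S laurent_module K" "bij_betw a (carrier laurent_module) (carrier K)"
    using K(2) by (auto simp: mod_iso_def)
  obtain b where b: "b \<in> mod_hom S dual_module E" "bij_betw b (carrier dual_module) (carrier E)"
    using E(2) by (auto simp: mod_iso_def)
  obtain a' where a': "a' \<in> mod_hom S K laurent_module" "\<And>f. a' (a f) = f" "\<And>x. x \<in> carrier K \<Longrightarrow> a (a' x) = x"
  proof -
    interpret module_iso S laurent_module K a
      by (intro module_iso.intro module_iso_axioms.intro module_laurent K(1) a)
    define a' where "a' = inv_into (carrier laurent_module) a"
    have 1: "a' (a f) = f" for f unfolding a'_def using a(2) by (rule bij_betw_inv_into_left) simp
    have 2: "a (a' x) = x" if "x \<in> carrier K" for x
      unfolding a'_def using a(2) that by (rule bij_betw_inv_into_right)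
    have "a' \<in> mod_hom S K laurent_module"
      unfolding mod_hom_def
    proof (intro CollectI conjI ballI)
      fix x assume x: "x \<in> carrier K"
      show "a' (x \<oplus>\<^bsub>K\<^esub> y) = a' x \<oplus>\<^bsub>laurent_module\<^esub> a' y" if y: "y \<in> carrier K" for y
        using add[of "a' x" "a' y"] 2[OF x] 2[OF y] 1[of "a' x + a' y"] by simp
      show "a' (r \<odot>\<^bsub>K\<^esub> x) = r \<odot>\<^bsub>laurent_module\<^esub> a' x" if "r \<in> carrier S" for r
        using smult[OF that, of "a' x"] 2[OF x] 1[of "fps_to_fls r * a' x"] by simp
    qed auto
    then show thesis using that 1 2 by blast
  qed
  \<comment> \<open>The coefficient of \<open>q f\<close> at \<open>-h\<close> is that of
    \<open>f\<close> at \<open>F - h\<close>. So \<open>q f\<close> sees exactly the exponents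
    \<open>F - h\<close> with \<open>h\<close> in \<open>H\<close>, which by symmetry are those
    outside \<open>H\<close>.\<close>
  define q where "q f = trunc (fls_shift F f)" for f
  have q_add: "q (f + g) = q f + q g" for f g by (simp add: q_def trunc_add fls_shift_plus)
  have q_smult: "q (fps_to_fls s * f) = trunc (fps_to_fls s * q f)" if "s \<in> carrier S" for s f
    using trunc_mult[OF that, of "fls_shift F f"] by (simp add: q_def fls_shifted_times_simps(1))
  have q_mem: "q f \<in> carrier dual_module" for f unfolding q_def by (rule trunc_mem)
  have q_ker: "q f = 0 \<longleftrightarrow> f \<in> fps_to_fls ` carrier S" for f
  proof
    assume "q f = 0"
    then have "fls_nth (q f) (- int h) = 0" for h by simp
    note q0 = this
    have zero: "fls_nth f (F - int h) = 0" if "h \<in> H" for h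
      using that q0[of h] by (simp add: q_def trunc_nth inj_image_mem_iff[OF inj_of_nat])
    have supp: "n \<in> int ` H" if "fls_nth f n \<noteq> 0" for n
    proof (rule ccontr)
      assume "n \<notin> int ` H"
      then have "F - n \<in> int ` H" using sym[of n] by simp
      then obtain h where "h \<in> H" "F - n = int h" by blast
      then show False using zero[of h] that by (metis diff_diff_eq2 add_diff_cancel_left')
    qed
    have "f = fps_to_fls (Abs_fps (\<lambda>n. fls_nth f (int n)))"
    proof (rule fls_eqI)
      fix n
      show "fls_nth f n = fls_nth (fps_to_fls (Abs_fps (\<lambda>n. fls_nth f (int n)))) n"
        using supp[of n] by (cases "n < 0") (auto simp: image_iff)
    qed
    moreover have "Abs_fps (\<lambda>n. fls_nth f (int n)) \<in> carrier S"
      using supp[of "int n" for n] by (simp add: sr_simps(1) inj_image_mem_iff[OF inj_of_nat])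
    ultimately show "f \<in> fps_to_fls ` carrier S" by blast
  next
    assume "f \<in> fps_to_fls ` carrier S"
    then obtain s where s: "s \<in> carrier S" "f = fps_to_fls s" by blast
    have f: "fls_nth f n = 0" if "n \<notin> int ` H" for n
    proof (cases "n < 0")
      case False
      then have "n = int (nat n)" by simp
      then have "nat n \<notin> H" using that by (metis imageI)
      then show ?thesis using s False by (auto simp: sr_simps(1))
    qed (simp add: s)
    show "q f = 0"
    proof (rule fls_eqI)
      fix n
      show "fls_nth (q f) n = fls_nth 0 n"
      proof (cases "- n \<in> int ` H")
        case True
        then have "n + F \<notin> int ` H" using sym[of "- n"] by (simp add: add.commute)
        then show ?thesis using f by (simp add: q_def trunc_nth)
      qed (simp add: q_def trunc_nth)
    qed
  qed
  have q_surj: "q (fls_shift (- F) g) = g" if "g \<in> carrier dual_module" for g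
    using trunc_dual[OF that] by (simp add: q_def)
  define EE where "EE i = (if i = 0 then K else if i = 1 then E else Z)" for i :: nat
  define \<epsilon> where "\<epsilon> s = a (fps_to_fls s)" for s
  define d where "d i = (if i = 0 then (\<lambda>x. b (q (a' x))) else (\<lambda>_. {}))" for i :: nat
  interpret b: module_iso S dual_module E b
    by (intro module_iso.intro module_iso_axioms.intro module_dual E(1) b)
  have bq0: "b (q f) = \<zero>\<^bsub>E\<^esub> \<longleftrightarrow> f \<in> fps_to_fls ` carrier S" for f
    using b.zero_iff[OF q_mem[of f]] q_ker[of f] by simp
  have "finite_injective_dimension S (regular_module S)"
    unfolding finite_injective_dimension_def
  proof (intro exI conjI allI impI)
    show "injective_module S (EE i)" for i using Ki Ei Zi by (simp add: EE_def)
    show "carrier (EE i) = {\<zero>\<^bsub>EE i\<^esub>}" if "i > 1" for i using that by (simp add: EE_def Z_simps)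
    show "\<epsilon> \<in> mod_hom S (regular_module S) (EE 0)"
      using a(1) by (auto simp: mod_hom_def \<epsilon>_def EE_def regular_module_def sr_simps(4,5) fls_times_fps_to_fls Pi_def)
    show "inj_on \<epsilon> (carrier (regular_module S))"
      by (rule inj_onI) (metis \<epsilon>_def a'(2) fps_to_fls_eq_iff)
    show "d i \<in> mod_hom S (EE i) (EE (Suc i))" for i
    proof (cases "i = 0")
      case True
      then show ?thesis
        using a'(1) b(1) q_mem
        by (auto simp: mod_hom_def d_def EE_def Pi_def q_add q_smult)
    qed (auto simp: mod_hom_def d_def EE_def Z_simps)
    show "\<epsilon> ` carrier (regular_module S) = {x \<in> carrier (EE 0). d 0 x = \<zero>\<^bsub>EE (Suc 0)\<^esub>}"
    proof
      show "\<epsilon> ` carrier (regular_module S) \<subseteq> {x \<in> carrier (EE 0). d 0 x = \<zero>\<^bsub>EE (Suc 0)\<^esub>}"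
        using a(1) bq0 by (auto simp: \<epsilon>_def d_def EE_def regular_module_def a'(2) mod_hom_def)
      show "{x \<in> carrier (EE 0). d 0 x = \<zero>\<^bsub>EE (Suc 0)\<^esub>} \<subseteq> \<epsilon> ` carrier (regular_module S)"
      proof
        fix x assume "x \<in> {x \<in> carrier (EE 0). d 0 x = \<zero>\<^bsub>EE (Suc 0)\<^esub>}"
        then have x: "x \<in> carrier K" "b (q (a' x)) = \<zero>\<^bsub>E\<^esub>" by (simp_all add: EE_def d_def)
        then obtain s where s: "s \<in> carrier S" "a' x = fps_to_fls s" using bq0 by blast
        then have "x = \<epsilon> s" using a'(3)[OF x(1)] by (simp add: \<epsilon>_def)
        then show "x \<in> \<epsilon> ` carrier (regular_module S)" using s(1) by (simp add: regular_module_def)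
      qed
    qed
    show "d i ` carrier (EE i) = {x \<in> carrier (EE (Suc i)). d (Suc i) x = \<zero>\<^bsub>EE (Suc (Suc i))\<^esub>}" for i
    proof (cases "i = 0")
      case True
      have "\<exists>y\<in>carrier K. x = b (q (a' y))" if x: "x \<in> carrier E" for x
      proof -
        obtain g where g: "g \<in> carrier dual_module" "x = b g" using x b.img by blast
        have "a (fls_shift (- F) g) \<in> carrier K" using a(1) by (auto simp: mod_hom_def)
        moreover have "x = b (q (a' (a (fls_shift (- F) g))))" using g q_surj by (simp add: a'(2))
        ultimately show ?thesis by blast
      qed
      moreover have "b (q f) \<in> carrier E" for f by (rule b.mem[OF q_mem])
      ultimately show ?thesis using True by (auto simp: d_def EE_def Z_simps image_iff)
    next
      case False
      then have "carrier (EE i) \<noteq> {}"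
        using E(1) abelian_groupE(2)[OF module.axioms(2)[OF E(1)]] by (auto simp: EE_def Z_simps)
      then show ?thesis using False by (auto simp: d_def EE_def Z_simps)
    qed
  qed
  then show ?thesis using noetherian_local_sr by (simp add: gorenstein_local_ring_def)
qed

end

section \<open>Semigroups of finite type\<close>

lemma nat_submonoid_generated: "nat_submonoid (nat_generated B)"
  by (rule hull_in) (auto simp: nat_submonoid_def)

lemma nat_generated_345: "nat_generated {3, 4, 5} = {n. n \<noteq> 1 \<and> n \<noteq> 2}"
proof
  show "nat_generated {3, 4, 5} \<subseteq> {n. n \<noteq> 1 \<and> n \<noteq> 2}"
    by (rule hull_minimal) (auto simp: nat_submonoid_def)
  let ?G = "nat_generated {3, 4, 5}"
  have G: "0 \<in> ?G" "\<And>a b. a \<in> ?G \<Longrightarrow> b \<in> ?G \<Longrightarrow> a + b \<in> ?G"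
    using nat_submonoid_generated unfolding nat_submonoid_def by blast+
  have B: "3 \<in> ?G" "4 \<in> ?G" "5 \<in> ?G" using hull_subset[of "{3, 4, 5}" nat_submonoid] by auto
  have "n \<in> ?G" if "n \<noteq> 1" "n \<noteq> 2" for n
    using that
  proof (induction n rule: less_induct)
    case (less n)
    show ?case
    proof (cases "n < 6")
      case True
      then have "n = 0 \<or> n = 3 \<or> n = 4 \<or> n = 5" using less.prems by linarith
      then show ?thesis using G(1) B by auto
    next
      case False
      then have "n - 3 \<in> ?G" by (intro less.IH) auto
      then show ?thesis using G(2)[OF _ B(1), of "n - 3"] False by simp
    qed
  qed
  then show "{n. n \<noteq> 1 \<and> n \<noteq> 2} \<subseteq> ?G" by blast
qed

lemma nat_generated_357: "nat_generated {3, 5, 7} = {n. n \<noteq> 1 \<and> n \<noteq> 2 \<and> n \<noteq> 4}"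
proof
  show "nat_generated {3, 5, 7} \<subseteq> {n. n \<noteq> 1 \<and> n \<noteq> 2 \<and> n \<noteq> 4}"
    by (rule hull_minimal) (auto simp: nat_submonoid_def)
  let ?G = "nat_generated {3, 5, 7}"
  have G: "0 \<in> ?G" "\<And>a b. a \<in> ?G \<Longrightarrow> b \<in> ?G \<Longrightarrow> a + b \<in> ?G"
    using nat_submonoid_generated unfolding nat_submonoid_def by blast+
  have B: "3 \<in> ?G" "5 \<in> ?G" "7 \<in> ?G" using hull_subset[of "{3, 5, 7}" nat_submonoid] by auto
  have "n \<in> ?G" if "n \<noteq> 1" "n \<noteq> 2" "n \<noteq> 4" for n
    using that
  proof (induction n rule: less_induct)
    case (less n)
    show ?case
    proof (cases "n < 6 \<or> n = 7")
      case True
      then have "n = 0 \<or> n = 3 \<or> n = 5 \<or> n = 7" using less.prems by linarith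
      then show ?thesis using G(1) B by auto
    next
      case False
      then have "n - 3 \<in> ?G" by (intro less.IH) auto
      then show ?thesis using G(2)[OF _ B(1), of "n - 3"] False by simp
    qed
  qed
  then show "{n. n \<noteq> 1 \<and> n \<noteq> 2 \<and> n \<noteq> 4} \<subseteq> ?G" by blast
qed

text \<open>Outside the range from 0 to \<open>F\<close> symmetry is automatic: integers above
  \<open>F\<close> belong to \<open>H\<close>, and their mirror images are negative.\<close>

lemma symmetric_of_gap:
  assumes F: "\<And>n. F < n \<Longrightarrow> n \<in> H" and low: "\<And>n. n \<le> F \<Longrightarrow> n \<in> H \<longleftrightarrow> F - n \<notin> H"
  shows "n \<in> int ` H \<longleftrightarrow> int F - n \<notin> int ` H"
proof -
  have int: "m \<in> int ` H \<longleftrightarrow> 0 \<le> m \<and> nat m \<in> H" for m by (force simp: image_iff)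
  consider "n < 0" | "0 \<le> n" "n \<le> int F" | "int F < n" by linarith
  then show ?thesis
  proof cases
    case 1
    then have "F < nat (int F - n)" by linarith
    then show ?thesis using 1 F by (simp add: int)
  next
    case 2
    then show ?thesis using low[of "nat n"] by (simp add: int nat_diff_distrib' nat_le_iff)
  next
    case 3
    then have "F < nat n" by linarith
    then show ?thesis using 3 F by (simp add: int)
  qed
qed

text \<open>Semigroups that contain 1 or 2 are symmetric, and the two families enforce 3 and one of
  4 and 5. Given 3, the least elements in the residue classes 1 and 2 modulo 3 determine
  \<open>H\<close>: the possibilities are <3, 4, 5>, <3, 5, 7> and the symmetric <3, 4> and <3,
  5>.\<close>

lemma (in semigroup_ring_conductor) nongorenstein_finite_type:
  assumes inf: "infinite (UNIV :: 'k set)"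
    and ng: "\<not> gorenstein_local_ring S" and fin: "finite_CM_type S"
  shows "H = {n. n \<noteq> 1 \<and> n \<noteq> 2} \<or> H = {n. n \<noteq> 1 \<and> n \<noteq> 2 \<and> n \<noteq> 4}"
proof -
  have gap: False if "\<And>n. F < n \<Longrightarrow> n \<in> H" "\<And>n. n \<le> F \<Longrightarrow> n \<in> H \<longleftrightarrow> F - n \<notin> H" for F
    using ng gorenstein_symmetric[of "int F", OF symmetric_of_gap[OF that]] by blast
  have mult: "k * a \<in> H" if "a \<in> H" for k a
    using that by (induction k) (auto intro: H_add zero_mem_H)
  have 1: "1 \<notin> H"
  proof
    assume "1 \<in> H"
    then have "n \<in> H" for n using mult[of 1 n] by simp
    then have "m \<in> int ` H \<longleftrightarrow> 0 \<le> m" for m :: int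
      by (metis imageE imageI nonneg_int_cases of_nat_0_le_iff)
    then have "n \<in> int ` H \<longleftrightarrow> -1 - n \<notin> int ` H" for n :: int
      by (simp add: algebra_simps) linarith
    \<comment> \<open>There are no gaps, and the symmetry has its centre given by
      \<open>F = -1\<close>.\<close>
    then show False using ng gorenstein_symmetric[of "-1"] by blast
  qed
  have 2: "2 \<notin> H"
  proof
    assume 2: "2 \<in> H"
    define F where "F = Max (- H)"
    have "- H \<subseteq> {..<c}" using c by (metis ComplD lessThan_iff linorder_not_less subsetI)
    then have "finite (- H)" by (rule finite_subset) simp
    then have F: "F \<notin> H" "\<And>n. F < n \<Longrightarrow> n \<in> H"
      using Max_in[of "- H"] Max_ge[of "- H"] 1 unfolding F_def by (auto simp: not_less[symmetric])
    have even: "n \<in> H" if "even n" for n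
      using mult[OF 2, of "n div 2"] that by simp
    \<comment> \<open>An odd element \<open>n\<close> below the odd gap \<open>F\<close> would
      differ from it by an even number, hence by an element of \<open>H\<close>, and
      \<open>F\<close> would be in \<open>H\<close>.\<close>
    have odd: "n \<notin> H" if n: "odd n" "n \<le> F" for n
    proof
      assume "n \<in> H"
      moreover have "F - n \<in> H" using F(1) n even[of F] even[of "F - n"] by auto
      ultimately have "n + (F - n) \<in> H" by (rule H_add)
      then show False using F(1) n by simp
    qed
    have "odd F" using F(1) even by blast
    then have "n \<in> H \<longleftrightarrow> F - n \<notin> H" if "n \<le> F" for n
      using that even[of n] odd[of n] even[of "F - n"] odd[of "F - n"] by (cases "even n") auto
    then show False using gap[OF F(2)] by blast
  qed
  have 3: "3 \<in> H" using infinite_CM_type_no_123[OF inf 1 2] fin by blast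
  have 45: "4 \<in> H \<or> 5 \<in> H" using infinite_CM_type_no_1245[OF inf 1 2] fin by blast
  have step: "n + 3 * k \<in> H" if "n \<in> H" for n k
    using H_add[OF that mult[OF 3, of k]] by (simp add: mult.commute)
  have mod3: "n \<in> H" if a: "a \<in> H" "a \<le> n" "n mod 3 = a mod 3" for a n
  proof -
    obtain k where "n - a = 3 * k" using a(2,3) by (metis mod_eq_dvd_iff_nat dvdE)
    then have "n = a + 3 * k" using a(2) by linarith
    then show ?thesis using step[OF a(1), of k] by simp
  qed
  have gen: "n \<in> H" if "a \<in> H" "b \<in> H" "a mod 3 = 1" "b mod 3 = 2" "n mod 3 = 0 \<or> n mod 3 = 1 \<and> a \<le> n \<or> n mod 3 = 2 \<and> b \<le> n" for a b n
    using that mod3[of a n] mod3[of b n] mod3[OF zero_mem_H, of n] by auto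
  show ?thesis
  proof (cases "4 \<in> H")
    case 4: True
    show ?thesis
    proof (cases "5 \<in> H")
      case True
      have "n \<in> H" if "n \<noteq> 1" "n \<noteq> 2" for n
      proof (rule gen[OF 4 True])
        show "n mod 3 = 0 \<or> n mod 3 = 1 \<and> 4 \<le> n \<or> n mod 3 = 2 \<and> 5 \<le> n" using that by presburger
      qed simp_all
      then show ?thesis using 1 2 by blast
    next
      case False
      have 8: "8 \<in> H" using H_add[OF 4 4] by simp
      have up: "n \<in> H" if "n mod 3 = 0 \<or> n mod 3 = 1 \<and> 4 \<le> n \<or> n mod 3 = 2 \<and> 8 \<le> n" for n
        by (rule gen[OF 4 8]) (use that in simp_all)
      have iff: "n \<in> H \<longleftrightarrow> n \<noteq> 1 \<and> n \<noteq> 2 \<and> n \<noteq> 5" for n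
      proof
        assume "n \<noteq> 1 \<and> n \<noteq> 2 \<and> n \<noteq> 5"
        then have "n mod 3 = 0 \<or> n mod 3 = 1 \<and> 4 \<le> n \<or> n mod 3 = 2 \<and> 8 \<le> n" by presburger
        then show "n \<in> H" by (rule up)
      qed (use 1 2 False in auto)
      \<comment> \<open>Here \<open>H\<close> is <3, 4>, which is symmetric with largest gap
        5.\<close>
      have False
      proof (rule gap[of 5])
        show "n \<in> H \<longleftrightarrow> 5 - n \<notin> H" if "n \<le> 5" for n using that unfolding iff by presburger
      qed (simp add: iff)
      then show ?thesis ..
    qed
  next
    case 4: False
    then have 5: "5 \<in> H" using 45 by blast
    show ?thesis
    proof (cases "7 \<in> H")
      case True
      have up: "n \<in> H" if "n mod 3 = 0 \<or> n mod 3 = 1 \<and> 7 \<le> n \<or> n mod 3 = 2 \<and> 5 \<le> n" for n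
        by (rule gen[OF True 5]) (use that in simp_all)
      have "n \<in> H" if "n \<noteq> 1" "n \<noteq> 2" "n \<noteq> 4" for n
        by (rule up) (use that in presburger)
      then show ?thesis using 1 2 4 by blast
    next
      case False
      have 10: "10 \<in> H" using H_add[OF 5 5] by simp
      have up: "n \<in> H" if "n mod 3 = 0 \<or> n mod 3 = 1 \<and> 10 \<le> n \<or> n mod 3 = 2 \<and> 5 \<le> n" for n
        by (rule gen[OF 10 5]) (use that in simp_all)
      have iff: "n \<in> H \<longleftrightarrow> n \<noteq> 1 \<and> n \<noteq> 2 \<and> n \<noteq> 4 \<and> n \<noteq> 7" for n
      proof
        assume "n \<noteq> 1 \<and> n \<noteq> 2 \<and> n \<noteq> 4 \<and> n \<noteq> 7"
        then have "n mod 3 = 0 \<or> n mod 3 = 1 \<and> 10 \<le> n \<or> n mod 3 = 2 \<and> 5 \<le> n" by presburger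
        then show "n \<in> H" by (rule up)
      qed (use 1 2 4 False in auto)
      \<comment> \<open>Here \<open>H\<close> is <3, 5>, which is symmetric with largest gap
        7.\<close>
      have False
      proof (rule gap[of 7])
        show "n \<in> H \<longleftrightarrow> 7 - n \<notin> H" if "n \<le> 7" for n using that unfolding iff by presburger
      qed (simp add: iff)
      then show ?thesis ..
    qed
  qed
qed

theorem theorem4p6:
  fixes H :: "nat set"
    and S :: "('k :: {alg_closed_field, field_char_0}) fps ring"
  assumes "numerical_semigroup H"
    and "S = semigroup_ring H"
    and "\<not> gorenstein_local_ring S"
  shows "finite_CM_type S \<longleftrightarrow> H = nat_generated {3, 4, 5} \<or> H = nat_generated {3, 5, 7}"
proof -
  have H: "nat_submonoid H" using assms(1) by (simp add: numerical_semigroup_def)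
  obtain c where "\<And>n. c \<le> n \<Longrightarrow> n \<in> H"
    by (rule numerical_semigroup_conductor[OF assms(1)]) blast
  then interpret semigroup_ring_conductor H c S
    using H assms(2) by unfold_locales auto
  show ?thesis
  proof
    assume "finite_CM_type S"
    then show "H = nat_generated {3, 4, 5} \<or> H = nat_generated {3, 5, 7}"
      using nongorenstein_finite_type[OF infinite_UNIV_char_0 assms(3)]
      by (simp add: nat_generated_345 nat_generated_357)
  next
    assume "H = nat_generated {3, 4, 5} \<or> H = nat_generated {3, 5, 7}"
    then have "n \<in> H" if "n \<notin> {1, 2, 4}" for n
      using that by (auto simp: nat_generated_345 nat_generated_357)
    then show "finite_CM_type S"
      using finite_CM_type_cusp[OF H _ assms(2)] by simp
  qed
qed

end
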